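(* Suppose Condition (Setup) of the context holds and Condition (Mixed-Strong) of the context holds for group $j$ (with $d_{\beta j}>0$). Let $P^S_{j,n,\lambda}(\cdot\mid\omega)$ be the conditional law under the full quasi-posterior $\Pi^{\mathrm{full}}_{n,\lambda}$ of $h_j=\sqrt{n_j}(\beta_j-\widehat\beta_j(\omega))$ given the retained variables $\omega$, let $P^{S,0}_{j,n}(\cdot\mid\omega)$ be the corresponding unpooled ($\lambda=0$) conditional law, and write $H_j(\omega)=H_j(\gamma_j(\omega))$. Then, uniformly over $\lambda\in\Lambda$ and retained $\omega$, $$d_{\mathrm{BL}}\bigl(P^S_{j,n,\lambda}(\cdot\mid\omega),N(0,H_j(\omega)^{-1})\bigr)=o_p(1),\qquad d_{\mathrm{BL}}\bigl(P^{S,0}_{j,n}(\cdot\mid\omega),N(0,H_j(\omega)^{-1})\bigr)=o_p(1),$$ and $$\sup_{\lambda\in\Lambda,\omega}\Bigl\|\int h_j\,P^S_{j,n,\lambda}(dh_j\mid\omega)\Bigr\|+\sup_\omega\Bigl\|\int h_j\,P^{S,0}_{j,n}(dh_j\mid\omega)\Bigr\|=o_p(1).$$ If $\widehat\beta^{\mathrm{un}}_j$ denotes the reported unpooled profiled estimator and $$\sup_{\lambda\in\Lambda}\int\sqrt{n_j}\,\bigl\|\widehat\beta_j(\gamma_j)-\widehat\beta_j^{\mathrm{un}}\bigr\|\,\Pi^{\mathrm{full},W}_{n,\lambda}(d\gamma)=o_p(1),$$ then $$\sup_{\lambda\in\Lambda}\sqrt{n_j}\,\bigl\|\tilde\bet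a^{\mathrm{full}}_{j,n,\lambda}-\widehat\beta^{\mathrm{un}}_j\bigr\|=o_p(1).$$
   Context: **Grouped problem.** There are $J\ge1$ groups. Group $j$ has sample $X_j=(X_{j1},\dots,X_{jn_j})$ with values in $\mathcal X_j$, a fixed covariate $z_j$, and parameter $\alpha_j\in\mathcal A_j\subset\mathbb R^{d_j}$; $\mathcal A=\prod_j\mathcal A_j$, $z=(z_j)_j$. The group criterion is $q_{2,j,n_j}(x_j,a)=-\tfrac12G_{j,n_j}(x_j,a)'W_{j,n_j}G_{j,n_j}(x_j,a)$, $G_{j,n_j}(x_j,a)=n_j^{-1/2}\sum_i\phi_j(x_{ji},a)$, $\phi_j:\mathcal X_j\times\mathcal A_j\to\mathbb R^{k_j}$, with positive definite weight $W_{j,n_j}$; $\bar q_{2,j,n_j}=n_j^{-1}q_{2,j,n_j}$. The pooling objective is $q_1(\alpha,\theta;z)=\sum_jq_{1,j}(\alpha_j,\theta;z_j)$, $\theta\in\Theta\subset\mathbb R^{d_\theta}$. The full quasi-posterior is $\Pi^{\mathrm{full}}_{n,\lambda}(d\alpha\,d\theta\mid X,z)\propto\exp[\sum_jq_{2,j,n_j}(X_j,\alpha_j)+\lambda q_1(\alpha,\theta;z)]\pi_\theta(d\theta)\prod_j\pi_j(d\alpha_j)$. Asymptotics are as all $n_j\to\infty$, under the triangular-array law of the data. **Condition (Setup).** (i) $J$ fixed, $n_j\to\infty$ for every $j$; within group $j$ the observations are i.i.d. under a row law that may depend on $n_j$; groups are independent. (ii) Each $\mathcal A_j$ and $\Theta$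 is compact; $\Lambda\subset[0,\bar\lambda]$ is compact. (iii) With probability approaching one $a\mapsto q_{2,j,n_j}(X_j,a)$ is finite and continuous on $\mathcal A_j$ for each group; $q_1(\cdot,\cdot;z)$ is finite and continuous on $\mathcal A\times\Theta$. (iv) $\pi_j,\pi_\theta$ are proper Borel priors with positive continuous densities relative to fixed dominating measures. **Split coordinates.** $\alpha_j=(\beta_j',\gamma_j')'$ with $\beta_j\in\mathcal B_j\subset\mathbb R^{d_{\beta j}}$ (regular block) and $\gamma_j\in\Gamma_j\subset\mathbb R^{d_{\gamma j}}$ (retained weak block), $\mathcal A_j=\mathcal B_j\times\Gamma_j$. The prior of group $j$ is $p_{\beta j\mid\gamma j}(\beta_j\mid\gamma_j)\,d\beta_j\,\mu_{\gamma j}(d\gamma_j)$. The retained variables $\omega$ are all coordinates of $(\alpha,\theta)$ other than $\beta_j$, ranging over a compact set, and $\gamma_j(\omega)$ is the $\gamma_j$-coordinate of $\omega$. $\gamma$ stacks the weak blocks $\gamma_\ell$ of all groups; $\Pi^{\mathrm{full},W}_{n,\lambda}$ is the marginal law of $\gamma$ under $\Pi^{\mathrm{full}}_{n,\lambda}$; $\tilde\beta^{\mathrm{full}}_{j,n,\lambda}=\int\beta_j\,d\Pi^{\mathrm{full}}_{n,\lambda}$. **Condition (Mixed-Strong)** for group $j$: there is a nonrandom criterion $M_j(\beta,\gamma)$ on $\mathcal B_j\times\Gamma_j$ with: (i) for each $\gamma\in\Gamma_j$, $\beta_{j0}(\gamma)$ is the unique interior maximizer of $M_j(\cdot,\gamma)$;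 $M_j$ is continuous on $\mathcal B_j\times\Gamma_j$, and twice continuously differentiable in $\beta$ on a neighborhood of the graph $\{(\beta_{j0}(\gamma),\gamma):\gamma\in\Gamma_j\}$. (ii) $H_j(\gamma)=-\partial^2_{\beta\beta}M_j(\beta_{j0}(\gamma),\gamma)$ is continuous in $\gamma$ and there is $c_j>0$ with $v'H_j(\gamma)v\ge c_j\|v\|^2$ for all $v$ and $\gamma$. (iii) $\sup_{\mathcal B_j\times\Gamma_j}|\bar q_{2,j,n_j}(X_j,(\beta,\gamma))-M_j(\beta,\gamma)|\xrightarrow{p}0$; there is $\delta_j>0$ such that $\mathcal U_j(\delta_j)=\{(\beta,\gamma):\gamma\in\Gamma_j,\|\beta-\beta_{j0}(\gamma)\|\le\delta_j\}$ lies in the differentiability neighborhood and $\sup_{\mathcal U_j(\delta_j)}\|\nabla^r_\beta\bar q_{2,j,n_j}(X_j,(\beta,\gamma))-\nabla_\beta^rM_j(\beta,\gamma)\|\xrightarrow{p}0$ for $r=1,2$; and $\sup_{\gamma\in\Gamma_j}\|n_j^{-1/2}\nabla_\beta q_{2,j,n_j}(X_j,(\beta_{j0}(\gamma),\gamma))\|=O_p(1)$. (iv) $p_{\beta j\mid\gamma j}$ is positive, continuous in $(\beta_j,\gamma_j)$ and continuously differentiable in $\beta_j$ on $\mathcal U_j(\delta_j)$; for every fixed $z$, $q_1$ as a function of $\beta_j$ (everything else fixed) has first and second partial derivatives on a neighborhood of $\mathcal U_j(\delta_j)$, jointly continuous on the corresponding compact set of retained coordinates. **Conditional maximizer.** $\widehat\beta_j(\omega)=\widehat\beta_j(\gamma_j(\omega))$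 is a measurable maximizer of $\beta\mapsto q_{2,j,n_j}(X_j,(\beta,\gamma_j(\omega)))$ over $\{\|\beta-\beta_{j0}(\gamma_j(\omega))\|\le\delta_j\}$ with $\sup_\omega\sqrt{n_j}\|\widehat\beta_j(\omega)-\beta_{j0}(\gamma_j(\omega))\|=O_p(1)$. The conditional law of $\beta_j$ given $\omega$ has density proportional to $\exp[q_{2,j,n_j}(X_j,(\beta_j,\gamma_j(\omega)))+\lambda q_1]\,p_{\beta j\mid\gamma j}(\beta_j\mid\gamma_j(\omega))$. $d_{\mathrm{BL}}(P,Q)=\sup|\int\varphi\,dP-\int\varphi\,dQ|$ over $\varphi$ with $\|\varphi\|_\infty\le1$ and Lipschitz constant at most $1$. $\widehat\beta_j^{\mathrm{un}}$ is a random vector in $\mathbb R^{d_{\beta j}}$. *)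

theory Defs
  imports "HOL-Probability.Probability"
begin

section \<open>Finite-dimensional vectors whose dimension is a number\<close>

text \<open>
  Different groups have parameter spaces of different dimensions.  A vector of \<open>\<real>\<^sup>d\<close> is therefore
  a real sequence vanishing from index \<open>d\<close> on; on \<open>Rvec d\<close> the product topology and its Borel sets
  are the Euclidean ones.
\<close>

type_synonym rvec = "nat \<Rightarrow> real"

definition Rvec :: "nat \<Rightarrow> rvec set" where
  "Rvec d = {x. \<forall>i\<ge>d. x i = 0}"

text \<open>
  Differentiation, Lebesgue measure and Gaussian laws are only needed for the regular block of one
  group.  There \<open>\<real>\<^sup>d\<close> is also viewed as \<^typ>\<open>real ^ 'b\<close> with \<open>CARD('b) = d\<close>, through the
  enumeration \<^term>\<open>to_nat_on UNIV\<close> of the index type.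
\<close>

definition to_rvec :: "real ^ 'b \<Rightarrow> rvec" where
  "to_rvec b = (\<lambda>i. if i < CARD('b) then b $ from_nat_into UNIV i else 0)"

definition of_rvec :: "rvec \<Rightarrow> real ^ 'b" where
  "of_rvec x = (\<chi> k. x (to_nat_on UNIV k))"

definition pos_def :: "nat \<Rightarrow> (nat \<Rightarrow> nat \<Rightarrow> real) \<Rightarrow> bool" where
  "pos_def k A \<longleftrightarrow> (\<forall>r<k. \<forall>s<k. A r s = A s r) \<and>
     (\<forall>v. (\<exists>r<k. v r \<noteq> 0) \<longrightarrow> 0 < (\<Sum>r<k. \<Sum>s<k. v r * A r s * v s))"


section \<open>Derivatives\<close>

definition gradient :: "(real ^ 'b \<Rightarrow> real) \<Rightarrow> real ^ 'b \<Rightarrow> real ^ 'b" where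
  "gradient f x = (\<chi> i. frechet_derivative f (at x) (axis i 1))"

definition hessian :: "(real ^ 'b \<Rightarrow> real) \<Rightarrow> real ^ 'b \<Rightarrow> real ^ 'b ^ 'b" where
  "hessian f x = matrix (frechet_derivative (gradient f) (at x))"

definition twice_differentiable_at :: "(real ^ 'b \<Rightarrow> real) \<Rightarrow> real ^ 'b \<Rightarrow> bool" where
  "twice_differentiable_at f x \<longleftrightarrow>
     (\<forall>\<^sub>F y in nhds x. f differentiable (at y)) \<and> gradient f differentiable (at x)"

definition has_partial :: "'b \<Rightarrow> (real ^ 'b \<Rightarrow> real) \<Rightarrow> real ^ 'b \<Rightarrow> bool" where
  "has_partial i f x \<longleftrightarrow> (\<lambda>t. f (x + t *\<^sub>R axis i 1)) field_differentiable (at 0)"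

definition partial :: "'b \<Rightarrow> (real ^ 'b \<Rightarrow> real) \<Rightarrow> real ^ 'b \<Rightarrow> real" where
  "partial i f x = deriv (\<lambda>t. f (x + t *\<^sub>R axis i 1)) 0"


section \<open>Stochastic order symbols along a sequence of probability spaces\<close>

text \<open>
  Suprema over uncountable index sets need not be measurable, so all statements use inner
  probability of the good event (equivalently, outer probability of the bad one); for measurable
  events this is the ordinary notion.  The random quantities take values in \<^typ>\<open>ennreal\<close>, so that
  suprema are always meaningful.
\<close>

definition inner_prob_ge :: "'w measure \<Rightarrow> ('w \<Rightarrow> bool) \<Rightarrow> real \<Rightarrow> bool" where
  "inner_prob_ge Pr E c \<longleftrightarrow> (\<exists>A\<in>sets Pr. (\<forall>w\<in>A. E w) \<and> c \<le> measure Pr A)"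

definition wpa1 :: "(nat \<Rightarrow> 'w measure) \<Rightarrow> (nat \<Rightarrow> 'w \<Rightarrow> bool) \<Rightarrow> bool" where
  "wpa1 Pr E \<longleftrightarrow> (\<forall>e>0. \<forall>\<^sub>F t in sequentially. inner_prob_ge (Pr t) (E t) (1 - e))"

definition small_op1 :: "(nat \<Rightarrow> 'w measure) \<Rightarrow> (nat \<Rightarrow> 'w \<Rightarrow> ennreal) \<Rightarrow> bool" where
  "small_op1 Pr Z \<longleftrightarrow> (\<forall>r>0. wpa1 Pr (\<lambda>t w. Z t w \<le> ennreal r))"

definition big_Op1 :: "(nat \<Rightarrow> 'w measure) \<Rightarrow> (nat \<Rightarrow> 'w \<Rightarrow> ennreal) \<Rightarrow> bool" where
  "big_Op1 Pr Z \<longleftrightarrow> (\<forall>e>0. \<exists>K::real. \<forall>\<^sub>F t in sequentially.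
     inner_prob_ge (Pr t) (\<lambda>w. Z t w \<le> ennreal K) (1 - e))"


section \<open>Laws\<close>

definition normalized :: "'a measure \<Rightarrow> ('a \<Rightarrow> real) \<Rightarrow> 'a measure" where
  "normalized M f = density M (\<lambda>x. ennreal (f x) / (\<integral>\<^sup>+ y. ennreal (f y) \<partial>M))"

definition mvnormal :: "real ^ 'b \<Rightarrow> real ^ 'b ^ 'b \<Rightarrow> (real ^ 'b) measure" where
  "mvnormal m \<Sigma> = normalized lborel (\<lambda>x. exp (- (1/2) * ((x - m) \<bullet> (matrix_inv \<Sigma> *v (x - m)))))"

definition d_BL :: "'a::metric_space measure \<Rightarrow> 'a measure \<Rightarrow> ennreal" where
  "d_BL P Q = (SUP f \<in> {f :: 'a \<Rightarrow> real. (\<forall>x. \<bar>f x\<bar> \<le> 1) \<and> 1-lipschitz_on UNIV f}.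
     ennreal \<bar>(\<integral>x. f x \<partial>P) - (\<integral>x. f x \<partial>Q)\<bar>)"


section \<open>The grouped problem\<close>

text \<open>
  Groups are numbered \<open>0, \<dots>, J - 1\<close>, and a group parameter is a pair (regular block, weak block) in
  \<open>Rvec (dim_beta l) \<times> Rvec (dim_gamma l)\<close>; either dimension may be \<open>0\<close>.  Asymptotics run along an
  index \<open>t\<close>: at stage \<open>t\<close> group \<open>l\<close> has \<open>sample_size t l\<close> observations \<open>obs t l i\<close>, random
  variables on the probability space \<open>pspace t\<close>.  The observation spaces of the groups are
  measurable spaces over a common type, which serves as their disjoint union; likewise for the
  covariates.
\<close>

record ('w, 'x, 'z) grouped_problem =
  ngroups :: nat
  dim_beta :: "nat \<Rightarrow> nat"
  dim_gamma :: "nat \<Rightarrow> nat"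
  dim_theta :: nat
  dim_moment :: "nat \<Rightarrow> nat"
  beta_space :: "nat \<Rightarrow> rvec set"
  gamma_space :: "nat \<Rightarrow> rvec set"
  theta_space :: "rvec set"
  tuning_set :: "real set"
  obs_space :: "nat \<Rightarrow> 'x measure"
  moment :: "nat \<Rightarrow> 'x \<Rightarrow> rvec \<times> rvec \<Rightarrow> rvec"
  weight :: "nat \<Rightarrow> nat \<Rightarrow> nat \<Rightarrow> nat \<Rightarrow> real"
    \<comment> \<open>\<open>weight l m r s\<close>: entry \<open>(r, s)\<close> of the weight of group \<open>l\<close> at sample size \<open>m\<close>\<close>
  pool_term :: "nat \<Rightarrow> rvec \<times> rvec \<Rightarrow> rvec \<Rightarrow> 'z \<Rightarrow> real"
  covariate :: "nat \<Rightarrow> 'z"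
  prior :: "nat \<Rightarrow> (rvec \<times> rvec) measure"
  prior_theta :: "rvec measure"
  pspace :: "nat \<Rightarrow> 'w measure"
  sample_size :: "nat \<Rightarrow> nat \<Rightarrow> nat"
  obs :: "nat \<Rightarrow> nat \<Rightarrow> nat \<Rightarrow> 'w \<Rightarrow> 'x"

definition alpha_space :: "('w, 'x, 'z) grouped_problem \<Rightarrow> nat \<Rightarrow> (rvec \<times> rvec) set" where
  "alpha_space S l = beta_space S l \<times> gamma_space S l"

definition alphas :: "('w, 'x, 'z) grouped_problem \<Rightarrow> (nat \<Rightarrow> rvec \<times> rvec) set" where
  "alphas S = (\<Pi>\<^sub>E l\<in>{..<ngroups S}. alpha_space S l)"

definition well_formed :: "('w, 'x, 'z) grouped_problem \<Rightarrow> bool" where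
  "well_formed S \<longleftrightarrow> 1 \<le> ngroups S \<and> theta_space S \<subseteq> Rvec (dim_theta S) \<and>
     (\<forall>l<ngroups S. beta_space S l \<subseteq> Rvec (dim_beta S l) \<and>
        gamma_space S l \<subseteq> Rvec (dim_gamma S l) \<and>
        (\<forall>x\<in>space (obs_space S l). \<forall>a\<in>alpha_space S l. moment S l x a \<in> Rvec (dim_moment S l)) \<and>
        (\<forall>m\<ge>1. pos_def (dim_moment S l) (weight S l m)))"

definition G_stat ::
  "('w, 'x, 'z) grouped_problem \<Rightarrow> nat \<Rightarrow> nat \<Rightarrow> (nat \<Rightarrow> 'x) \<Rightarrow> rvec \<times> rvec \<Rightarrow> rvec" where
  "G_stat S l m x a = (\<lambda>r. (\<Sum>i<m. moment S l (x i) a r) / sqrt (real m))"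

definition q2 ::
  "('w, 'x, 'z) grouped_problem \<Rightarrow> nat \<Rightarrow> nat \<Rightarrow> (nat \<Rightarrow> 'x) \<Rightarrow> rvec \<times> rvec \<Rightarrow> real" where
  "q2 S l m x a = - (1/2) * (\<Sum>r<dim_moment S l. \<Sum>s<dim_moment S l.
     G_stat S l m x a r * weight S l m r s * G_stat S l m x a s)"

definition q2_data ::
  "('w, 'x, 'z) grouped_problem \<Rightarrow> nat \<Rightarrow> nat \<Rightarrow> 'w \<Rightarrow> rvec \<times> rvec \<Rightarrow> real" where
  "q2_data S l t w a = q2 S l (sample_size S t l) (\<lambda>i. obs S t l i w) a"

definition q1 :: "('w, 'x, 'z) grouped_problem \<Rightarrow> (nat \<Rightarrow> rvec \<times> rvec) \<Rightarrow> rvec \<Rightarrow> real" where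
  "q1 S \<alpha> \<theta> = (\<Sum>l<ngroups S. pool_term S l (\<alpha> l) \<theta> (covariate S l))"

text \<open>The dominating measure \<open>D\<close> may live on the whole ambient space.\<close>

definition regular_prior :: "'a::topological_space set \<Rightarrow> 'a measure \<Rightarrow> bool" where
  "regular_prior A \<pi> \<longleftrightarrow> prob_space \<pi> \<and> sets \<pi> = sets borel \<and>
     (\<exists>D f. sets D = sets borel \<and> continuous_on A f \<and> (\<forall>a\<in>A. 0 < f a) \<and>
        \<pi> = density D (\<lambda>a. ennreal (f a) * indicator A a))"

definition setup_cond :: "('w, 'x, 'z) grouped_problem \<Rightarrow> bool" where
  "setup_cond S \<longleftrightarrow>
     (\<forall>l<ngroups S. filterlim (\<lambda>t. sample_size S t l) at_top sequentially) \<and>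
     (\<forall>t. prob_space (pspace S t) \<and>
        prob_space.indep_vars (pspace S t) (\<lambda>(l, i). obs_space S l) (\<lambda>(l, i). obs S t l i)
          (SIGMA l:{..<ngroups S}. {..<sample_size S t l}) \<and>
        (\<forall>l<ngroups S. \<forall>i<sample_size S t l. \<forall>i'<sample_size S t l.
           distr (pspace S t) (obs_space S l) (obs S t l i) =
           distr (pspace S t) (obs_space S l) (obs S t l i'))) \<and>
     (\<forall>l<ngroups S. compact (alpha_space S l)) \<and> compact (theta_space S) \<and>
     compact (tuning_set S) \<and> (\<exists>b. tuning_set S \<subseteq> {0..b}) \<and>
     (\<forall>l<ngroups S. wpa1 (pspace S) (\<lambda>t w. continuous_on (alpha_space S l) (q2_data S l t w))) \<and>
     continuous_on (alphas S \<times> theta_space S) (\<lambda>(\<alpha>, \<theta>). q1 S \<alpha> \<theta>) \<and>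
     (\<forall>l<ngroups S. regular_prior (alpha_space S l) (prior S l)) \<and>
     regular_prior (theta_space S) (prior_theta S)"

text \<open>
  The criteria are only controlled on the parameter space, so the quasi-posterior weight is cut off
  outside of it.
\<close>

definition full_posterior ::
  "('w, 'x, 'z) grouped_problem \<Rightarrow> nat \<Rightarrow> 'w \<Rightarrow> real \<Rightarrow> ((nat \<Rightarrow> rvec \<times> rvec) \<times> rvec) measure" where
  "full_posterior S t w lam =
     normalized ((\<Pi>\<^sub>M l\<in>{..<ngroups S}. prior S l) \<Otimes>\<^sub>M prior_theta S)
       (\<lambda>(\<alpha>, \<theta>). if \<alpha> \<in> alphas S \<and> \<theta> \<in> theta_space S
          then exp ((\<Sum>l<ngroups S. q2_data S l t w (\<alpha> l)) + lam * q1 S \<alpha> \<theta>) else 0)"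

definition weak_marginal ::
  "('w, 'x, 'z) grouped_problem \<Rightarrow> nat \<Rightarrow> 'w \<Rightarrow> real \<Rightarrow> (nat \<Rightarrow> rvec) measure" where
  "weak_marginal S t w lam = distr (full_posterior S t w lam) (\<Pi>\<^sub>M l\<in>{..<ngroups S}. borel)
     (\<lambda>(\<alpha>, \<theta>). \<lambda>l\<in>{..<ngroups S}. snd (\<alpha> l))"

definition beta_tilde ::
  "('w, 'x, 'z) grouped_problem \<Rightarrow> nat \<Rightarrow> nat \<Rightarrow> 'w \<Rightarrow> real \<Rightarrow> real ^ 'b" where
  "beta_tilde S j t w lam = (\<integral>(\<alpha>, \<theta>). of_rvec (fst (\<alpha> j)) \<partial>full_posterior S t w lam)"


section \<open>The split group\<close>

text \<open>From here on, \<open>CARD('b) = dim_beta S j\<close> is understood.\<close>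

definition Bset :: "('w, 'x, 'z) grouped_problem \<Rightarrow> nat \<Rightarrow> (real ^ 'b) set" where
  "Bset S j = {b. to_rvec b \<in> beta_space S j}"

definition q2_split ::
  "('w, 'x, 'z) grouped_problem \<Rightarrow> nat \<Rightarrow> nat \<Rightarrow> 'w \<Rightarrow> real ^ 'b \<Rightarrow> rvec \<Rightarrow> real" where
  "q2_split S j t w b g = q2_data S j t w (to_rvec b, g)"

definition q2_bar ::
  "('w, 'x, 'z) grouped_problem \<Rightarrow> nat \<Rightarrow> nat \<Rightarrow> 'w \<Rightarrow> real ^ 'b \<Rightarrow> rvec \<Rightarrow> real" where
  "q2_bar S j t w b g = q2_split S j t w b g / real (sample_size S t j)"

text \<open>
  The prior of group \<open>j\<close> is \<open>p(b | g) db \<mu>(dg)\<close>, with \<open>p(\<cdot> | g)\<close> a probability density on the regular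
  block for every \<open>g\<close>.
\<close>

definition split_prior :: "('w, 'x, 'z) grouped_problem \<Rightarrow> nat \<Rightarrow>
    (real ^ 'b \<Rightarrow> rvec \<Rightarrow> real) \<Rightarrow> rvec measure \<Rightarrow> bool" where
  "split_prior S j p \<mu> \<longleftrightarrow>
     prob_space \<mu> \<and> sets \<mu> = sets borel \<and> emeasure \<mu> (UNIV - gamma_space S j) = 0 \<and>
     (\<forall>b\<in>Bset S j. \<forall>g\<in>gamma_space S j. 0 \<le> p b g) \<and>
     (\<lambda>(b, g). p b g * indicator (Bset S j \<times> gamma_space S j) (b, g)) \<in> borel_measurable borel \<and>
     (\<forall>g\<in>gamma_space S j. (\<integral>\<^sup>+ b\<in>Bset S j. ennreal (p b g) \<partial>lborel) = 1) \<and>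
     prior S j = distr
       (density (lborel \<Otimes>\<^sub>M \<mu>)
          (\<lambda>(b, g). ennreal (p b g) * indicator (Bset S j \<times> gamma_space S j) (b, g)))
       borel (\<lambda>(b, g). (to_rvec b, g))"

text \<open>
  Retained variables \<open>\<omega> = (a, g, \<theta>)\<close>: the parameters \<open>a\<close> of the groups other than \<open>j\<close>, the weak
  block \<open>g\<close> of group \<open>j\<close>, and \<open>\<theta>\<close>.
\<close>

type_synonym retained = "(nat \<Rightarrow> rvec \<times> rvec) \<times> rvec \<times> rvec"

definition retained_space :: "('w, 'x, 'z) grouped_problem \<Rightarrow> nat \<Rightarrow> retained set" where
  "retained_space S j =
     (\<Pi>\<^sub>E l\<in>{..<ngroups S} - {j}. alpha_space S l) \<times> gamma_space S j \<times> theta_space S"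

definition gamma_of :: "retained \<Rightarrow> rvec" where
  "gamma_of \<omega> = fst (snd \<omega>)"

definition q1_split ::
  "('w, 'x, 'z) grouped_problem \<Rightarrow> nat \<Rightarrow> real ^ 'b \<Rightarrow> retained \<Rightarrow> real" where
  "q1_split S j b \<omega> = (case \<omega> of (a, g, \<theta>) \<Rightarrow> q1 S (a(j := (to_rvec b, g))) \<theta>)"

definition tube :: "('w, 'x, 'z) grouped_problem \<Rightarrow> nat \<Rightarrow> (rvec \<Rightarrow> real ^ 'b) \<Rightarrow> real \<Rightarrow>
    ((real ^ 'b) \<times> rvec) set" where
  "tube S j \<beta>0 \<delta> = {(b, g). g \<in> gamma_space S j \<and> norm (b - \<beta>0 g) \<le> \<delta>}"

definition H_mat :: "(real ^ 'b \<Rightarrow> rvec \<Rightarrow> real) \<Rightarrow> (rvec \<Rightarrow> real ^ 'b) \<Rightarrow> rvec \<Rightarrow> real ^ 'b ^ 'b" where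
  "H_mat M \<beta>0 g = - hessian (\<lambda>b. M b g) (\<beta>0 g)"

text \<open>
  Neighborhoods are relatively open in \<open>\<real>\<^sup>d \<times> \<Gamma>\<close>, where \<open>d\<close> is the dimension of the regular block, and
  lie in the domain \<open>B \<times> \<Gamma>\<close>.  The second order smoothness of \<open>M\<close> in \<open>b\<close> is joint in \<open>(b, g)\<close>: with
  continuity in \<open>b\<close> for each single \<open>g\<close> only, no Gaussian limit uniform in \<open>g\<close> could be expected.
  Convergence in probability of the derivatives of the sample criterion presupposes that they exist
  with probability approaching one.
\<close>

definition mixed_strong :: "('w, 'x, 'z) grouped_problem \<Rightarrow> nat \<Rightarrow>
    (real ^ 'b \<Rightarrow> rvec \<Rightarrow> real) \<Rightarrow> (rvec \<Rightarrow> real ^ 'b) \<Rightarrow> real \<Rightarrow>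
    (real ^ 'b \<Rightarrow> rvec \<Rightarrow> real) \<Rightarrow> bool" where
  "mixed_strong S j M \<beta>0 \<delta> p \<longleftrightarrow>
     (\<forall>g\<in>gamma_space S j. \<beta>0 g \<in> interior (Bset S j) \<and>
        (\<forall>b\<in>Bset S j. b \<noteq> \<beta>0 g \<longrightarrow> M b g < M (\<beta>0 g) g)) \<and>
     continuous_on (Bset S j \<times> gamma_space S j) (\<lambda>(b, g). M b g) \<and>
     0 < \<delta> \<and>
     (\<exists>N. openin (top_of_set (UNIV \<times> gamma_space S j)) N \<and> N \<subseteq> Bset S j \<times> gamma_space S j \<and>
        (\<forall>g\<in>gamma_space S j. (\<beta>0 g, g) \<in> N) \<and> tube S j \<beta>0 \<delta> \<subseteq> N \<and>
        (\<forall>(b, g)\<in>N. twice_differentiable_at (\<lambda>b. M b g) b) \<and>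
        continuous_on N (\<lambda>(b, g). gradient (\<lambda>b. M b g) b) \<and>
        continuous_on N (\<lambda>(b, g). hessian (\<lambda>b. M b g) b)) \<and>
     continuous_on (gamma_space S j) (H_mat M \<beta>0) \<and>
     (\<exists>c>0. \<forall>g\<in>gamma_space S j. \<forall>v. v \<bullet> (H_mat M \<beta>0 g *v v) \<ge> c * (norm v)\<^sup>2) \<and>
     small_op1 (pspace S) (\<lambda>t w. SUP (b, g)\<in>Bset S j \<times> gamma_space S j.
        ennreal \<bar>q2_bar S j t w b g - M b g\<bar>) \<and>
     wpa1 (pspace S) (\<lambda>t w. \<forall>(b, g)\<in>tube S j \<beta>0 \<delta>.
        twice_differentiable_at (\<lambda>b. q2_bar S j t w b g) b) \<and>
     small_op1 (pspace S) (\<lambda>t w. SUP (b, g)\<in>tube S j \<beta>0 \<delta>.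
        ennreal (norm (gradient (\<lambda>b. q2_bar S j t w b g) b - gradient (\<lambda>b. M b g) b))) \<and>
     small_op1 (pspace S) (\<lambda>t w. SUP (b, g)\<in>tube S j \<beta>0 \<delta>.
        ennreal (norm (hessian (\<lambda>b. q2_bar S j t w b g) b - hessian (\<lambda>b. M b g) b))) \<and>
     big_Op1 (pspace S) (\<lambda>t w. SUP g\<in>gamma_space S j.
        ennreal (norm ((1 / sqrt (real (sample_size S t j))) *\<^sub>R
          gradient (\<lambda>b. q2_split S j t w b g) (\<beta>0 g)))) \<and>
     (\<forall>(b, g)\<in>tube S j \<beta>0 \<delta>. 0 < p b g \<and> (\<lambda>b. p b g) differentiable (at b)) \<and>
     continuous_on (tube S j \<beta>0 \<delta>) (\<lambda>(b, g). p b g) \<and>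
     (\<forall>g\<in>gamma_space S j. continuous_on (cball (\<beta>0 g) \<delta>) (gradient (\<lambda>b. p b g))) \<and>
     (\<exists>N. openin (top_of_set (UNIV \<times> gamma_space S j)) N \<and> N \<subseteq> Bset S j \<times> gamma_space S j \<and>
        tube S j \<beta>0 \<delta> \<subseteq> N \<and>
        (\<forall>\<omega>\<in>retained_space S j. \<forall>b. (b, gamma_of \<omega>) \<in> N \<longrightarrow>
           (\<forall>i. has_partial i (\<lambda>b. q1_split S j b \<omega>) b \<and>
              (\<forall>k. has_partial k (partial i (\<lambda>b. q1_split S j b \<omega>)) b)))) \<and>
     (\<forall>i. continuous_on {(b, \<omega>). \<omega> \<in> retained_space S j \<and> (b, gamma_of \<omega>) \<in> tube S j \<beta>0 \<delta>}
        (\<lambda>(b, \<omega>). partial i (\<lambda>b. q1_split S j b \<omega>) b)) \<and>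
     (\<forall>i k. continuous_on {(b, \<omega>). \<omega> \<in> retained_space S j \<and> (b, gamma_of \<omega>) \<in> tube S j \<beta>0 \<delta>}
        (\<lambda>(b, \<omega>). partial k (partial i (\<lambda>b. q1_split S j b \<omega>)) b))"

text \<open>
  A maximizer need only exist where the criterion is continuous, hence with probability
  approaching one.
\<close>

definition conditional_maximizer :: "('w, 'x, 'z) grouped_problem \<Rightarrow> nat \<Rightarrow>
    (rvec \<Rightarrow> real ^ 'b) \<Rightarrow> real \<Rightarrow> (nat \<Rightarrow> 'w \<Rightarrow> rvec \<Rightarrow> real ^ 'b) \<Rightarrow> bool" where
  "conditional_maximizer S j \<beta>0 \<delta> \<beta>hat \<longleftrightarrow>
     (\<forall>t. (\<lambda>(w, g). \<beta>hat t w g) \<in>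
        borel_measurable (pspace S t \<Otimes>\<^sub>M restrict_space borel (gamma_space S j))) \<and>
     wpa1 (pspace S) (\<lambda>t w. \<forall>g\<in>gamma_space S j. norm (\<beta>hat t w g - \<beta>0 g) \<le> \<delta> \<and>
        (\<forall>b. norm (b - \<beta>0 g) \<le> \<delta> \<longrightarrow> q2_split S j t w b g \<le> q2_split S j t w (\<beta>hat t w g) g)) \<and>
     big_Op1 (pspace S) (\<lambda>t w. SUP \<omega>\<in>retained_space S j.
        ennreal (sqrt (real (sample_size S t j)) *
          norm (\<beta>hat t w (gamma_of \<omega>) - \<beta>0 (gamma_of \<omega>))))"

text \<open>
  Given the retained variables, the factors of the full quasi-posterior not involving the regular
  block of group \<open>j\<close> cancel; this fixes a version of the conditional law for every \<open>\<omega>\<close>.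
\<close>

definition cond_law :: "('w, 'x, 'z) grouped_problem \<Rightarrow> nat \<Rightarrow> (real ^ 'b \<Rightarrow> rvec \<Rightarrow> real) \<Rightarrow>
    nat \<Rightarrow> 'w \<Rightarrow> real \<Rightarrow> retained \<Rightarrow> (real ^ 'b) measure" where
  "cond_law S j p t w lam \<omega> = normalized lborel
     (\<lambda>b. if b \<in> Bset S j
        then exp (q2_split S j t w b (gamma_of \<omega>) + lam * q1_split S j b \<omega>) * p b (gamma_of \<omega>)
        else 0)"

text \<open>The unpooled conditional law is the case \<open>lam = 0\<close>.\<close>

definition PS :: "('w, 'x, 'z) grouped_problem \<Rightarrow> nat \<Rightarrow> (real ^ 'b \<Rightarrow> rvec \<Rightarrow> real) \<Rightarrow>
    (nat \<Rightarrow> 'w \<Rightarrow> rvec \<Rightarrow> real ^ 'b) \<Rightarrow> nat \<Rightarrow> 'w \<Rightarrow> real \<Rightarrow> retained \<Rightarrow> (real ^ 'b) measure" where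
  "PS S j p \<beta>hat t w lam \<omega> = distr (cond_law S j p t w lam \<omega>) borel
     (\<lambda>b. sqrt (real (sample_size S t j)) *\<^sub>R (b - \<beta>hat t w (gamma_of \<omega>)))"

end

theory Submission
  imports Defs
begin

text \<open>
  Write \<open>h = \<surd>n (b - m)\<close> with \<open>m\<close> the conditional maximizer, and divide the conditional density by its
  value at \<open>m\<close>.  On a fixed small ball around \<open>\<beta>0 g\<close> the criterion is expanded to second order at \<open>m\<close>,
  where its gradient vanishes because \<open>m\<close> is eventually an interior maximizer; the Hessian there is
  uniformly within \<open>\<rho>\<close> of \<open>- H\<close>, and the pooling term and the prior change by a factor within \<open>\<rho>\<close> of 1.
  Hence the rescaled density differs from \<open>\<phi> h = exp (- h \<bullet> H h / 2)\<close> by at most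
  \<open>\<rho> (1 + \<parallel>h\<parallel>\<^sup>2) exp (- c \<parallel>h\<parallel>\<^sup>2 / 4)\<close>.  Off the ball, separation of the maximum makes it \<open>exp (- 2 \<eta> n)\<close>
  times a probability density.  So the distance to \<open>\<phi>\<close> in \<open>L\<^sup>1\<close> with weight \<open>1 + \<parallel>h\<parallel>\<close> is small
  uniformly, which bounds both the bounded Lipschitz distance and the mean, the Gaussian being
  centered.  Only consistency of \<open>m\<close> is used, not its rate.  For the full posterior mean, the
  bound on the conditional means is integrated over the retained variables by Fubini's theorem.
\<close>

text \<open>Uniformity over uncountably many \<open>lam\<close> and \<omega> is the obstacle: the
  exceptional event may not depend on them. All probability is therefore spent on finitely many
  events, each already a statement about all parameters. On their intersection the Laplace bound is
  a deterministic inequality with constants that come from compactness: \<rho> is chosen from the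
  target accuracy, the radius \<epsilon> from \<rho>, the gap \<eta> from \<epsilon>, and only then
  does the sample size grow. Compactness of the tube rests on continuity of \<open>\<beta>0\<close>,
  which is derived from uniqueness of the maximizer. The conditional law is given by a formula, not
  by disintegration, so the passage to the posterior mean rests on an identity: prior density times
  posterior weight is a factor free of the regular block times the conditional kernel. Unnormalized
  kernels are used there, which avoids dividing by section masses that vanish off the retained
  space.\<close>

section \<open>Inner probability and stochastic order symbols\<close>

lemma inner_prob_ge_mono:
  assumes "inner_prob_ge P E c" and "\<And>w. w \<in> space P \<Longrightarrow> E w \<Longrightarrow> F w"
  shows "inner_prob_ge P F c"
  using assms sets.sets_into_space unfolding inner_prob_ge_def by (metis subsetD)

lemma (in prob_space) inner_prob_ge_conj:
  assumes "inner_prob_ge M E (1 - a)" and "inner_prob_ge M F (1 - b)"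
  shows "inner_prob_ge M (\<lambda>w. E w \<and> F w) (1 - (a + b))"
proof -
  obtain A B where A: "A \<in> sets M" "\<forall>w\<in>A. E w" "1 - a \<le> prob A"
    and B: "B \<in> sets M" "\<forall>w\<in>B. F w" "1 - b \<le> prob B"
    using assms unfolding inner_prob_ge_def by auto
  have "prob (space M - (A \<inter> B)) \<le> prob (space M - A) + prob (space M - B)"
    unfolding Diff_Int using A(1) B(1) by (intro measure_Un_le) auto
  then have "1 - (a + b) \<le> prob (A \<inter> B)"
    using A B by (simp add: prob_compl)
  then show ?thesis
    unfolding inner_prob_ge_def using A B by (intro bexI[of _ "A \<inter> B"]) auto
qed

text \<open>The implication is asked only for large indices, so that conditions on the sample size
  alone can enter it; restricting to the sample space later gives access to measurability of
  \<open>\<beta>hat\<close> at a fixed outcome.\<close>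

lemma wpa1_mono:
  assumes "wpa1 Pr E"
    and "\<forall>\<^sub>F t in sequentially. \<forall>w\<in>space (Pr t). E t w \<longrightarrow> F t w"
  shows "wpa1 Pr F"
  unfolding wpa1_def
proof (intro allI impI)
  fix e :: real assume "0 < e"
  then have "\<forall>\<^sub>F t in sequentially. inner_prob_ge (Pr t) (E t) (1 - e)"
    using assms(1) by (simp add: wpa1_def)
  with assms(2) show "\<forall>\<^sub>F t in sequentially. inner_prob_ge (Pr t) (F t) (1 - e)"
    by eventually_elim (auto intro: inner_prob_ge_mono)
qed

lemma wpa1_conj:
  assumes "\<And>t. prob_space (Pr t)" and "wpa1 Pr E" and "wpa1 Pr F"
  shows "wpa1 Pr (\<lambda>t w. E t w \<and> F t w)"
  unfolding wpa1_def
proof (intro allI impI)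
  fix e :: real assume "0 < e"
  then have "\<forall>\<^sub>F t in sequentially. inner_prob_ge (Pr t) (E t) (1 - e / 2)"
    "\<forall>\<^sub>F t in sequentially. inner_prob_ge (Pr t) (F t) (1 - e / 2)"
    using assms(2,3) by (simp_all add: wpa1_def)
  then show "\<forall>\<^sub>F t in sequentially. inner_prob_ge (Pr t) (\<lambda>w. E t w \<and> F t w) (1 - e)"
    by eventually_elim (use prob_space.inner_prob_ge_conj[OF assms(1), of _ _ "e/2" _ "e/2"] in auto)
qed

lemma wpa1_True:
  assumes "\<And>t. prob_space (Pr t)"
  shows "wpa1 Pr (\<lambda>t w. True)"
  unfolding wpa1_def inner_prob_ge_def
  using prob_space.prob_space[OF assms] by (auto intro!: always_eventually bexI[OF _ sets.top])

lemma wpa1_ball: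
  assumes "\<And>t. prob_space (Pr t)" and "finite I" and "\<And>i. i \<in> I \<Longrightarrow> wpa1 Pr (\<lambda>t. E t i)"
  shows "wpa1 Pr (\<lambda>t w. \<forall>i\<in>I. E t i w)"
  using assms(2,3)
proof (induction I)
  case empty
  then show ?case using wpa1_True[OF assms(1)] by simp
next
  case (insert i I)
  then show ?case using wpa1_conj[OF assms(1), where E="\<lambda>t. E t i" and F="\<lambda>t w. \<forall>i\<in>I. E t i w"] by simp
qed

text \<open>Turns a bound on a supremum into one event that serves all indices at once.\<close>

lemma small_op1_SUP:
  assumes "small_op1 Pr (\<lambda>t w. SUP x\<in>X. Z t w x)" and "0 < r"
  shows "wpa1 Pr (\<lambda>t w. \<forall>x\<in>X. Z t w x \<le> ennreal r)"
  using assms by (simp add: small_op1_def SUP_le_iff)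

text \<open>A bound in probability at the diverging rate \<open>a\<close> is spent to get plain
  consistency.\<close>

lemma wpa1_le_of_big_Op1:
  assumes "big_Op1 Pr (\<lambda>t w. SUP x\<in>X. ennreal (a t * Z t w x))"
    and a: "filterlim a at_top sequentially" and "0 < r"
  shows "wpa1 Pr (\<lambda>t w. \<forall>x\<in>X. Z t w x \<le> r)"
  unfolding wpa1_def
proof (intro allI impI)
  fix e :: real assume "0 < e"
  then obtain K where
    K: "\<forall>\<^sub>F t in sequentially. inner_prob_ge (Pr t) (\<lambda>w. (SUP x\<in>X. ennreal (a t * Z t w x)) \<le> ennreal K) (1 - e)"
    using assms(1) unfolding big_Op1_def by blast
  \<comment> \<open>The entry 1 makes \<open>a t\<close> positive, so that it can be cancelled at
    the end; the absolute value covers a negative \<open>K\<close>, for which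
    \<open>ennreal K\<close> is 0.\<close>
  have "\<forall>\<^sub>F t in sequentially. max 1 (\<bar>K\<bar> / r) \<le> a t"
    using a unfolding filterlim_at_top by blast
  with K show "\<forall>\<^sub>F t in sequentially. inner_prob_ge (Pr t) (\<lambda>w. \<forall>x\<in>X. Z t w x \<le> r) (1 - e)"
  proof eventually_elim
    case (elim t)
    show ?case
    proof (rule inner_prob_ge_mono[OF elim(1)], rule ballI)
      fix w x assume "(SUP x\<in>X. ennreal (a t * Z t w x)) \<le> ennreal K" "x \<in> X"
      then have "ennreal (a t * Z t w x) \<le> ennreal \<bar>K\<bar>"
        by (metis SUP_le_iff abs_ge_self ennreal_leI order_trans)
      then have "a t * Z t w x \<le> \<bar>K\<bar>" by (simp add: ennreal_le_iff)
      also have "\<bar>K\<bar> \<le> a t * r" using elim(2) \<open>0 < r\<close> by (simp add: field_simps)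
      finally show "Z t w x \<le> r" using elim(2) by simp
    qed
  qed
qed

section \<open>Normalized densities\<close>

lemma normalized_eq_density:
  assumes f: "integrable M f" "\<And>x. 0 \<le> f x" and Z: "0 < integral\<^sup>L M f"
  shows "normalized M f = density M (\<lambda>x. ennreal (f x / integral\<^sup>L M f))"
  using assms unfolding normalized_def
  by (auto simp: nn_integral_eq_integral divide_ennreal intro!: arg_cong[where f="density M"])

lemma integral_normalized:
  fixes u :: "'a \<Rightarrow> 'b::{banach, second_countable_topology}"
  assumes f: "integrable M f" "\<And>x. 0 \<le> f x" and Z: "0 < integral\<^sup>L M f"
    and u: "u \<in> borel_measurable M"
  shows "(\<integral>x. u x \<partial>normalized M f) = (1 / integral\<^sup>L M f) *\<^sub>R (\<integral>x. f x *\<^sub>R u x \<partial>M)"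
proof -
  have "(\<integral>x. u x \<partial>normalized M f) = (\<integral>x. (f x / integral\<^sup>L M f) *\<^sub>R u x \<partial>M)"
    unfolding normalized_eq_density[OF f Z]
    using f Z u by (subst integral_density) auto
  also have "\<dots> = (\<integral>x. (1 / integral\<^sup>L M f) *\<^sub>R (f x *\<^sub>R u x) \<partial>M)"
    by simp
  finally show ?thesis by (simp only: integral_scaleR_right)
qed

text \<open>Lets the conditional kernel be divided by its value at the maximizer. The cancellation
  takes place in \<open>ennreal\<close>, so total mass 0 or infinity is covered as well.\<close>

lemma normalized_cmult:
  assumes "0 < c" and [measurable]: "f \<in> borel_measurable M" and nn: "\<And>x. 0 \<le> f x"
  shows "normalized M (\<lambda>x. c * f x) = normalized M f"
proof -
  have c: "ennreal c \<noteq> 0" "ennreal c \<noteq> top" using assms(1) by auto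
  have "(\<integral>\<^sup>+ y. ennreal (c * f y) \<partial>M) = ennreal c * (\<integral>\<^sup>+ y. ennreal (f y) \<partial>M)"
    using assms by (simp add: ennreal_mult nn_integral_cmult)
  then have "ennreal (c * f x) / (\<integral>\<^sup>+ y. ennreal (c * f y) \<partial>M) = ennreal (f x) / (\<integral>\<^sup>+ y. ennreal (f y) \<partial>M)" for x
    using c assms(1) nn[of x] by (simp add: ennreal_mult mult.commute[of "ennreal c"] divide_mult_eq)
  then show ?thesis unfolding normalized_def by simp
qed

text \<open>The Jacobian appears in numerator and normalizer alike, so the rescaled law is just the
  kernel read in the new coordinates and normalized afresh.\<close>

lemma distr_normalized_lborel_affine:
  fixes k :: "'a::euclidean_space \<Rightarrow> real"
  assumes s: "0 < s" and [measurable]: "k \<in> borel_measurable borel" and nn: "\<And>x. 0 \<le> k x"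
  shows "distr (normalized lborel k) borel (\<lambda>b. s *\<^sub>R (b - m)) =
    normalized lborel (\<lambda>h. k (m + (1 / s) *\<^sub>R h))"
proof -
  define A where "A = (\<lambda>h::'a. m + (1 / s) *\<^sub>R h)"
  define C where "C = ennreal (1 / s) ^ DIM('a)"
  have [measurable]: "A \<in> borel_measurable borel" unfolding A_def by measurable
  \<comment> \<open>Lebesgue measure is written as a weighted image under \<open>A\<close>; then
    \<open>density_distr\<close> pulls the kernel back, and the map \<open>h = s (b - m)\<close>
    undoes \<open>A\<close>.\<close>
  have L: "(lborel :: 'a measure) = density (distr lborel borel A) (\<lambda>_. C)"
    using lborel_affine[of "1 / s" m] s unfolding A_def C_def by (simp add: ennreal_power)
  have C: "C \<noteq> 0" "C \<noteq> top"
    using s by (auto simp: C_def ennreal_power power_eq_top_ennreal simp del: power_divide)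
  have Z: "(\<integral>\<^sup>+ y. ennreal (k y) \<partial>lborel) = C * (\<integral>\<^sup>+ y. ennreal (k (A y)) \<partial>lborel)"
    by (subst L) (simp add: nn_integral_density nn_integral_distr nn_integral_cmult)
  have "normalized lborel k = density (density (distr lborel borel A) (\<lambda>_. C))
      (\<lambda>x. ennreal (k x) / (\<integral>\<^sup>+ y. ennreal (k y) \<partial>lborel))"
    unfolding normalized_def by (subst L) simp
  also have "\<dots> = density (distr lborel borel A) (\<lambda>x. C * (ennreal (k x) / (C * (\<integral>\<^sup>+ y. ennreal (k (A y)) \<partial>lborel))))"
    unfolding Z by (subst density_density_eq) simp_all
  also have "\<dots> = density (distr lborel borel A) (\<lambda>x. ennreal (k x) / (\<integral>\<^sup>+ y. ennreal (k (A y)) \<partial>lborel))"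
    using C by (simp add: ennreal_times_divide mult.commute[of C] divide_mult_eq)
  also have "\<dots> = distr (normalized lborel (\<lambda>h. k (A h))) borel A"
    unfolding normalized_def by (subst density_distr) simp_all
  finally have "distr (normalized lborel k) borel (\<lambda>b. s *\<^sub>R (b - m)) =
     distr (normalized lborel (\<lambda>h. k (A h))) borel ((\<lambda>b. s *\<^sub>R (b - m)) \<circ> A)"
    by (simp add: distr_distr normalized_def)
  also have "(\<lambda>b. s *\<^sub>R (b - m)) \<circ> A = (\<lambda>h. h)"
    using s by (auto simp: A_def)
  also have "distr (normalized lborel (\<lambda>h. k (A h))) borel (\<lambda>h. h) = normalized lborel (\<lambda>h. k (A h))"
    by (rule distr_id2) (simp add: normalized_def)
  finally show ?thesis by (simp add: A_def)
qed

text \<open>Reflection invariance of Lebesgue measure. It centers the Gaussian without any moment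
  computation.\<close>

lemma integral_lborel_odd:
  fixes u :: "'a::euclidean_space \<Rightarrow> 'b::{banach, second_countable_topology}"
  assumes [measurable]: "u \<in> borel_measurable borel" and odd: "\<And>h. u (- h) = - u h"
  shows "(\<integral>h. u h \<partial>lborel) = 0"
proof -
  have L: "(lborel :: 'a measure) = distr lborel borel uminus"
    using lborel_affine[of "-1" "0::'a"] by (simp add: density_1 one_ennreal_def[symmetric])
  have "(\<integral>h. u h \<partial>lborel) = (\<integral>h. u h \<partial>distr lborel borel uminus)"
    by (rule arg_cong[OF L, of "\<lambda>N. integral\<^sup>L N u"])
  also have "\<dots> = (\<integral>h. u (- h) \<partial>lborel)"
    by (rule integral_distr) auto
  finally have "(\<integral>h. u h \<partial>lborel) = (\<integral>h. u (- h) \<partial>lborel)" .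
  then have "(\<integral>h. u h \<partial>lborel) = - (\<integral>h. u h \<partial>lborel)"
    by (simp add: odd)
  then have "2 *\<^sub>R (\<integral>h. u h \<partial>lborel) = 0"
    by (metis add.right_inverse scaleR_2)
  then show ?thesis by simp
qed

text \<open>The weight \<open>1 + norm h\<close> dominates bounded test functions, the constant 1
  and the identity together, so one weighted bound controls numerators and normalizers. The lower
  bound \<open>z\<close> on the mass of \<phi> and \<open>D \<le> z / 2\<close> keep the mass of
  \<open>f\<close> above \<open>z / 2\<close>.\<close>

lemma normalized_close:
  fixes f \<phi> :: "'a::euclidean_space \<Rightarrow> real"
  assumes [measurable]: "f \<in> borel_measurable borel" and f0: "\<And>h. 0 \<le> f h"
    and \<phi>: "integrable lborel \<phi>" "\<And>h. 0 \<le> \<phi> h" "\<And>h. \<phi> (- h) = \<phi> h"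
    and \<phi>1: "integrable lborel (\<lambda>h. norm h * \<phi> h)"
    and D: "(\<integral>\<^sup>+h. ennreal ((1 + norm h) * \<bar>f h - \<phi> h\<bar>) \<partial>lborel) \<le> ennreal D"
    and z: "0 < z" "z \<le> integral\<^sup>L lborel \<phi>" and Dz: "0 \<le> D" "D \<le> z / 2"
  shows "integrable lborel f" "0 < integral\<^sup>L lborel f"
    and "d_BL (normalized lborel f) (normalized lborel \<phi>) \<le> ennreal (2 * D / z)"
    and "norm (\<integral>h. h \<partial>normalized lborel f) \<le> 2 * D / z"
proof -
  have [measurable]: "\<phi> \<in> borel_measurable borel" using \<phi>(1) by auto
  have int1: "integrable lborel (\<lambda>h. (1 + norm h) * \<bar>f h - \<phi> h\<bar>)"
    by (rule integrableI_bounded) (use D in \<open>auto simp: order_le_less_trans\<close>)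
  have int1_le: "(\<integral>h. (1 + norm h) * \<bar>f h - \<phi> h\<bar> \<partial>lborel) \<le> D"
    using D Dz by (subst (asm) nn_integral_eq_integral[OF int1]) auto
  have intu: "integrable lborel (\<lambda>h. (f h - \<phi> h) *\<^sub>R u h)"
    and intu_le: "norm (\<integral>h. (f h - \<phi> h) *\<^sub>R u h \<partial>lborel) \<le> D"
    if [measurable]: "u \<in> borel_measurable borel" and u: "\<And>h. norm (u h) \<le> 1 + norm h"
    for u :: "'a \<Rightarrow> 'c::{banach, second_countable_topology}"
  proof -
    have le: "norm ((f h - \<phi> h) *\<^sub>R u h) \<le> (1 + norm h) * \<bar>f h - \<phi> h\<bar>" for h
      using mult_left_mono[OF u, of "\<bar>f h - \<phi> h\<bar>"] by (simp add: mult.commute)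
    show i: "integrable lborel (\<lambda>h. (f h - \<phi> h) *\<^sub>R u h)"
      by (rule Bochner_Integration.integrable_bound[OF int1]) (use le in auto)
    have "norm (\<integral>h. (f h - \<phi> h) *\<^sub>R u h \<partial>lborel) \<le> (\<integral>h. (1 + norm h) * \<bar>f h - \<phi> h\<bar> \<partial>lborel)"
      by (rule order_trans[OF integral_norm_bound integral_mono[OF integrable_norm[OF i] int1 le]])
    with int1_le show "norm (\<integral>h. (f h - \<phi> h) *\<^sub>R u h \<partial>lborel) \<le> D" by simp
  qed
  have d: "integrable lborel (\<lambda>h. f h - \<phi> h)" and d_le: "\<bar>\<integral>h. f h - \<phi> h \<partial>lborel\<bar> \<le> D"
    using intu[of "\<lambda>_. 1::real"] intu_le[of "\<lambda>_. 1::real"] by auto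
  show f: "integrable lborel f"
    using Bochner_Integration.integrable_add[OF d \<phi>(1)] by simp
  have Zd: "\<bar>integral\<^sup>L lborel f - integral\<^sup>L lborel \<phi>\<bar> \<le> D"
    using d_le f \<phi>(1) by simp
  then have Zf: "z / 2 \<le> integral\<^sup>L lborel f" using z Dz by linarith
  then show Zf0: "0 < integral\<^sup>L lborel f" using z by linarith
  have Z\<phi>: "0 < integral\<^sup>L lborel \<phi>" using z by linarith
  show "d_BL (normalized lborel f) (normalized lborel \<phi>) \<le> ennreal (2 * D / z)"
    unfolding d_BL_def
  proof (rule SUP_least)
    fix u :: "'a \<Rightarrow> real" assume "u \<in> {u. (\<forall>x. \<bar>u x\<bar> \<le> 1) \<and> 1-lipschitz_on UNIV u}"
    then have u: "\<And>x. \<bar>u x\<bar> \<le> 1" and "continuous_on UNIV u"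
      by (auto intro: lipschitz_on_continuous_on)
    then have [measurable]: "u \<in> borel_measurable borel"
      by (simp add: borel_measurable_continuous_onI)
    define a where "a = (\<integral>h. f h * u h \<partial>lborel)"
    define b where "b = (\<integral>h. \<phi> h * u h \<partial>lborel)"
    have "u h \<le> 1 + norm h \<and> - u h \<le> 1 + norm h" for h
      using u[of h] norm_ge_zero[of h] by linarith
    then have u': "norm (u h) \<le> 1 + norm h" for h by (auto simp: abs_le_iff)
    have fu: "integrable lborel (\<lambda>h. f h * u h)"
      using u f0 by (intro Bochner_Integration.integrable_bound[OF f]) (auto simp: abs_mult mult_left_le)
    have \<phi>u: "integrable lborel (\<lambda>h. \<phi> h * u h)"
      using u \<phi> by (intro Bochner_Integration.integrable_bound[OF \<phi>(1)]) (auto simp: abs_mult mult_left_le)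
    have ab: "\<bar>a - b\<bar> \<le> D"
      using intu_le[of u] u' fu \<phi>u by (simp add: a_def b_def left_diff_distrib)
    have a: "\<bar>a\<bar> \<le> integral\<^sup>L lborel f"
      unfolding a_def using u f0
      by (intro order_trans[OF integral_abs_bound integral_mono[OF integrable_abs[OF fu] f]])
        (auto simp: abs_mult mult_left_le)
    have "(\<integral>x. u x \<partial>normalized lborel f) - (\<integral>x. u x \<partial>normalized lborel \<phi>)
        = a / integral\<^sup>L lborel f - b / integral\<^sup>L lborel \<phi>"
      using integral_normalized[OF f f0 Zf0, of u] integral_normalized[OF \<phi>(1,2) Z\<phi>, of u]
      by (simp add: a_def b_def)
    \<comment> \<open>Error of the numerator plus error of the normalizer; the latter is multiplied
      by a mean of a function bounded by 1, whence the constant 2.\<close>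
    also have "\<dots> = (a - b) / integral\<^sup>L lborel \<phi> +
        (a / integral\<^sup>L lborel f) * ((integral\<^sup>L lborel \<phi> - integral\<^sup>L lborel f) / integral\<^sup>L lborel \<phi>)"
      using Zf0 Z\<phi> by (simp add: field_simps)
    also have "\<bar>\<dots>\<bar> \<le> \<bar>a - b\<bar> / integral\<^sup>L lborel \<phi> +
        (\<bar>a\<bar> / integral\<^sup>L lborel f) * (\<bar>integral\<^sup>L lborel \<phi> - integral\<^sup>L lborel f\<bar> / integral\<^sup>L lborel \<phi>)"
      using Zf0 Z\<phi> by (intro order_trans[OF abs_triangle_ineq]) (simp add: abs_mult)
    also have "\<dots> \<le> D / integral\<^sup>L lborel \<phi> + 1 * (D / integral\<^sup>L lborel \<phi>)"
      using ab a Zd Zf0 Z\<phi> Dz by (intro add_mono mult_mono divide_right_mono) (auto simp: abs_minus_commute)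
    also have "\<dots> = 2 * D / integral\<^sup>L lborel \<phi>" by simp
    also have "\<dots> \<le> 2 * D / z"
      using z Dz by (intro divide_left_mono) auto
    finally show "ennreal \<bar>(\<integral>x. u x \<partial>normalized lborel f) - (\<integral>x. u x \<partial>normalized lborel \<phi>)\<bar> \<le> ennreal (2 * D / z)"
      by (rule ennreal_leI)
  qed
  have \<phi>h: "integrable lborel (\<lambda>h. \<phi> h *\<^sub>R h)"
    using \<phi> by (intro Bochner_Integration.integrable_bound[OF \<phi>1]) auto
  have "(\<integral>h. f h *\<^sub>R h \<partial>lborel) = (\<integral>h. (f h - \<phi> h) *\<^sub>R h + \<phi> h *\<^sub>R h \<partial>lborel)"
    by (simp add: scaleR_left_diff_distrib)
  also have "\<dots> = (\<integral>h. (f h - \<phi> h) *\<^sub>R h \<partial>lborel) + (\<integral>h. \<phi> h *\<^sub>R h \<partial>lborel)"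
    using intu[of "\<lambda>h. h"] \<phi>h by (intro Bochner_Integration.integral_add) auto
  also have "(\<integral>h. \<phi> h *\<^sub>R h \<partial>lborel) = 0"
    by (rule integral_lborel_odd) (auto simp: \<phi>(3))
  finally have "norm (\<integral>h. f h *\<^sub>R h \<partial>lborel) \<le> D"
    using intu_le[of "\<lambda>h. h"] by simp
  then have "norm (\<integral>h. h \<partial>normalized lborel f) \<le> D / integral\<^sup>L lborel f"
    using integral_normalized[OF f f0 Zf0, of "\<lambda>h. h"] Zf0 by (simp add: divide_right_mono)
  also have "\<dots> \<le> D / (z / 2)"
    using Zf z Dz by (intro divide_left_mono) auto
  finally show "norm (\<integral>h. h \<partial>normalized lborel f) \<le> 2 * D / z"
    by (simp add: mult.commute)
qed

section \<open>Gaussian integrals\<close>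

lemma integrable_exp_minus_square:
  fixes s :: real assumes "0 < s"
  shows "integrable lborel (\<lambda>x::real. exp (- s * x\<^sup>2))"
proof -
  define \<sigma> where "\<sigma> = 1 / sqrt (2 * s)"
  have \<sigma>: "0 < \<sigma>" "2 * \<sigma>\<^sup>2 = 1 / s" using assms by (auto simp: \<sigma>_def power_divide)
  have "integrable lborel (\<lambda>x. sqrt (2 * pi * \<sigma>\<^sup>2) * normal_density 0 \<sigma> x)"
    using integrable_normal_moment[OF \<sigma>(1), of 0 0] by auto
  moreover have "sqrt (2 * pi * \<sigma>\<^sup>2) * normal_density 0 \<sigma> x = exp (- s * x\<^sup>2)" for x
    using \<sigma> assms by (simp add: normal_density_def)
  ultimately show ?thesis by simp
qed

text \<open>The exponential factorizes over the orthonormal basis, and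
  \<open>nn_integral_lborel_prod\<close> reduces the claim to one dimension.\<close>

lemma integrable_exp_minus_norm_square:
  fixes s :: real assumes s: "0 < s"
  shows "integrable lborel (\<lambda>x::'a::euclidean_space. exp (- s * (norm x)\<^sup>2))"
proof (rule integrableI_bounded)
  have exp_eq: "exp (- s * (norm x)\<^sup>2) = (\<Prod>b\<in>Basis. exp (- s * (x \<bullet> b)\<^sup>2))" for x :: 'a
    unfolding power2_norm_eq_inner euclidean_inner[of x x]
    by (simp add: exp_sum[symmetric] sum_negf[symmetric] sum_distrib_left power2_eq_square)
  have "(\<integral>\<^sup>+(x::'a). ennreal (norm (exp (- s * (norm x)\<^sup>2))) \<partial>lborel) =
      (\<integral>\<^sup>+(x::'a). (\<Prod>b\<in>Basis. ennreal (exp (- s * (x \<bullet> b)\<^sup>2))) \<partial>lborel)"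
    unfolding exp_eq by (simp add: prod_ennreal prod_nonneg)
  also have "\<dots> = (\<Prod>b\<in>(Basis::'a set). \<integral>\<^sup>+x. ennreal (exp (- s * x\<^sup>2)) \<partial>lborel)"
    by (rule nn_integral_lborel_prod) auto
  also have "\<dots> < \<infinity>"
    using nn_integral_eq_integral[OF integrable_exp_minus_square[OF s]]
    by (simp add: ennreal_power)
  finally show "(\<integral>\<^sup>+(x::'a). ennreal (norm (exp (- s * (norm x)\<^sup>2))) \<partial>lborel) < \<infinity>" .
qed auto

text \<open>\<open>1 + norm x\<close> is the weight of \<open>normalized_close\<close>;
  \<open>1 + (norm x)\<^sup>2\<close> is the size of the pointwise Laplace error, the square coming
  from the second order term.\<close>

lemma integrable_gaussian_majorant:
  fixes s :: real assumes s: "0 < s"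
  shows "integrable lborel
    (\<lambda>x::'a::euclidean_space. (1 + norm x) * ((1 + (norm x)\<^sup>2) * exp (- s * (norm x)\<^sup>2)))"
proof (rule Bochner_Integration.integrable_bound)
  \<comment> \<open>Chosen so that \<open>1 + y\<^sup>2 \<le> K * exp (s / 4 * y\<^sup>2)\<close>.
    Two such factors cost \<open>s / 2\<close> of the decay and leave the other half.\<close>
  define K where "K = max 1 (4 / s)"
  show "integrable lborel (\<lambda>x::'a. 2 * K\<^sup>2 * exp (- (s / 2) * (norm x)\<^sup>2))"
    using integrable_exp_minus_norm_square[of "s / 2"] s by auto
  have "(1 + y) * ((1 + y\<^sup>2) * exp (- s * y\<^sup>2)) \<le> 2 * K\<^sup>2 * exp (- (s / 2) * y\<^sup>2)" if "0 \<le> y" for y :: real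
  proof -
    have K: "1 \<le> K" "1 \<le> K * (s / 4)" using s by (auto simp: K_def max_def field_simps)
    have "1 + y\<^sup>2 \<le> K * (1 + s / 4 * y\<^sup>2)"
      using K(1) mult_right_mono[OF K(2), of "y\<^sup>2"] by (simp add: algebra_simps)
    also have "\<dots> \<le> K * exp (s / 4 * y\<^sup>2)"
      using K by (intro mult_left_mono exp_ge_add_one_self) auto
    finally have 1: "1 + y\<^sup>2 \<le> K * exp (s / 4 * y\<^sup>2)" .
    have 2: "1 + y \<le> 2 * (1 + y\<^sup>2)"
      using zero_le_power2[of "y - 1"] zero_le_power2[of y] by (simp add: power2_diff algebra_simps, linarith)
    have "(1 + y) * (1 + y\<^sup>2) \<le> 2 * (1 + y\<^sup>2) * (1 + y\<^sup>2)"
      using 2 by (intro mult_right_mono) auto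
    also have "\<dots> \<le> 2 * (K * exp (s / 4 * y\<^sup>2)) * (K * exp (s / 4 * y\<^sup>2))"
      using 1 K by (intro mult_mono) auto
    also have "\<dots> = 2 * K\<^sup>2 * exp (s / 2 * y\<^sup>2)"
      by (simp add: power2_eq_square exp_add[symmetric])
    finally have "(1 + y) * (1 + y\<^sup>2) * exp (- s * y\<^sup>2) \<le> 2 * K\<^sup>2 * exp (s / 2 * y\<^sup>2) * exp (- s * y\<^sup>2)"
      by (rule mult_right_mono) simp
    also have "\<dots> = 2 * K\<^sup>2 * exp (- (s / 2) * y\<^sup>2)"
      by (simp add: exp_add[symmetric])
    finally show ?thesis by (simp add: mult.assoc)
  qed
  then show "AE x in lborel. norm ((1 + norm x) * ((1 + (norm x)\<^sup>2) * exp (- s * (norm x)\<^sup>2)))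
      \<le> norm (2 * K\<^sup>2 * exp (- (s / 2) * (norm (x::'a))\<^sup>2))"
    by (auto simp: abs_mult)
qed auto

section \<open>Second order expansion at a maximum\<close>

lemma has_derivative_gradient:
  fixes f :: "real ^ 'b \<Rightarrow> real"
  assumes "f differentiable (at x)"
  shows "(f has_derivative (\<lambda>v. gradient f x \<bullet> v)) (at x)"
proof -
  have D: "(f has_derivative frechet_derivative f (at x)) (at x)"
    using assms frechet_derivative_works by blast
  then interpret bounded_linear "frechet_derivative f (at x)"
    by (rule has_derivative_bounded_linear)
  have "frechet_derivative f (at x) v = gradient f x \<bullet> v" for v
  proof -
    have "frechet_derivative f (at x) v = frechet_derivative f (at x) (\<Sum>i\<in>UNIV. (v $ i) *\<^sub>R axis i 1)"
      by (simp add: basis_expansion scalar_mult_eq_scaleR[symmetric])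
    also have "\<dots> = gradient f x \<bullet> v"
      by (simp add: sum scaleR gradient_def inner_vec_def mult.commute)
    finally show ?thesis .
  qed
  then have "frechet_derivative f (at x) = (\<lambda>v. gradient f x \<bullet> v)" by auto
  with D show ?thesis by simp
qed

lemma has_derivative_hessian:
  fixes f :: "real ^ 'b \<Rightarrow> real"
  assumes "gradient f differentiable (at x)"
  shows "(gradient f has_derivative (\<lambda>v. hessian f x *v v)) (at x)"
proof -
  have D: "(gradient f has_derivative frechet_derivative (gradient f) (at x)) (at x)"
    using assms frechet_derivative_works by blast
  then have "linear (frechet_derivative (gradient f) (at x))"
    by (rule has_derivative_linear)
  then have "frechet_derivative (gradient f) (at x) = (\<lambda>v. hessian f x *v v)"
    unfolding hessian_def by (auto simp: matrix_works)
  with D show ?thesis by simp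
qed

lemma twice_differentiable_atD:
  assumes "twice_differentiable_at f x"
  shows "f differentiable (at x)" "gradient f differentiable (at x)"
  using assms eventually_nhds_x_imp_x unfolding twice_differentiable_at_def by blast+

lemma gradient_eq_0_at_max:
  fixes f :: "real ^ 'b \<Rightarrow> real"
  assumes "f differentiable (at m)" and "m \<in> interior C" and "\<And>x. x \<in> C \<Longrightarrow> f x \<le> f m"
  shows "gradient f m = 0"
proof -
  have "(\<lambda>v. gradient f m \<bullet> v) = (\<lambda>v. 0)"
    using assms interior_subset
    by (intro differential_zero_maxmin[OF _ open_interior has_derivative_gradient]) auto
  then show ?thesis by (metis inner_eq_zero_iff)
qed

text \<open>Maclaurin's formula along the segment from \<open>m\<close> to \<open>b\<close>. The
  remainder sits at an unspecified intermediate point, which is harmless because the Hessian will be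
  controlled on all of \<open>C\<close>.\<close>

lemma taylor_at_max:
  fixes f :: "real ^ 'b \<Rightarrow> real"
  assumes C: "convex C" "\<And>x. x \<in> C \<Longrightarrow> twice_differentiable_at f x"
    and m: "m \<in> interior C" "\<And>x. x \<in> C \<Longrightarrow> f x \<le> f m" and b: "b \<in> C"
  shows "\<exists>\<xi>\<in>C. f b - f m = (1/2) * ((b - m) \<bullet> (hessian f \<xi> *v (b - m)))"
proof -
  define x where "x = (\<lambda>s::real. m + s *\<^sub>R (b - m))"
  have mC: "m \<in> C" using m(1) interior_subset by blast
  have x: "x s \<in> C" if "0 \<le> s" "s \<le> 1" for s
    using convexD_alt[OF C(1) mC b that] by (simp add: x_def algebra_simps)
  have dx: "(x has_derivative (\<lambda>h. h *\<^sub>R (b - m))) (at s)" for s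
    unfolding x_def by (auto intro!: derivative_eq_intros)
  \<comment> \<open>Derivatives of orders 0, 1 and 2 along the segment; the last branch also catches
    higher orders, which never occur.\<close>
  define diff where "diff = (\<lambda>k::nat. if k = 0 then (\<lambda>s. f (x s))
    else if k = 1 then (\<lambda>s. gradient f (x s) \<bullet> (b - m))
    else (\<lambda>s. (hessian f (x s) *v (b - m)) \<bullet> (b - m)))"
  have "(diff k has_real_derivative diff (Suc k) s) (at s)" if "k < 2" "0 \<le> s" "s \<le> 1" for k s
  proof -
    have t: "f differentiable (at (x s))" "gradient f differentiable (at (x s))"
      using twice_differentiable_atD C(2) x that by blast+
    have "((\<lambda>s. f (x s)) has_derivative (\<lambda>h. gradient f (x s) \<bullet> (h *\<^sub>R (b - m)))) (at s)"
      by (rule has_derivative_compose[OF dx has_derivative_gradient[OF t(1)]])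
    then have 0: "((\<lambda>s. f (x s)) has_real_derivative gradient f (x s) \<bullet> (b - m)) (at s)"
      unfolding has_field_derivative_def by (rule has_derivative_eq_rhs) (auto simp: mult.commute)
    have "((\<lambda>s. gradient f (x s)) has_derivative (\<lambda>h. hessian f (x s) *v (h *\<^sub>R (b - m)))) (at s)"
      by (rule has_derivative_compose[OF dx has_derivative_hessian[OF t(2)]])
    then have "((\<lambda>s. gradient f (x s) \<bullet> (b - m)) has_derivative
        (\<lambda>h. (hessian f (x s) *v (h *\<^sub>R (b - m))) \<bullet> (b - m))) (at s)"
      by (rule has_derivative_inner_left)
    then have 1: "((\<lambda>s. gradient f (x s) \<bullet> (b - m)) has_real_derivative
        (hessian f (x s) *v (b - m)) \<bullet> (b - m)) (at s)"
      unfolding has_field_derivative_def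
      by (rule has_derivative_eq_rhs) (auto simp: matrix_vector_mult_scaleR mult.commute)
    have "k = 0 \<or> k = 1" using that by auto
    with 0 1 show ?thesis by (auto simp: diff_def)
  qed
  then have "\<exists>s>0. s < 1 \<and> diff 0 1 = (\<Sum>k<2. diff k 0 / fact k * 1 ^ k) + diff 2 s / fact 2 * 1 ^ 2"
    by (intro Maclaurin) auto
  then obtain s where s: "0 < s" "s < 1"
    and eq: "diff 0 1 = (\<Sum>k<2. diff k 0 / fact k * 1 ^ k) + diff 2 s / fact 2 * 1 ^ 2"
    by blast
  have "gradient f m = 0"
    using m mC C(2) by (intro gradient_eq_0_at_max[of f m C]) (auto intro: twice_differentiable_atD)
  then have "f b - f m = (1/2) * ((b - m) \<bullet> (hessian f (x s) *v (b - m)))"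
    using eq by (simp add: diff_def x_def numeral_2_eq_2 inner_commute)
  with x[of s] s show ?thesis by auto
qed

section \<open>Quadratic forms\<close>

text \<open>The norm of a matrix as a vector of vectors is the Frobenius norm, and Cauchy-Schwarz is
  applied row by row. It is the norm in which \<open>mixed_strong\<close> measures Hessian
  errors.\<close>

lemma norm_matrix_vector_mult_le:
  fixes A :: "real ^ 'n ^ 'm"
  shows "norm (A *v v) \<le> norm A * norm v"
proof -
  have "norm (A *v v) \<le> L2_set (\<lambda>i. norm (A $ i) * norm v) UNIV"
    unfolding norm_vec_def[of "A *v v"]
    by (intro L2_set_mono) (auto simp: matrix_vector_mul_component Cauchy_Schwarz_ineq2)
  also have "\<dots> = norm A * norm v"
    by (simp add: norm_vec_def[of A] L2_set_left_distrib[symmetric])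
  finally show ?thesis .
qed

lemma abs_quadratic_form_le:
  fixes A :: "real ^ 'n ^ 'n"
  shows "\<bar>v \<bullet> (A *v v)\<bar> \<le> norm A * (norm v)\<^sup>2"
  using order_trans[OF Cauchy_Schwarz_ineq2 mult_left_mono[OF norm_matrix_vector_mult_le norm_ge_zero]]
  by (simp add: power2_eq_square mult.commute mult.left_commute)

text \<open>\<open>mvnormal\<close> takes a covariance and inverts it; with covariance
  \<open>matrix_inv (H g)\<close> the exponent must come back to \<open>H g\<close>.\<close>

lemma matrix_inv_matrix_inv:
  fixes A :: "'a::field ^ 'n ^ 'n"
  assumes "invertible A"
  shows "matrix_inv (matrix_inv A) = A"
proof -
  have inv: "B ** matrix_inv B = mat 1 \<and> matrix_inv B ** B = mat 1" if "invertible B" for B :: "'a ^ 'n ^ 'n"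
    using someI_ex[OF that[unfolded invertible_def]] unfolding matrix_inv_def by auto
  have "invertible (matrix_inv A)"
    using inv[OF assms] unfolding invertible_def by blast
  then show ?thesis
    using inv[OF assms] inv by (metis matrix_mul_assoc matrix_mul_lid matrix_mul_rid)
qed

lemma invertible_of_quadratic_form:
  fixes A :: "real ^ 'n ^ 'n"
  assumes "0 < c" and "\<And>v. c * (norm v)\<^sup>2 \<le> v \<bullet> (A *v v)"
  shows "invertible A"
proof -
  have "v = 0" if "A *v v = 0" for v
    using assms(2)[of v] assms(1) that by (simp add: mult_le_0_iff)
  then show ?thesis
    using matrix_left_invertible_ker invertible_left_inverse by blast
qed

section \<open>Compactness and continuity\<close>

text \<open>The argmax is unique, so its graph is the set of all maximizers and hence closed; a
  closed graph over a compact range gives continuity. Applied to the population criterion it yields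
  continuity of \<open>\<beta>0\<close>.\<close>

lemma continuous_on_unique_argmax:
  fixes M :: "'a::metric_space \<Rightarrow> 'c::metric_space \<Rightarrow> real"
  assumes B: "compact B" and M: "continuous_on (B \<times> G) (\<lambda>(b, g). M b g)"
    and max: "\<And>g. g \<in> G \<Longrightarrow> m g \<in> B" "\<And>g b. g \<in> G \<Longrightarrow> b \<in> B \<Longrightarrow> b \<noteq> m g \<Longrightarrow> M b g < M (m g) g"
  shows "continuous_on G m"
proof (cases "B = {}")
  case True
  then have "G = {}" using max(1) by auto
  then show ?thesis by simp
next
  case False
  define R where "R = {(b, g) \<in> B \<times> G. b = m g}"
  \<comment> \<open>Each competitor \<open>b'\<close> contributes one closed condition; uniqueness
    excludes any further point from the intersection.\<close>
  have "R = (\<Inter>b'\<in>B. (B \<times> G) \<inter> (\<lambda>(b, g). M b g - M b' g) -` {0..})"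
  proof (intro set_eqI iffI)
    fix x assume "x \<in> R"
    then have "fst x \<in> B" "snd x \<in> G" "fst x = m (snd x)" "x \<in> B \<times> G" by (auto simp: R_def)
    then show "x \<in> (\<Inter>b'\<in>B. (B \<times> G) \<inter> (\<lambda>(b, g). M b g - M b' g) -` {0..})"
      using max(2)[of "snd x"] by (force simp: case_prod_beta)
  next
    fix x assume x: "x \<in> (\<Inter>b'\<in>B. (B \<times> G) \<inter> (\<lambda>(b, g). M b g - M b' g) -` {0..})"
    with False have xB: "x \<in> B \<times> G" by auto
    then have "m (snd x) \<in> B" using max(1) by auto
    with x have "x \<in> (\<lambda>(b, g). M b g - M (m (snd x)) g) -` {0..}" by blast
    then have "M (m (snd x)) (snd x) \<le> M (fst x) (snd x)" by (simp add: case_prod_beta)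
    with xB max(2)[of "snd x" "fst x"] have "fst x = m (snd x)" by force
    with xB show "x \<in> R" by (auto simp: R_def)
  qed
  moreover have "closedin (top_of_set (B \<times> G)) ((B \<times> G) \<inter> (\<lambda>(b, g). M b g - M b' g) -` {0..})" if "b' \<in> B" for b'
  proof (rule continuous_closedin_preimage)
    have "continuous_on (B \<times> G) ((\<lambda>(b, g). M b g) \<circ> (\<lambda>(b, g). (b', g)))"
      using that by (intro continuous_on_compose continuous_on_subset[OF M])
        (auto simp: case_prod_beta intro!: continuous_intros)
    then show "continuous_on (B \<times> G) (\<lambda>(b, g). M b g - M b' g)"
      using M by (auto simp: case_prod_beta intro!: continuous_intros)
  qed simp
  ultimately have R: "closedin (top_of_set (B \<times> G)) R"
    using closedin_INT[OF False, of "top_of_set (B \<times> G)" "\<lambda>b'. (B \<times> G) \<inter> (\<lambda>(b, g). M b g - M b' g) -` {0..}"]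
    by simp
  show ?thesis
  proof (subst continuous_on_closed_gen[of m G B])
    show "m \<in> G \<rightarrow> B" using max by auto
    show "\<forall>U. closedin (top_of_set B) U \<longrightarrow> closedin (top_of_set G) (G \<inter> m -` U)"
    proof (intro allI impI)
      fix U assume U: "closedin (top_of_set B) U"
      then have "U \<subseteq> B" using closedin_imp_subset by blast
      \<comment> \<open>The preimage becomes a projection along the compact factor \<open>B\<close>,
        and such a projection is a closed map.\<close>
      then have "G \<inter> m -` U = snd ` (R \<inter> U \<times> G)"
        by (force simp: R_def image_iff)
      moreover have "closedin (top_of_set (B \<times> G)) (R \<inter> U \<times> G)"
        using R U by (intro closedin_Int closedin_Times) auto
      ultimately show "closedin (top_of_set G) (G \<inter> m -` U)"
        using closed_map_snd[of "top_of_set B" "top_of_set G"] B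
        by (simp add: closed_map_def subtopology_Times[symmetric] compact_space_subtopology)
    qed
  qed
qed

text \<open>Uniqueness gives a positive gap at each single point. The points at distance at least
  \<open>e\<close> from the argmax form a compact set because \<open>m\<close> is continuous, so the
  gap attains a positive minimum there.\<close>

lemma separated_maximum:
  fixes M :: "'a::metric_space \<Rightarrow> 'c::metric_space \<Rightarrow> real"
  assumes B: "compact B" and G: "compact G" and M: "continuous_on (B \<times> G) (\<lambda>(b, g). M b g)"
    and max: "\<And>g. g \<in> G \<Longrightarrow> m g \<in> B" "\<And>g b. g \<in> G \<Longrightarrow> b \<in> B \<Longrightarrow> b \<noteq> m g \<Longrightarrow> M b g < M (m g) g"
    and e: "0 < e"
  obtains \<eta> where "0 < \<eta>" "\<And>g b. g \<in> G \<Longrightarrow> b \<in> B \<Longrightarrow> e \<le> dist b (m g) \<Longrightarrow> M b g \<le> M (m g) g - \<eta>"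
proof -
  have m: "continuous_on G m" by (rule continuous_on_unique_argmax[OF B M max])
  define K where "K = (B \<times> G) \<inter> (\<lambda>(b, g). dist b (m g)) -` {e..}"
  have m2: "continuous_on (B \<times> G) (\<lambda>x. m (snd x))"
    by (rule continuous_on_compose2[OF m]) (auto intro!: continuous_intros)
  have "compact K"
    unfolding K_def using B G m2
    by (intro closedin_compact[OF compact_Times continuous_closedin_preimage])
      (auto simp: case_prod_beta intro!: continuous_intros)
  define d where "d = (\<lambda>x. M (m (snd x)) (snd x) - M (fst x) (snd x))"
  have "continuous_on (B \<times> G) (\<lambda>x. (\<lambda>(b, g). M b g) (m (snd x), snd x))"
    using max(1) m2 by (intro continuous_on_compose2[OF M] continuous_intros) auto
  then have d: "continuous_on K d"
    unfolding d_def using M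
    by (intro continuous_intros) (auto simp: K_def case_prod_beta elim: continuous_on_subset)
  show ?thesis
  proof (cases "K = {}")
    case True
    then show ?thesis by (intro that[of 1]) (auto simp: K_def)
  next
    case False
    then obtain x where x: "x \<in> K" "\<And>y. y \<in> K \<Longrightarrow> d x \<le> d y"
      using continuous_attains_inf[OF \<open>compact K\<close> _ d] by blast
    show ?thesis
    proof (rule that[of "d x"])
      show "0 < d x" using x(1) e max(2)[of "snd x" "fst x"] by (force simp: d_def K_def)
    next
      fix g b assume "g \<in> G" "b \<in> B" "e \<le> dist b (m g)"
      then show "M b g \<le> M (m g) g - d x"
        using x(2)[of "(b, g)"] by (auto simp: d_def K_def)
    qed
  qed
qed

section \<open>Products, coordinates and nonempty parameter sets\<close>

text \<open>\<open>Pi\<^sub>E\<close> pins coordinates outside \<open>I\<close> to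
  \<open>undefined\<close>, so it is a full product with singleton factors there, and Tychonoff
  applies.\<close>

lemma compact_PiE:
  fixes A :: "'i \<Rightarrow> 'a::topological_space set"
  assumes "\<And>i. i \<in> I \<Longrightarrow> compact (A i)"
  shows "compact (Pi\<^sub>E I A)"
proof -
  have "y \<in> (if i \<in> I then A i else {undefined}) \<longleftrightarrow> (i \<in> I \<longrightarrow> y \<in> A i) \<and> (i \<notin> I \<longrightarrow> y = undefined)" for y i
    by simp
  then have "Pi\<^sub>E I A = Pi\<^sub>E UNIV (\<lambda>i. if i \<in> I then A i else {undefined})"
    unfolding set_eq_iff PiE_iff extensional_def by blast
  moreover have "compactin (product_topology (\<lambda>_. euclidean) UNIV)
      (Pi\<^sub>E UNIV (\<lambda>i. if i \<in> I then A i else {undefined}))"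
    using assms by (auto simp: compactin_PiE)
  ultimately show ?thesis
    by (simp add: euclidean_product_topology compactin_euclidean_iff)
qed

lemma continuous_on_fun_upd:
  fixes f :: "'a::topological_space \<Rightarrow> 'i \<Rightarrow> 'b::topological_space"
  assumes "continuous_on A f" and "continuous_on A g"
  shows "continuous_on A (\<lambda>x. (f x)(i := g x))"
proof (rule continuous_on_coordinatewise_then_product)
  fix k
  have "continuous_on A (\<lambda>x. f x k)"
    using assms(1) by (rule continuous_on_product_then_coordinatewise)
  with assms(2) show "continuous_on A (\<lambda>x. ((f x)(i := g x)) k)" by (cases "k = i") auto
qed

lemma to_nat_on_UNIV_less: "to_nat_on UNIV (k :: 'b::finite) < CARD('b)"
  using to_nat_on_finite[of "UNIV :: 'b set"] by (auto simp: bij_betw_def)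

lemma of_rvec_to_rvec [simp]: "of_rvec (to_rvec b) = b"
  by (simp add: of_rvec_def to_rvec_def vec_eq_iff to_nat_on_UNIV_less)

lemma to_rvec_of_rvec:
  assumes "x \<in> Rvec CARD('b::finite)"
  shows "to_rvec (of_rvec x :: real ^ 'b) = x"
proof
  fix i
  have "i \<in> to_nat_on UNIV ` (UNIV :: 'b set)" if "i < CARD('b)"
    using to_nat_on_finite[of "UNIV :: 'b set"] that by (auto simp: bij_betw_def)
  then show "to_rvec (of_rvec x :: real ^ 'b) i = x i"
    using assms by (auto simp: of_rvec_def to_rvec_def Rvec_def)
qed

lemma continuous_on_of_rvec: "continuous_on A of_rvec"
  unfolding of_rvec_def
  by (intro continuous_on_vec_lambda continuous_on_subset[OF continuous_on_product_coordinates]) auto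

lemma continuous_on_to_rvec: "continuous_on A to_rvec"
  unfolding to_rvec_def
proof (rule continuous_on_coordinatewise_then_product)
  show "continuous_on A (\<lambda>b. if i < CARD('b) then b $ from_nat_into UNIV i else 0)" for i
    by (cases "i < CARD('b)") (auto intro!: continuous_intros)
qed

text \<open>Over an empty set the prior would be the zero measure. Nonemptiness is not stated among
  the conditions, but recovering a factor from a product relies on it.\<close>

lemma regular_prior_nonempty:
  assumes "regular_prior A \<pi>"
  shows "A \<noteq> {}"
proof
  assume "A = {}"
  then obtain D where "\<pi> = density D (\<lambda>_. 0)" "prob_space \<pi>"
    using assms unfolding regular_prior_def by auto
  then show False
    using prob_space.emeasure_space_1[of \<pi>] by (simp add: emeasure_density)
qed

section \<open>Laplace approximation\<close>

text \<open>Here the Jacobian does not cancel: it is the source of the factor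
  \<open>s ^ CARD('b)\<close> in the tail term of the Laplace bound.\<close>

lemma nn_integral_lborel_rescale:
  fixes F :: "'a::euclidean_space \<Rightarrow> ennreal"
  assumes s: "0 < s" and [measurable]: "F \<in> borel_measurable borel"
  shows "(\<integral>\<^sup>+h. F (m + (1 / s) *\<^sub>R h) \<partial>lborel) = ennreal (s ^ DIM('a)) * (\<integral>\<^sup>+b. F b \<partial>lborel)"
proof -
  have L: "(lborel :: 'a measure) = density (distr lborel borel (\<lambda>h. m + (1 / s) *\<^sub>R h)) (\<lambda>_. ennreal ((1 / s) ^ DIM('a)))"
    using lborel_affine[of "1 / s" m] s by simp
  have "(\<integral>\<^sup>+b. F b \<partial>lborel) =
      (\<integral>\<^sup>+b. F b \<partial>density (distr lborel borel (\<lambda>h. m + (1 / s) *\<^sub>R h)) (\<lambda>_. ennreal ((1 / s) ^ DIM('a))))"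
    by (rule arg_cong[OF L, of "\<lambda>N. integral\<^sup>N N F"])
  also have "\<dots> = ennreal ((1 / s) ^ DIM('a)) * (\<integral>\<^sup>+h. F (m + (1 / s) *\<^sub>R h) \<partial>lborel)"
    by (simp add: nn_integral_density nn_integral_distr nn_integral_cmult)
  finally have eq: "(\<integral>\<^sup>+b. F b \<partial>lborel) = ennreal ((1 / s) ^ DIM('a)) * (\<integral>\<^sup>+h. F (m + (1 / s) *\<^sub>R h) \<partial>lborel)" .
  have "ennreal (s ^ DIM('a)) * ennreal ((1 / s) ^ DIM('a)) = 1"
    using s by (subst ennreal_mult[symmetric]) (auto simp: power_one_over)
  then show ?thesis unfolding eq by (simp add: mult.assoc[symmetric])
qed

text \<open>The common bound \<open>u\<close> of the exponents keeps the Gaussian decay on the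
  difference; the inequality itself comes from \<open>1 + x \<le> exp x\<close>.\<close>

lemma abs_exp_diff_le:
  fixes x y u :: real
  assumes "x \<le> u" "y \<le> u"
  shows "\<bar>exp x - exp y\<bar> \<le> \<bar>x - y\<bar> * exp u"
proof -
  have *: "\<bar>exp x - exp y\<bar> \<le> \<bar>x - y\<bar> * exp u" if "y \<le> x" "x \<le> u" for x y
  proof -
    have "exp x * (1 + (y - x)) \<le> exp x * exp (y - x)"
      by (intro mult_left_mono exp_ge_add_one_self) auto
    then have "exp x - exp y \<le> (x - y) * exp x"
      by (simp add: exp_add[symmetric] algebra_simps)
    also have "\<dots> \<le> (x - y) * exp u"
      using that by (intro mult_left_mono) auto
    finally show ?thesis using that by simp
  qed
  show ?thesis
    using *[of y x] *[of x y] assms by (cases "y \<le> x") (auto simp: abs_minus_commute)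
qed

text \<open>In the bound, \<rho> is the error inside the ball, the exponential with
  \<open>c / 16\<close> is the Gaussian tail outside it, and the last summand is the tail of the
  conditional density. The two tails are separate because off the ball \<open>f\<close> and \<phi>
  are each small for their own reason: separation of the maximum in one case, curvature in the
  other.\<close>

lemma laplace_bound:
  fixes q l \<pi> :: "real ^ 'b \<Rightarrow> real" and A :: "real ^ 'b ^ 'b"
  assumes [measurable]: "(\<lambda>b. if b \<in> B then exp (q b + l b) * \<pi> b else 0) \<in> borel_measurable borel"
    "(\<lambda>b. \<pi> b * indicator B b) \<in> borel_measurable borel"
    and \<pi>0: "\<And>b. b \<in> B \<Longrightarrow> 0 \<le> \<pi> b" and \<pi>1: "(\<integral>\<^sup>+b\<in>B. ennreal (\<pi> b) \<partial>lborel) = 1"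
    and \<pi>m: "0 < \<pi> m" "1 / \<pi> m \<le> P"
    and A: "0 < c" "\<And>v. c * (norm v)\<^sup>2 \<le> v \<bullet> (A *v v)"
    and s: "0 < s" and \<rho>: "0 \<le> \<rho>" "\<rho> \<le> c / 2"
    and ball: "cball b0 \<epsilon> \<subseteq> B" "norm (m - b0) \<le> \<epsilon> / 2" "0 < \<epsilon>"
    and q_in: "\<And>b. b \<in> cball b0 \<epsilon> \<Longrightarrow>
      \<bar>(q b - q m) + s\<^sup>2 / 2 * ((b - m) \<bullet> (A *v (b - m)))\<bar> \<le> s\<^sup>2 / 2 * (\<rho> * (norm (b - m))\<^sup>2)"
    and l_in: "\<And>b. b \<in> cball b0 \<epsilon> \<Longrightarrow> \<bar>exp (l b - l m) * \<pi> b / \<pi> m - 1\<bar> \<le> \<rho>"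
    and q_out: "\<And>b. b \<in> B \<Longrightarrow> b \<notin> cball b0 \<epsilon> \<Longrightarrow> q b - q m \<le> - 2 * \<eta> * s\<^sup>2"
    and l_out: "\<And>b. b \<in> B \<Longrightarrow> exp (l b - l m) \<le> L"
    and diam: "\<And>b. b \<in> B \<Longrightarrow> norm (b - m) \<le> \<Delta>"
  defines "f \<equiv> \<lambda>b. (if b \<in> B then exp (q b + l b) * \<pi> b else 0) / (exp (q m + l m) * \<pi> m)"
    and "\<phi> \<equiv> \<lambda>h. exp (- (1/2) * (h \<bullet> (A *v h)))"
  shows "(\<integral>\<^sup>+h. ennreal ((1 + norm h) * \<bar>f (m + (1 / s) *\<^sub>R h) - \<phi> h\<bar>) \<partial>lborel) \<le>
    ennreal ((\<rho> + exp (- (c / 16) * (s * \<epsilon>)\<^sup>2)) *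
        (\<integral>h. (1 + norm h) * ((1 + (norm h)\<^sup>2) * exp (- (c / 4) * (norm h)\<^sup>2)) \<partial>(lborel :: (real ^ 'b) measure)) +
      L * P * exp (- 2 * \<eta> * s\<^sup>2) * (1 + s * \<Delta>) * s ^ CARD('b))"
proof -
  define E where "E = (\<lambda>h::real ^ 'b. exp (- (c / 4) * (norm h)\<^sup>2))"
  define e where "e = exp (- (c / 16) * (s * \<epsilon>)\<^sup>2)"
  define C where "C = L * P * exp (- 2 * \<eta> * s\<^sup>2)"
  define \<pi>B where "\<pi>B = (\<lambda>b. \<pi> b * indicator B b)"
  have mB: "m \<in> B" using ball by (intro subsetD[OF ball(1)]) (auto simp: dist_norm norm_minus_commute)
  have "0 < L" using l_out[OF mB] by (metis exp_gt_zero less_le_trans)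
  have "0 < P" using \<pi>m by (metis less_le_trans zero_less_divide_1_iff)
  have C0: "0 \<le> C" using \<open>0 < L\<close> \<open>0 < P\<close> by (simp add: C_def)
  have e0: "0 \<le> e" by (simp add: e_def)
  have \<Delta>0: "0 \<le> \<Delta>" using diam[OF mB] by simp
  have \<phi>E: "\<phi> h \<le> exp (- (c / 2) * (norm h)\<^sup>2)" for h
    using A(2)[of h] by (simp add: \<phi>_def)
  have f_eq: "f b = exp (q b - q m) * (exp (l b - l m) * \<pi> b / \<pi> m)" if "b \<in> B" for b
    using that \<pi>m by (simp add: f_def exp_add exp_diff field_simps)
  have pointwise: "\<bar>f b - \<phi> h\<bar> \<le> (\<rho> + e) * ((1 + (norm h)\<^sup>2) * E h) + C * \<pi>B b"
    if b: "b = m + (1 / s) *\<^sub>R h" for b h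
  proof -
    have h: "h = s *\<^sub>R (b - m)" using b s by simp
    have \<pi>B0: "0 \<le> \<pi>B b" using \<pi>0 by (simp add: \<pi>B_def indicator_def)
    show ?thesis
    proof (cases "b \<in> cball b0 \<epsilon>")
      case True
      define X where "X = q b - q m"
      define Y where "Y = - (1/2) * (h \<bullet> (A *v h))"
      define R where "R = exp (l b - l m) * \<pi> b / \<pi> m"
      have hA: "h \<bullet> (A *v h) = s\<^sup>2 * ((b - m) \<bullet> (A *v (b - m)))"
        unfolding h by (simp add: matrix_vector_mult_scaleR power2_eq_square)
      have hn: "(norm h)\<^sup>2 = s\<^sup>2 * (norm (b - m))\<^sup>2"
        unfolding h using s by (simp add: power_mult_distrib)
      have XY: "\<bar>X - Y\<bar> \<le> (1/2) * \<rho> * (norm h)\<^sup>2"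
        using q_in[OF True] by (simp add: X_def Y_def hA hn algebra_simps)
      have Yle: "Y \<le> - (c / 2) * (norm h)\<^sup>2"
        using A(2)[of h] by (simp add: Y_def)
      \<comment> \<open>\<open>\<rho> \<le> c / 2\<close> lets the expansion error consume at most
        half of the curvature, so \<open>X\<close> and \<open>Y\<close> share the bound with
        \<open>c / 4\<close>.\<close>
      have "\<rho> * (norm h)\<^sup>2 \<le> c / 2 * (norm h)\<^sup>2"
        using \<rho> by (intro mult_right_mono) auto
      then have XE: "X \<le> - (c / 4) * (norm h)\<^sup>2"
        using XY Yle abs_ge_self[of "X - Y"] by linarith
      have YE: "Y \<le> - (c / 4) * (norm h)\<^sup>2"
        using Yle A(1) by (simp add: order_trans)
      have "\<bar>exp X - exp Y\<bar> \<le> \<bar>X - Y\<bar> * E h"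
        unfolding E_def by (rule abs_exp_diff_le[OF XE YE])
      also have "\<dots> \<le> ((1/2) * \<rho> * (norm h)\<^sup>2) * E h"
        using XY by (intro mult_right_mono) (auto simp: E_def)
      also have "\<dots> \<le> \<rho> * (norm h)\<^sup>2 * E h"
        using \<rho> by (intro mult_right_mono) (auto simp: E_def)
      finally have 1: "\<bar>exp X - exp Y\<bar> \<le> \<rho> * (norm h)\<^sup>2 * E h" .
      have "\<bar>exp X * (R - 1)\<bar> \<le> E h * \<rho>"
        unfolding abs_mult using XE l_in[OF True] by (intro mult_mono) (auto simp: E_def R_def)
      \<comment> \<open>Separates the factor \<open>R\<close> from pooling and prior, which is near
        1, from the Taylor error in the exponent.\<close>
      moreover have "f b - \<phi> h = exp X * (R - 1) + (exp X - exp Y)"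
        using True ball(1) f_eq[of b] by (auto simp: X_def R_def \<phi>_def Y_def algebra_simps)
      ultimately have "\<bar>f b - \<phi> h\<bar> \<le> \<rho> * ((1 + (norm h)\<^sup>2) * E h)"
        using 1 by (simp add: algebra_simps)
      also have "\<dots> \<le> (\<rho> + e) * ((1 + (norm h)\<^sup>2) * E h)"
        using e0 by (intro mult_right_mono) (auto simp: E_def)
      finally show ?thesis using C0 \<pi>B0 by (simp add: add_increasing2)
    next
      case False
      \<comment> \<open>As \<open>m\<close> is within \<open>\<epsilon> / 2\<close> of the center,
        \<open>norm h\<close> is at least \<open>s * \<epsilon> / 2\<close>. Half of the exponent
        \<open>c / 2\<close> stays as \<open>E h\<close>; the other half gives \<open>e\<close>,
        with \<open>c / 4 * (1 / 2)\<^sup>2 = c / 16\<close>.\<close>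
      have "\<epsilon> < norm (b - b0)" using False by (simp add: dist_norm norm_minus_commute)
      also have "\<dots> \<le> norm (b - m) + norm (m - b0)" using norm_triangle_ineq[of "b - m" "m - b0"] by simp
      finally have "\<epsilon> / 2 \<le> norm (b - m)" using ball(2) by simp
      then have "s * (\<epsilon> / 2) \<le> norm h" unfolding h using s by simp
      then have "(s * (\<epsilon> / 2))\<^sup>2 \<le> (norm h)\<^sup>2" using s ball(3) by (intro power_mono) auto
      then have "c * (s * (\<epsilon> / 2))\<^sup>2 \<le> c * (norm h)\<^sup>2" using A(1) by (intro mult_left_mono) auto
      then have "- (c / 2) * (norm h)\<^sup>2 \<le> - (c / 16) * (s * \<epsilon>)\<^sup>2 + (- (c / 4) * (norm h)\<^sup>2)"
        by (simp add: power_mult_distrib power_divide algebra_simps)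
      then have "exp (- (c / 2) * (norm h)\<^sup>2) \<le> e * E h"
        by (simp add: e_def E_def exp_add[symmetric])
      with \<phi>E[of h] have "\<phi> h \<le> e * E h" by linarith
      also have "\<dots> \<le> (\<rho> + e) * E h" using \<rho> by (intro mult_right_mono) (auto simp: E_def)
      also have "\<dots> \<le> (\<rho> + e) * ((1 + (norm h)\<^sup>2) * E h)"
        using \<rho> e0 by (intro mult_left_mono) (auto simp: E_def)
      finally have 1: "\<phi> h \<le> (\<rho> + e) * ((1 + (norm h)\<^sup>2) * E h)" .
      \<comment> \<open>Off the ball only the integral of \<pi> is under control, so the bound keeps
        \<pi> as a factor to be integrated later.\<close>
      have 2: "0 \<le> f b \<and> f b \<le> C * \<pi>B b"
      proof (cases "b \<in> B")
        case True
        have "f b = (exp (l b - l m) * (1 / \<pi> m) * exp (q b - q m)) * \<pi> b"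
          using f_eq[OF True] by simp
        also have "\<dots> \<le> C * \<pi> b"
          unfolding C_def using l_out[OF True] q_out[OF True False] \<pi>m \<pi>0[OF True] \<open>0 < L\<close> \<open>0 < P\<close>
          by (intro mult_right_mono mult_mono) auto
        finally show ?thesis
          using True f_eq[OF True] \<pi>m \<pi>0[OF True] by (simp add: \<pi>B_def)
      qed (simp add: f_def \<pi>B_def)
      have "0 \<le> \<phi> h" by (simp add: \<phi>_def)
      with 1 2 show ?thesis by (simp add: abs_le_iff)
    qed
  qed
  define g where "g = (\<lambda>h::real ^ 'b. (1 + norm h) * ((1 + (norm h)\<^sup>2) * E h))"
  have g0: "0 \<le> g h" for h by (simp add: g_def E_def)
  have [measurable]: "g \<in> borel_measurable borel" unfolding g_def E_def by measurable
  have g: "integrable lborel g"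
    unfolding g_def E_def using A(1) by (intro integrable_gaussian_majorant) auto
  have \<pi>B0: "0 \<le> \<pi>B b" for b using \<pi>0 by (simp add: \<pi>B_def indicator_def)
  have [measurable]: "\<pi>B \<in> borel_measurable borel" unfolding \<pi>B_def by measurable
  have "(1 + norm h) * \<bar>f (m + (1 / s) *\<^sub>R h) - \<phi> h\<bar> \<le>
      (\<rho> + e) * g h + C * (1 + s * \<Delta>) * \<pi>B (m + (1 / s) *\<^sub>R h)" for h
  proof -
    define b where "b = m + (1 / s) *\<^sub>R h"
    \<comment> \<open>The weight is unbounded, but \<open>\<pi>B\<close> lives on \<open>B\<close>,
      whose points are within \<Delta> of \<open>m\<close>.\<close>
    have "norm h * \<pi>B b \<le> s * \<Delta> * \<pi>B b"
    proof (cases "b \<in> B")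
      case True
      have "norm h = s * norm (b - m)" using s by (simp add: b_def)
      also have "\<dots> \<le> s * \<Delta>" using diam[OF True] s by simp
      finally show ?thesis using \<pi>B0 by (intro mult_right_mono) auto
    qed (simp add: \<pi>B_def)
    then have "C * ((1 + norm h) * \<pi>B b) \<le> C * ((1 + s * \<Delta>) * \<pi>B b)"
      using C0 by (intro mult_left_mono) (auto simp: algebra_simps)
    moreover have "(1 + norm h) * \<bar>f b - \<phi> h\<bar> \<le> (1 + norm h) * ((\<rho> + e) * ((1 + (norm h)\<^sup>2) * E h) + C * \<pi>B b)"
      using pointwise[OF b_def] by (intro mult_left_mono) auto
    ultimately show ?thesis by (simp add: g_def b_def algebra_simps)
  qed
  moreover have k0: "0 \<le> C * (1 + s * \<Delta>)" using C0 s \<Delta>0 by simp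
  ultimately have "(\<integral>\<^sup>+h. ennreal ((1 + norm h) * \<bar>f (m + (1 / s) *\<^sub>R h) - \<phi> h\<bar>) \<partial>lborel) \<le>
      (\<integral>\<^sup>+h. ennreal ((\<rho> + e) * g h + C * (1 + s * \<Delta>) * \<pi>B (m + (1 / s) *\<^sub>R h)) \<partial>lborel)"
    by (intro nn_integral_mono ennreal_leI)
  also have "\<dots> = (\<integral>\<^sup>+h. ennreal ((\<rho> + e) * g h) \<partial>lborel) +
      (\<integral>\<^sup>+h. ennreal (C * (1 + s * \<Delta>)) * ennreal (\<pi>B (m + (1 / s) *\<^sub>R h)) \<partial>lborel)"
    using \<rho> e0 g0 k0 \<pi>B0
    by (subst nn_integral_add[symmetric]) (simp_all add: ennreal_mult)
  also have "(\<integral>\<^sup>+h. ennreal ((\<rho> + e) * g h) \<partial>lborel) = ennreal ((\<rho> + e) * integral\<^sup>L lborel g)"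
    using g g0 \<rho> e0 by (subst nn_integral_eq_integral) auto
  also have "(\<integral>\<^sup>+h. ennreal (C * (1 + s * \<Delta>)) * ennreal (\<pi>B (m + (1 / s) *\<^sub>R h)) \<partial>lborel) =
      ennreal (C * (1 + s * \<Delta>)) * (ennreal (s ^ CARD('b)) * (\<integral>\<^sup>+b. ennreal (\<pi>B b) \<partial>lborel))"
    using s by (simp add: nn_integral_cmult nn_integral_lborel_rescale[of s "\<lambda>b. ennreal (\<pi>B b)" m])
  also have "(\<integral>\<^sup>+b. ennreal (\<pi>B b) \<partial>lborel) = 1"
    unfolding \<pi>1[symmetric] by (intro nn_integral_cong) (auto simp: \<pi>B_def indicator_def)
  also have "ennreal ((\<rho> + e) * integral\<^sup>L lborel g) + ennreal (C * (1 + s * \<Delta>)) * (ennreal (s ^ CARD('b)) * 1) =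
      ennreal ((\<rho> + e) * integral\<^sup>L lborel g + C * (1 + s * \<Delta>) * s ^ CARD('b))"
    using \<rho> e0 g0 k0 s by (simp add: ennreal_mult)
  finally show ?thesis by (simp add: g_def E_def e_def C_def)
qed

section \<open>The split group\<close>

locale split_group =
  fixes S :: "('w, 'x, 'z) grouped_problem" and j :: nat
    and M :: "real ^ 'b \<Rightarrow> rvec \<Rightarrow> real" and \<beta>0 :: "rvec \<Rightarrow> real ^ 'b" and \<delta> :: real
    and p :: "real ^ 'b \<Rightarrow> rvec \<Rightarrow> real" and \<mu> :: "rvec measure"
    and \<beta>hat :: "nat \<Rightarrow> 'w \<Rightarrow> rvec \<Rightarrow> real ^ 'b"
  assumes wf: "well_formed S" and setup_S: "setup_cond S"
    and j: "j < ngroups S" and dim: "dim_beta S j = CARD('b)"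
    and prior: "split_prior S j p \<mu>"
    and strong: "mixed_strong S j M \<beta>0 \<delta> p"
    and maximizer: "conditional_maximizer S j \<beta>0 \<delta> \<beta>hat"
begin

abbreviation B :: "(real ^ 'b) set" where "B \<equiv> Bset S j"
abbreviation G :: "rvec set" where "G \<equiv> gamma_space S j"
abbreviation \<Omega> :: "retained set" where "\<Omega> \<equiv> retained_space S j"
abbreviation H :: "rvec \<Rightarrow> real ^ 'b ^ 'b" where "H \<equiv> H_mat M \<beta>0"
abbreviation n :: "nat \<Rightarrow> nat" where "n t \<equiv> sample_size S t j"

lemma prob_space_pspace: "prob_space (pspace S t)"
  using setup_S unfolding setup_cond_def by (elim conjE) blast

lemma sample_size_at_top: "filterlim n at_top sequentially"
  using setup_S j unfolding setup_cond_def by (elim conjE) blast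

lemma compact_alpha_space: "l < ngroups S \<Longrightarrow> compact (alpha_space S l)"
  using setup_S unfolding setup_cond_def by (elim conjE) blast

lemma compact_theta_space: "compact (theta_space S)"
  using setup_S unfolding setup_cond_def by (elim conjE)

lemma regular_priors:
  "l < ngroups S \<Longrightarrow> regular_prior (alpha_space S l) (prior S l)"
  "regular_prior (theta_space S) (prior_theta S)"
  using setup_S unfolding setup_cond_def by (elim conjE, blast)+

lemma alpha_space_nonempty: "l < ngroups S \<Longrightarrow> alpha_space S l \<noteq> {}"
  using regular_priors(1) regular_prior_nonempty by blast

text \<open>Compactness is given for the product of regular and weak block; it passes to a factor
  because the product is nonempty.\<close>

lemma compact_G: "compact G"
proof -
  have "G = snd ` alpha_space S j"
    using alpha_space_nonempty[OF j] by (auto simp: alpha_space_def)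
  then show ?thesis
    using compact_continuous_image[OF continuous_on_snd[OF continuous_on_id] compact_alpha_space[OF j]] by simp
qed

lemma beta_space_eq: "beta_space S j = to_rvec ` B"
proof -
  have "beta_space S j \<subseteq> Rvec CARD('b)"
    using wf j dim unfolding well_formed_def by (metis (no_types, lifting))
  then have "x = to_rvec (of_rvec x :: real ^ 'b)" if "x \<in> beta_space S j" for x
    using that by (metis subsetD to_rvec_of_rvec)
  then show ?thesis by (force simp: Bset_def image_iff)
qed

lemma compact_B: "compact B"
proof -
  have "beta_space S j = fst ` alpha_space S j"
    using alpha_space_nonempty[OF j] by (auto simp: alpha_space_def)
  then have "compact (beta_space S j)"
    using compact_continuous_image[OF continuous_on_fst[OF continuous_on_id] compact_alpha_space[OF j]] by simp
  then have "compact (of_rvec ` beta_space S j :: (real ^ 'b) set)"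
    by (rule compact_continuous_image[OF continuous_on_of_rvec])
  moreover have "of_rvec ` beta_space S j = B"
    unfolding beta_space_eq by (simp add: image_image)
  ultimately show ?thesis by simp
qed

lemma borel_B [measurable]: "B \<in> sets borel"
  by (rule borel_closed[OF compact_imp_closed[OF compact_B]])

lemma borel_G [measurable]: "G \<in> sets borel"
  by (rule borel_closed[OF compact_imp_closed[OF compact_G]])

lemma compact_\<Omega>: "compact \<Omega>"
  unfolding retained_space_def
  using compact_alpha_space compact_G compact_theta_space
  by (intro compact_Times compact_PiE) auto

lemma gamma_of_\<Omega>: "\<omega> \<in> \<Omega> \<Longrightarrow> gamma_of \<omega> \<in> G"
  by (simp add: gamma_of_def retained_space_def mem_Times_iff)

lemma \<beta>0_in_B: "g \<in> G \<Longrightarrow> \<beta>0 g \<in> B"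
  and \<beta>0_max: "g \<in> G \<Longrightarrow> b \<in> B \<Longrightarrow> b \<noteq> \<beta>0 g \<Longrightarrow> M b g < M (\<beta>0 g) g"
proof -
  have *: "\<forall>g\<in>G. \<beta>0 g \<in> interior B \<and> (\<forall>b\<in>B. b \<noteq> \<beta>0 g \<longrightarrow> M b g < M (\<beta>0 g) g)"
    using strong unfolding mixed_strong_def by (elim conjE)
  show "g \<in> G \<Longrightarrow> \<beta>0 g \<in> B" using * interior_subset by blast
  show "g \<in> G \<Longrightarrow> b \<in> B \<Longrightarrow> b \<noteq> \<beta>0 g \<Longrightarrow> M b g < M (\<beta>0 g) g" using * by blast
qed

lemma M_cont: "continuous_on (B \<times> G) (\<lambda>(b, g). M b g)"
  using strong unfolding mixed_strong_def by (elim conjE)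

lemma \<delta>_pos: "0 < \<delta>"
  using strong unfolding mixed_strong_def by (elim conjE)

lemma \<beta>0_cont: "continuous_on G \<beta>0"
  by (rule continuous_on_unique_argmax[OF compact_B M_cont \<beta>0_in_B \<beta>0_max])

lemma M_smooth:
  obtains N where "N \<subseteq> B \<times> G" "tube S j \<beta>0 \<delta> \<subseteq> N" "continuous_on N (\<lambda>(b, g). hessian (\<lambda>b. M b g) b)"
proof -
  have "\<exists>N. openin (top_of_set (UNIV \<times> G)) N \<and> N \<subseteq> B \<times> G \<and>
      (\<forall>g\<in>G. (\<beta>0 g, g) \<in> N) \<and> tube S j \<beta>0 \<delta> \<subseteq> N \<and>
      (\<forall>(b, g)\<in>N. twice_differentiable_at (\<lambda>b. M b g) b) \<and>
      continuous_on N (\<lambda>(b, g). gradient (\<lambda>b. M b g) b) \<and>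
      continuous_on N (\<lambda>(b, g). hessian (\<lambda>b. M b g) b)"
    using strong unfolding mixed_strong_def by (elim conjE)
  then show ?thesis using that by blast
qed

lemma tube_iff: "(b, g) \<in> tube S j \<beta>0 \<delta> \<longleftrightarrow> g \<in> G \<and> b \<in> cball (\<beta>0 g) \<delta>"
  by (auto simp: tube_def dist_norm norm_minus_commute)

lemma cball_subset_B: "g \<in> G \<Longrightarrow> cball (\<beta>0 g) \<delta> \<subseteq> B"
proof -
  assume g: "g \<in> G"
  obtain N where "N \<subseteq> B \<times> G" "tube S j \<beta>0 \<delta> \<subseteq> N" by (rule M_smooth)
  with g tube_iff show ?thesis by blast
qed

lemma compact_tube: "compact (tube S j \<beta>0 \<delta>)"
proof -
  have *: "tube S j \<beta>0 \<delta> = (B \<times> G) \<inter> (\<lambda>(b, g). dist (\<beta>0 g) b) -` {..\<delta>}"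
  proof (intro set_eqI iffI)
    fix x assume "x \<in> tube S j \<beta>0 \<delta>"
    then show "x \<in> (B \<times> G) \<inter> (\<lambda>(b, g). dist (\<beta>0 g) b) -` {..\<delta>}"
      using tube_iff[of "fst x" "snd x"] cball_subset_B[of "snd x"] by (auto simp: case_prod_beta mem_Times_iff)
  next
    fix x assume "x \<in> (B \<times> G) \<inter> (\<lambda>(b, g). dist (\<beta>0 g) b) -` {..\<delta>}"
    then show "x \<in> tube S j \<beta>0 \<delta>"
      using tube_iff[of "fst x" "snd x"] by (auto simp: case_prod_beta mem_Times_iff)
  qed
  have "continuous_on (B \<times> G) (\<lambda>x. \<beta>0 (snd x))"
    by (rule continuous_on_compose2[OF \<beta>0_cont continuous_on_snd[OF continuous_on_id]]) auto
  then show ?thesis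
    unfolding * using compact_B compact_G
    by (intro closedin_compact[OF compact_Times continuous_closedin_preimage])
      (auto simp: case_prod_beta intro!: continuous_on_dist continuous_on_fst)
qed

text \<open>Uniform continuity on the compact tube, applied to two points over the same
  \<open>g\<close>, so that their distance is that of the regular components.\<close>

lemma hessian_M_near:
  assumes "0 < \<rho>"
  obtains e where "0 < e" "\<And>g b. g \<in> G \<Longrightarrow> norm (b - \<beta>0 g) \<le> min e \<delta> \<Longrightarrow>
    norm (hessian (\<lambda>b. M b g) b - hessian (\<lambda>b. M b g) (\<beta>0 g)) \<le> \<rho>"
proof -
  obtain N where "tube S j \<beta>0 \<delta> \<subseteq> N" "continuous_on N (\<lambda>(b, g). hessian (\<lambda>b. M b g) b)"
    by (rule M_smooth)
  then have "continuous_on (tube S j \<beta>0 \<delta>) (\<lambda>(b, g). hessian (\<lambda>b. M b g) b)"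
    using continuous_on_subset by blast
  then have "uniformly_continuous_on (tube S j \<beta>0 \<delta>) (\<lambda>(b, g). hessian (\<lambda>b. M b g) b)"
    using compact_tube compact_uniformly_continuous by blast
  with assms obtain d where d: "0 < d" "\<And>x y. x \<in> tube S j \<beta>0 \<delta> \<Longrightarrow> y \<in> tube S j \<beta>0 \<delta> \<Longrightarrow> dist x y < d \<Longrightarrow>
      dist ((\<lambda>(b, g). hessian (\<lambda>b. M b g) b) x) ((\<lambda>(b, g). hessian (\<lambda>b. M b g) b) y) < \<rho>"
    unfolding uniformly_continuous_on_def by blast
  show ?thesis
  proof (rule that[of "d / 2"])
    fix g b assume "g \<in> G" "norm (b - \<beta>0 g) \<le> min (d / 2) \<delta>"
    then show "norm (hessian (\<lambda>b. M b g) b - hessian (\<lambda>b. M b g) (\<beta>0 g)) \<le> \<rho>"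
      using d(1) d(2)[of "(b, g)" "(\<beta>0 g, g)"] \<delta>_pos
      by (auto simp: tube_def dist_Pair_Pair dist_norm)
  qed (use d in auto)
qed

lemma H_pos: obtains c where "0 < c" "\<And>g v. g \<in> G \<Longrightarrow> c * (norm v)\<^sup>2 \<le> v \<bullet> (H g *v v)"
proof -
  have "\<exists>c>0. \<forall>g\<in>G. \<forall>v. v \<bullet> (H g *v v) \<ge> c * (norm v)\<^sup>2"
    using strong unfolding mixed_strong_def by (elim conjE)
  then show ?thesis using that by blast
qed

lemma H_bounded: obtains K where "0 < K" "\<And>g. g \<in> G \<Longrightarrow> norm (H g) \<le> K"
proof -
  have "continuous_on G H"
    using strong unfolding mixed_strong_def by (elim conjE)
  then have "bounded (H ` G)"
    using compact_G compact_continuous_image compact_imp_bounded by blast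
  then show ?thesis using that unfolding bounded_pos by blast
qed

lemma B_bounded: obtains R where "0 < R" "\<And>b. b \<in> B \<Longrightarrow> norm b \<le> R"
  using compact_imp_bounded[OF compact_B] that unfolding bounded_pos by blast

lemma continuous_on_retain:
  "continuous_on A (\<lambda>(b :: real ^ 'b, a :: nat \<Rightarrow> rvec \<times> rvec, g :: rvec, \<theta> :: rvec). (a(j := (to_rvec b, g)), \<theta>))"
  unfolding case_prod_beta
  by (rule continuous_on_Pair continuous_on_fun_upd continuous_on_compose2[OF continuous_on_to_rvec[of UNIV]]
      continuous_on_fst continuous_on_snd continuous_on_id subset_UNIV)+

lemma retain_in_alphas:
  assumes "b \<in> B" and "(a, g, \<theta>) \<in> \<Omega>"
  shows "a(j := (to_rvec b, g)) \<in> alphas S" and "\<theta> \<in> theta_space S"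
proof -
  have "a \<in> (\<Pi>\<^sub>E l\<in>{..<ngroups S} - {j}. alpha_space S l)" "g \<in> G" "to_rvec b \<in> beta_space S j"
    and "\<theta> \<in> theta_space S"
    using assms by (simp_all add: retained_space_def Bset_def)
  then have "a(j := (to_rvec b, g)) \<in> (\<Pi>\<^sub>E l\<in>insert j ({..<ngroups S} - {j}). alpha_space S l)"
    by (intro PiE_fun_upd) (simp_all add: alpha_space_def)
  moreover have "insert j ({..<ngroups S} - {j}) = {..<ngroups S}" using j by auto
  ultimately show "a(j := (to_rvec b, g)) \<in> alphas S" by (simp add: alphas_def)
  show "\<theta> \<in> theta_space S" by fact
qed

lemma q1_cont: "continuous_on (alphas S \<times> theta_space S) (\<lambda>(\<alpha>, \<theta>). q1 S \<alpha> \<theta>)"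
  using setup_S unfolding setup_cond_def by (elim conjE)

lemma q1_split_cont: "continuous_on (B \<times> \<Omega>) (\<lambda>(b, \<omega>). q1_split S j b \<omega>)"
proof -
  have "continuous_on (B \<times> \<Omega>) (\<lambda>x. (\<lambda>(\<alpha>, \<theta>). q1 S \<alpha> \<theta>) ((\<lambda>(b, a, g, \<theta>). (a(j := (to_rvec b, g)), \<theta>)) x))"
  proof (rule continuous_on_compose2[OF q1_cont continuous_on_retain], rule image_subsetI)
    fix x assume "x \<in> B \<times> \<Omega>"
    then obtain b a g \<theta> where "x = (b, a, g, \<theta>)" "b \<in> B" "(a, g, \<theta>) \<in> \<Omega>"
      by (cases x) auto
    then show "(\<lambda>(b, a, g, \<theta>). (a(j := (to_rvec b, g)), \<theta>)) x \<in> alphas S \<times> theta_space S"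
      using retain_in_alphas by simp
  qed
  then show ?thesis
    by (simp add: q1_split_def case_prod_beta)
qed

lemma q1_bounded: obtains Q where "0 < Q" "\<And>b \<omega>. b \<in> B \<Longrightarrow> \<omega> \<in> \<Omega> \<Longrightarrow> \<bar>q1_split S j b \<omega>\<bar> \<le> Q"
proof -
  have "bounded ((\<lambda>(b, \<omega>). q1_split S j b \<omega>) ` (B \<times> \<Omega>))"
    by (intro compact_imp_bounded compact_continuous_image[OF q1_split_cont] compact_Times compact_B compact_\<Omega>)
  then show ?thesis using that unfolding bounded_pos by auto
qed

lemma p_tube: "continuous_on (tube S j \<beta>0 \<delta>) (\<lambda>(b, g). p b g)"
  "g \<in> G \<Longrightarrow> b \<in> cball (\<beta>0 g) \<delta> \<Longrightarrow> 0 < p b g"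
proof -
  show "continuous_on (tube S j \<beta>0 \<delta>) (\<lambda>(b, g). p b g)"
    using strong unfolding mixed_strong_def by (elim conjE)
  have "\<forall>(b, g)\<in>tube S j \<beta>0 \<delta>. 0 < p b g \<and> (\<lambda>b. p b g) differentiable (at b)"
    using strong unfolding mixed_strong_def by (elim conjE)
  then show "g \<in> G \<Longrightarrow> b \<in> cball (\<beta>0 g) \<delta> \<Longrightarrow> 0 < p b g" using tube_iff by blast
qed

text \<open>Positivity on the compact tube becomes the bound on \<open>1 / \<pi> m\<close> that the
  Laplace estimate asks for.\<close>

lemma p_lower: obtains pmin where "0 < pmin" "\<And>g b. g \<in> G \<Longrightarrow> b \<in> cball (\<beta>0 g) \<delta> \<Longrightarrow> pmin \<le> p b g"
proof -
  obtain g where "g \<in> G" using alpha_space_nonempty[OF j] by (auto simp: alpha_space_def)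
  then have "tube S j \<beta>0 \<delta> \<noteq> {}" using tube_iff[of "\<beta>0 g" g] \<delta>_pos by auto
  then have "\<exists>x\<in>tube S j \<beta>0 \<delta>. \<forall>y\<in>tube S j \<beta>0 \<delta>. (\<lambda>(b, g). p b g) x \<le> (\<lambda>(b, g). p b g) y"
    by (rule continuous_attains_inf[OF compact_tube _ p_tube(1)])
  then obtain b g where x: "(b, g) \<in> tube S j \<beta>0 \<delta>"
    "\<And>b' g'. (b', g') \<in> tube S j \<beta>0 \<delta> \<Longrightarrow> p b g \<le> p b' g'"
    by fastforce
  show ?thesis
  proof (rule that[of "p b g"])
    show "0 < p b g" using x(1) p_tube(2) tube_iff by blast
    show "p b g \<le> p b' g'" if "g' \<in> G" "b' \<in> cball (\<beta>0 g') \<delta>" for g' b'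
      using x(2) that tube_iff by blast
  qed
qed

text \<open>The quotient is the exponential of an increment of \<open>lam * q1 + ln p\<close>. With
  \<open>lam\<close> treated as one more coordinate of a compact set, uniform continuity gives a
  single radius for all \<open>lam\<close> and all retained variables.\<close>

lemma pooling_and_prior_near:
  assumes "0 < \<rho>"
  obtains e where "0 < e" "\<And>\<omega> lam b b'. \<omega> \<in> \<Omega> \<Longrightarrow> lam \<in> {0..L} \<Longrightarrow>
    norm (b - \<beta>0 (gamma_of \<omega>)) \<le> min e \<delta> \<Longrightarrow> norm (b' - \<beta>0 (gamma_of \<omega>)) \<le> min e \<delta> \<Longrightarrow>
    \<bar>exp (lam * q1_split S j b \<omega> - lam * q1_split S j b' \<omega>) * p b (gamma_of \<omega>) / p b' (gamma_of \<omega>) - 1\<bar> \<le> \<rho>"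
proof -
  define K where "K = {0..L} \<times> {(b, \<omega>) \<in> B \<times> \<Omega>. (b, gamma_of \<omega>) \<in> tube S j \<beta>0 \<delta>}"
  define \<psi> where "\<psi> = (\<lambda>(lam, b, \<omega>). lam * q1_split S j b \<omega> + ln (p b (gamma_of \<omega>)))"
  have gam: "continuous_on A (\<lambda>x. (fst x, gamma_of (snd x)))" for A :: "((real ^ 'b) \<times> retained) set"
    unfolding gamma_of_def
    by (intro continuous_on_Pair continuous_on_fst continuous_on_snd continuous_on_id)
  have "{(b, \<omega>) \<in> B \<times> \<Omega>. (b, gamma_of \<omega>) \<in> tube S j \<beta>0 \<delta>} =
      (B \<times> \<Omega>) \<inter> (\<lambda>x. (fst x, gamma_of (snd x))) -` tube S j \<beta>0 \<delta>"
    by auto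
  then have "closedin (top_of_set (B \<times> \<Omega>)) {(b, \<omega>) \<in> B \<times> \<Omega>. (b, gamma_of \<omega>) \<in> tube S j \<beta>0 \<delta>}"
    using continuous_closedin_preimage[OF gam compact_imp_closed[OF compact_tube]] by simp
  then have "compact {(b, \<omega>) \<in> B \<times> \<Omega>. (b, gamma_of \<omega>) \<in> tube S j \<beta>0 \<delta>}"
    by (rule closedin_compact[OF compact_Times[OF compact_B compact_\<Omega>]])
  then have K: "compact K"
    unfolding K_def by (intro compact_Times compact_Icc)
  have "continuous_on K (\<lambda>x. (\<lambda>(b, \<omega>). q1_split S j b \<omega>) (snd x))"
    by (rule continuous_on_compose2[OF q1_split_cont continuous_on_snd[OF continuous_on_id]]) (auto simp: K_def)
  moreover have "continuous_on K (\<lambda>x. (\<lambda>(b, g). p b g) ((\<lambda>x. (fst x, gamma_of (snd x))) (snd x)))"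
    by (rule continuous_on_compose2[OF p_tube(1)
          continuous_on_compose2[OF gam[of UNIV] continuous_on_snd[OF continuous_on_id] subset_UNIV]])
      (auto simp: K_def)
  moreover have "p (fst (snd x)) (gamma_of (snd (snd x))) \<noteq> 0" if "x \<in> K" for x
    using that p_tube(2) tube_iff by (fastforce simp: K_def)
  ultimately have "continuous_on K \<psi>"
    unfolding \<psi>_def case_prod_beta by (intro continuous_intros) auto
  then have "uniformly_continuous_on K \<psi>" using K compact_uniformly_continuous by blast
  moreover obtain \<tau> where \<tau>: "0 < \<tau>" "\<And>x :: real. \<bar>x\<bar> < \<tau> \<Longrightarrow> \<bar>exp x - 1\<bar> < \<rho>"
    using isCont_exp[of "0 :: real"] assms unfolding continuous_at_eps_delta
    by (force simp: dist_real_def)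
  ultimately obtain d where d: "0 < d" "\<And>x y. x \<in> K \<Longrightarrow> y \<in> K \<Longrightarrow> dist x y < d \<Longrightarrow> dist (\<psi> x) (\<psi> y) < \<tau>"
    unfolding uniformly_continuous_on_def by blast
  show ?thesis
  \<comment> \<open>Both points lie within \<open>d / 3\<close> of \<open>\<beta>0\<close>, hence
    within \<open>2 * d / 3 < d\<close> of each other.\<close>
  proof (rule that[of "d / 3"])
    fix \<omega> lam b b' assume \<omega>: "\<omega> \<in> \<Omega>" and lam: "lam \<in> {0..L}"
      and b: "norm (b - \<beta>0 (gamma_of \<omega>)) \<le> min (d / 3) \<delta>" and b': "norm (b' - \<beta>0 (gamma_of \<omega>)) \<le> min (d / 3) \<delta>"
    have cb: "b \<in> cball (\<beta>0 (gamma_of \<omega>)) \<delta>" "b' \<in> cball (\<beta>0 (gamma_of \<omega>)) \<delta>"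
      using b b' by (auto simp: dist_norm norm_minus_commute)
    then have "(lam, b, \<omega>) \<in> K" "(lam, b', \<omega>) \<in> K"
      using \<omega> lam cball_subset_B[OF gamma_of_\<Omega>[OF \<omega>]] gamma_of_\<Omega>[OF \<omega>] by (auto simp: K_def tube_iff)
    moreover have "dist b b' < d"
      using norm_triangle_ineq4[of "b - \<beta>0 (gamma_of \<omega>)" "b' - \<beta>0 (gamma_of \<omega>)"] b b' d(1) by (simp add: dist_norm)
    ultimately have "\<bar>\<psi> (lam, b, \<omega>) - \<psi> (lam, b', \<omega>)\<bar> < \<tau>"
      using d(2)[of "(lam, b, \<omega>)" "(lam, b', \<omega>)"] by (simp add: dist_Pair_Pair dist_real_def)
    moreover have "exp (\<psi> (lam, b, \<omega>) - \<psi> (lam, b', \<omega>)) =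
        exp (lam * q1_split S j b \<omega> - lam * q1_split S j b' \<omega>) * p b (gamma_of \<omega>) / p b' (gamma_of \<omega>)"
      using p_tube(2)[OF gamma_of_\<Omega>[OF \<omega>]] cb by (simp add: \<psi>_def exp_add exp_diff exp_minus field_simps)
    ultimately show "\<bar>exp (lam * q1_split S j b \<omega> - lam * q1_split S j b' \<omega>) * p b (gamma_of \<omega>) / p b' (gamma_of \<omega>) - 1\<bar> \<le> \<rho>"
      using \<tau>(2) by (metis less_imp_le)
  qed (use d in auto)
qed

end

section \<open>Vanishing of the Laplace remainder\<close>

lemma filterlim_sqrt_real_at_top:
  assumes "filterlim n at_top sequentially"
  shows "filterlim (\<lambda>t. sqrt (real (n t))) at_top sequentially"
  by (rule filterlim_compose[OF sqrt_at_top filterlim_compose[OF filterlim_real_sequentially assms]])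

lemma exp_minus_square_tendsto_0:
  fixes a :: real assumes "0 < a"
  shows "((\<lambda>s. exp (- a * s\<^sup>2)) \<longlongrightarrow> 0) at_top"
  using assms by real_asymp

lemma power_times_exp_minus_square_tendsto_0:
  fixes a :: real assumes a: "0 < a"
  shows "((\<lambda>s. s ^ k * exp (- a * s\<^sup>2)) \<longlongrightarrow> 0) at_top"
proof (rule tendsto_sandwich[where f = "\<lambda>_. 0" and h = "\<lambda>s. s ^ k * exp (- a * s)"])
  have "((\<lambda>s. (a * s) ^ k / exp (a * s)) \<longlongrightarrow> 0) at_top"
    by (rule filterlim_compose[OF tendsto_power_div_exp_0])
      (use a in \<open>auto intro!: filterlim_tendsto_pos_mult_at_top[OF tendsto_const] filterlim_ident\<close>)
  from tendsto_mult_right_zero[OF this, of "1 / a ^ k"]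
  show "((\<lambda>s. s ^ k * exp (- a * s)) \<longlongrightarrow> 0) at_top"
    using a by (simp add: power_mult_distrib exp_minus field_simps)
  show "\<forall>\<^sub>F s in at_top. s ^ k * exp (- a * s\<^sup>2) \<le> s ^ k * exp (- a * s)"
    using eventually_ge_at_top[of 1]
    by eventually_elim (use a in \<open>auto intro!: mult_left_mono simp: power2_eq_square\<close>)
  show "\<forall>\<^sub>F s in at_top. 0 \<le> s ^ k * exp (- a * s\<^sup>2)"
    using eventually_ge_at_top[of 0] by eventually_elim auto
qed auto

text \<open>Any polynomial loses against \<open>exp (- 2 * \<eta> * s\<^sup>2)\<close>. The
  expression involves neither \<open>lam\<close> nor \<omega>, so one threshold for \<open>s\<close>
  serves all of them.\<close>

lemma laplace_remainder_small:
  fixes a \<eta> I C \<Delta> d :: real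
  assumes "0 < a" "0 < \<eta>" "0 < d"
  shows "\<forall>\<^sub>F s in at_top. exp (- a * s\<^sup>2) * I + C * exp (- 2 * \<eta> * s\<^sup>2) * (1 + s * \<Delta>) * s ^ k \<le> d"
proof -
  have "((\<lambda>s. exp (- a * s\<^sup>2) * I + (C * (s ^ k * exp (- (2 * \<eta>) * s\<^sup>2)) +
      C * \<Delta> * (s ^ Suc k * exp (- (2 * \<eta>) * s\<^sup>2)))) \<longlongrightarrow> 0 * I + (C * 0 + C * \<Delta> * 0)) at_top"
    using assms by (intro tendsto_intros exp_minus_square_tendsto_0 power_times_exp_minus_square_tendsto_0) auto
  then have "((\<lambda>s. exp (- a * s\<^sup>2) * I + C * exp (- 2 * \<eta> * s\<^sup>2) * (1 + s * \<Delta>) * s ^ k) \<longlongrightarrow> 0) at_top"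
    by (simp add: algebra_simps)
  then have "\<forall>\<^sub>F s in at_top. exp (- a * s\<^sup>2) * I + C * exp (- 2 * \<eta> * s\<^sup>2) * (1 + s * \<Delta>) * s ^ k < d"
    using assms(3) by (simp add: order_tendsto_iff)
  then show ?thesis by eventually_elim simp
qed

text \<open>With \<open>k\<close> half an upper bound for \<open>norm (H g)\<close> over
  \<open>G\<close>, this mass bounds every Gaussian normalizer of the limit from below.\<close>

lemma gaussian_mass_pos:
  assumes "0 < k"
  shows "0 < (\<integral>h. exp (- k * (norm h)\<^sup>2) \<partial>(lborel :: 'a::euclidean_space measure))"
proof -
  have "\<not> (AE h in (lborel :: 'a measure). exp (- k * (norm h)\<^sup>2) = 0)"
    by (simp add: eventually_False trivial_limit_def[symmetric] ae_filter_eq_bot_iff)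
  then show ?thesis
    using integral_nonneg_eq_0_iff_AE[OF integrable_exp_minus_norm_square[OF assms, where 'a='a]]
    by (simp add: less_le)
qed

section \<open>The conditional kernel and its Gaussian approximation\<close>

context split_group begin

definition kernel :: "nat \<Rightarrow> 'w \<Rightarrow> real \<Rightarrow> retained \<Rightarrow> real ^ 'b \<Rightarrow> real" where
  "kernel t w lam \<omega> b = (if b \<in> B
     then exp (q2_split S j t w b (gamma_of \<omega>) + lam * q1_split S j b \<omega>) * p b (gamma_of \<omega>) else 0)"

lemma cond_law_eq: "cond_law S j p t w lam \<omega> = normalized lborel (kernel t w lam \<omega>)"
  unfolding cond_law_def kernel_def ..

lemma p_nonneg: "b \<in> B \<Longrightarrow> g \<in> G \<Longrightarrow> 0 \<le> p b g"
proof -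
  have "\<forall>b\<in>B. \<forall>g\<in>G. 0 \<le> p b g"
    using prior unfolding split_prior_def by (elim conjE)
  then show "b \<in> B \<Longrightarrow> g \<in> G \<Longrightarrow> 0 \<le> p b g" by simp
qed

lemma p_measurable: "(\<lambda>(b, g). p b g * indicator (B \<times> G) (b, g)) \<in> borel_measurable (borel \<Otimes>\<^sub>M borel)"
proof -
  have "(\<lambda>(b, g). p b g * indicator (B \<times> G) (b, g)) \<in> borel_measurable borel"
    using prior unfolding split_prior_def by (elim conjE)
  then show ?thesis by (simp add: borel_prod)
qed

lemma p_section_measurable:
  assumes "g \<in> G" shows "(\<lambda>b. p b g * indicator B b) \<in> borel_measurable borel"
proof -
  have "(\<lambda>b. (\<lambda>(b, g). p b g * indicator (B \<times> G) (b, g)) (b, g)) \<in> borel_measurable borel"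
    by (rule measurable_compose[OF _ p_measurable]) simp
  with assms show ?thesis by (simp add: indicator_times)
qed

lemma p_section_integral: "g \<in> G \<Longrightarrow> (\<integral>\<^sup>+ b\<in>B. ennreal (p b g) \<partial>lborel) = 1"
proof -
  have "\<forall>g\<in>G. (\<integral>\<^sup>+ b\<in>B. ennreal (p b g) \<partial>lborel) = 1"
    using prior unfolding split_prior_def by (elim conjE)
  then show "g \<in> G \<Longrightarrow> (\<integral>\<^sup>+ b\<in>B. ennreal (p b g) \<partial>lborel) = 1" by simp
qed

lemma kernel_nonneg: "\<omega> \<in> \<Omega> \<Longrightarrow> 0 \<le> kernel t w lam \<omega> b"
  using p_nonneg gamma_of_\<Omega> by (simp add: kernel_def)

lemma q1_split_section_cont:
  assumes "\<omega> \<in> \<Omega>" shows "continuous_on B (\<lambda>b. q1_split S j b \<omega>)"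
proof -
  have "continuous_on B (\<lambda>b. (\<lambda>(b, \<omega>). q1_split S j b \<omega>) (b, \<omega>))"
    by (rule continuous_on_compose2[OF q1_split_cont])
      (use assms in \<open>auto intro: continuous_on_Pair continuous_on_id continuous_on_const\<close>)
  then show ?thesis by simp
qed

lemma kernel_measurable:
  assumes q2: "continuous_on (alpha_space S j) (q2_data S j t w)" and \<omega>: "\<omega> \<in> \<Omega>"
  shows "kernel t w lam \<omega> \<in> borel_measurable borel"
proof -
  have "continuous_on B (\<lambda>b. q2_split S j t w b (gamma_of \<omega>))"
    unfolding q2_split_def
    by (rule continuous_on_compose2[OF q2])
      (use gamma_of_\<Omega>[OF \<omega>] in \<open>auto simp: alpha_space_def Bset_def
         intro: continuous_on_Pair continuous_on_to_rvec continuous_on_const\<close>)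
  then have "continuous_on B (\<lambda>b. exp (q2_split S j t w b (gamma_of \<omega>) + lam * q1_split S j b \<omega>))"
    using q1_split_section_cont[OF \<omega>] by (intro continuous_intros)
  then have "(\<lambda>b. indicator B b *\<^sub>R exp (q2_split S j t w b (gamma_of \<omega>) + lam * q1_split S j b \<omega>)) \<in> borel_measurable borel"
    by (rule borel_measurable_continuous_on_indicator[OF borel_B])
  then have "(\<lambda>b. (indicator B b *\<^sub>R exp (q2_split S j t w b (gamma_of \<omega>) + lam * q1_split S j b \<omega>)) *
      (p b (gamma_of \<omega>) * indicator B b)) \<in> borel_measurable borel"
    using p_section_measurable[OF gamma_of_\<Omega>[OF \<omega>]] by (rule borel_measurable_times)
  then show ?thesis
    by (rule measurable_cong[THEN iffD1, rotated]) (simp add: kernel_def)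
qed

text \<open>A translation into \<open>laplace_bound\<close> at a fixed outcome, where each
  probabilistic condition enters as a plain inequality. The right-hand side contains neither
  \<omega> nor \<open>lam\<close> nor the outcome, which is what makes the result uniform.\<close>

lemma kernel_close:
  assumes \<omega>: "\<omega> \<in> \<Omega>" and lam: "lam \<in> {0..L}" and n: "1 \<le> n t"
    and g: "g = gamma_of \<omega>" and m: "m = \<beta>hat t w g" and s: "s = sqrt (real (n t))"
    and \<epsilon>: "0 < \<epsilon>" "\<epsilon> \<le> \<delta>" and \<rho>: "0 < \<rho>" "\<rho> \<le> c / 2"
    and c: "0 < c" "\<And>v. c * (norm v)\<^sup>2 \<le> v \<bullet> (H g *v v)"
    and near_M: "\<And>b. norm (b - \<beta>0 g) \<le> \<epsilon> \<Longrightarrow>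
      norm (hessian (\<lambda>b. M b g) b - hessian (\<lambda>b. M b g) (\<beta>0 g)) \<le> \<rho> / 2"
    and near_q1: "\<And>b b'. norm (b - \<beta>0 g) \<le> \<epsilon> \<Longrightarrow> norm (b' - \<beta>0 g) \<le> \<epsilon> \<Longrightarrow>
      \<bar>exp (lam * q1_split S j b \<omega> - lam * q1_split S j b' \<omega>) * p b g / p b' g - 1\<bar> \<le> \<rho>"
    and sep: "\<And>b. b \<in> B \<Longrightarrow> \<epsilon> \<le> dist b (\<beta>0 g) \<Longrightarrow> M b g \<le> M (\<beta>0 g) g - 4 * \<eta>"
    and Q: "\<And>b. b \<in> B \<Longrightarrow> \<bar>q1_split S j b \<omega>\<bar> \<le> Q"
    and R: "\<And>b. b \<in> B \<Longrightarrow> norm b \<le> R"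
    and pmin: "0 < pmin" "\<And>b. b \<in> cball (\<beta>0 g) \<delta> \<Longrightarrow> pmin \<le> p b g"
    and q2_cont: "continuous_on (alpha_space S j) (q2_data S j t w)"
    and q2_M: "\<And>b. b \<in> B \<Longrightarrow> \<bar>q2_bar S j t w b g - M b g\<bar> \<le> \<eta>"
    and q2_diff: "\<And>b. b \<in> cball (\<beta>0 g) \<delta> \<Longrightarrow> twice_differentiable_at (\<lambda>b. q2_bar S j t w b g) b"
    and q2_hess: "\<And>b. b \<in> cball (\<beta>0 g) \<delta> \<Longrightarrow>
      norm (hessian (\<lambda>b. q2_bar S j t w b g) b - hessian (\<lambda>b. M b g) b) \<le> \<rho> / 2"
    and max: "\<And>b. norm (b - \<beta>0 g) \<le> \<delta> \<Longrightarrow> q2_split S j t w b g \<le> q2_split S j t w m g"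
    and cons: "norm (m - \<beta>0 g) \<le> \<epsilon> / 2"
  shows "(\<integral>\<^sup>+h. ennreal ((1 + norm h) * \<bar>kernel t w lam \<omega> (m + (1 / s) *\<^sub>R h) /
        (exp (q2_split S j t w m g + lam * q1_split S j m \<omega>) * p m g) - exp (- (1/2) * (h \<bullet> (H g *v h)))\<bar>) \<partial>lborel) \<le>
    ennreal ((\<rho> + exp (- (c / 16) * (s * \<epsilon>)\<^sup>2)) *
        (\<integral>h. (1 + norm h) * ((1 + (norm h)\<^sup>2) * exp (- (c / 4) * (norm h)\<^sup>2)) \<partial>(lborel :: (real ^ 'b) measure)) +
      exp (2 * L * Q) * (1 / pmin) * exp (- 2 * \<eta> * s\<^sup>2) * (1 + s * (2 * R)) * s ^ CARD('b))"
proof -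
  define C where "C = cball (\<beta>0 g) \<epsilon>"
  have gG: "g \<in> G" using gamma_of_\<Omega>[OF \<omega>] g by simp
  have s0: "0 < s" "s\<^sup>2 = real (n t)" using n s by auto
  have q_eq: "q2_split S j t w b g = s\<^sup>2 * q2_bar S j t w b g" for b
    using n s0 by (simp add: q2_bar_def)
  have C_sub: "C \<subseteq> cball (\<beta>0 g) \<delta>" using \<epsilon> by (auto simp: C_def)
  have CB: "C \<subseteq> B" using C_sub cball_subset_B[OF gG] by simp
  have normC: "norm (b - \<beta>0 g) \<le> \<epsilon>" if "b \<in> C" for b
    using that by (simp add: C_def dist_norm norm_minus_commute)
  \<comment> \<open>The margin of \<open>\<epsilon> / 2\<close> puts \<open>m\<close> into the
    interior, where its gradient has to vanish.\<close>
  have m_int: "m \<in> interior C"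
    using cons \<epsilon> by (simp add: C_def interior_cball dist_norm norm_minus_commute)
  then have mC: "m \<in> C" using interior_subset by blast
  have mB: "m \<in> B" using mC CB by blast
  have pm: "pmin \<le> p m g" using pmin(2) mC C_sub by blast
  have umax: "q2_bar S j t w b g \<le> q2_bar S j t w m g" if "norm (b - \<beta>0 g) \<le> \<delta>" for b
    using max[OF that] n unfolding q_eq s0(2) by simp
  show ?thesis
    unfolding kernel_def g[symmetric]
  proof (rule laplace_bound[where ?b0.0 = "\<beta>0 g" and \<epsilon> = \<epsilon>])
    show "(\<lambda>b. if b \<in> B then exp (q2_split S j t w b g + lam * q1_split S j b \<omega>) * p b g else 0) \<in> borel_measurable borel"
      using kernel_measurable[OF q2_cont \<omega>, of lam] unfolding kernel_def[abs_def] g .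
    show "(\<lambda>b. p b g * indicator B b) \<in> borel_measurable borel" by (rule p_section_measurable[OF gG])
    show "0 \<le> p b g" if "b \<in> B" for b using p_nonneg[OF that gG] .
    show "(\<integral>\<^sup>+b\<in>B. ennreal (p b g) \<partial>lborel) = 1" by (rule p_section_integral[OF gG])
    show "0 < p m g" using pm pmin(1) by simp
    show "1 / p m g \<le> 1 / pmin" using pm pmin(1) by (simp add: frac_le)
    show "0 < c" "c * (norm v)\<^sup>2 \<le> v \<bullet> (H g *v v)" for v using c by auto
    show "0 < s" by (rule s0(1))
    show "0 \<le> \<rho>" "\<rho> \<le> c / 2" using \<rho> by auto
    show "cball (\<beta>0 g) \<epsilon> \<subseteq> B" using CB by (simp add: C_def)
    show "norm (m - \<beta>0 g) \<le> \<epsilon> / 2" "0 < \<epsilon>" using cons \<epsilon> by auto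
    show "\<bar>(q2_split S j t w b g - q2_split S j t w m g) + s\<^sup>2 / 2 * ((b - m) \<bullet> (H g *v (b - m)))\<bar>
        \<le> s\<^sup>2 / 2 * (\<rho> * (norm (b - m))\<^sup>2)" if "b \<in> cball (\<beta>0 g) \<epsilon>" for b
    proof -
      have "\<exists>\<xi>\<in>C. q2_bar S j t w b g - q2_bar S j t w m g =
          (1/2) * ((b - m) \<bullet> (hessian (\<lambda>b. q2_bar S j t w b g) \<xi> *v (b - m)))"
      proof (rule taylor_at_max)
        show "convex C" by (simp add: C_def)
        show "twice_differentiable_at (\<lambda>b. q2_bar S j t w b g) x" if "x \<in> C" for x
          using q2_diff that C_sub by blast
        show "q2_bar S j t w x g \<le> q2_bar S j t w m g" if "x \<in> C" for x
          using umax normC[OF that] \<epsilon>(2) by simp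
        show "b \<in> C" using that by (simp add: C_def)
      qed (rule m_int)
      then obtain \<xi> where \<xi>: "\<xi> \<in> C" and taylor: "q2_bar S j t w b g - q2_bar S j t w m g =
          (1/2) * ((b - m) \<bullet> (hessian (\<lambda>b. q2_bar S j t w b g) \<xi> *v (b - m)))" by blast
      \<comment> \<open>\<open>H\<close> is minus the Hessian of \<open>M\<close> at
        \<open>\<beta>0\<close>, so adding the quadratic form of \<open>H\<close> to twice the
        Taylor term leaves exactly that of \<open>A\<close>. One \<open>\<rho> / 2\<close> pays for
        sample against population, the other for \<xi> against \<open>\<beta>0\<close>.\<close>
      define A where "A = hessian (\<lambda>b. q2_bar S j t w b g) \<xi> - hessian (\<lambda>b. M b g) (\<beta>0 g)"
      have "norm A \<le> norm (hessian (\<lambda>b. q2_bar S j t w b g) \<xi> - hessian (\<lambda>b. M b g) \<xi>) +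
          norm (hessian (\<lambda>b. M b g) \<xi> - hessian (\<lambda>b. M b g) (\<beta>0 g))"
        unfolding A_def by (rule order_trans[OF _ norm_triangle_ineq]) simp
      also have "\<dots> \<le> \<rho> / 2 + \<rho> / 2"
        using q2_hess near_M[OF normC[OF \<xi>]] \<xi> C_sub by (intro add_mono) auto
      finally have "norm A \<le> \<rho>" by simp
      have "(q2_split S j t w b g - q2_split S j t w m g) + s\<^sup>2 / 2 * ((b - m) \<bullet> (H g *v (b - m))) =
          s\<^sup>2 / 2 * (2 * (q2_bar S j t w b g - q2_bar S j t w m g) + (b - m) \<bullet> (H g *v (b - m)))"
        unfolding q_eq by (simp add: algebra_simps)
      also have "\<dots> = s\<^sup>2 / 2 * ((b - m) \<bullet> (A *v (b - m)))"
        unfolding taylor A_def H_mat_def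
        \<comment> \<open>The instance at 0 moves the minus sign in \<open>H_mat\<close> out of the
          matrix product.\<close>
        using matrix_vector_mult_diff_rdistrib[of 0 "hessian (\<lambda>b. M b g) (\<beta>0 g)"]
        by (simp add: matrix_vector_mult_diff_rdistrib inner_diff_right)
      also have "\<bar>\<dots>\<bar> \<le> s\<^sup>2 / 2 * (\<rho> * (norm (b - m))\<^sup>2)"
        unfolding abs_mult
        using order_trans[OF abs_quadratic_form_le mult_right_mono[OF \<open>norm A \<le> \<rho>\<close>]]
        by (intro mult_mono) auto
      finally show ?thesis .
    qed
    show "\<bar>exp (lam * q1_split S j b \<omega> - lam * q1_split S j m \<omega>) * p b g / p m g - 1\<bar> \<le> \<rho>"
      if "b \<in> cball (\<beta>0 g) \<epsilon>" for b
      using near_q1 normC that mC by (simp add: C_def)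
    show "q2_split S j t w b g - q2_split S j t w m g \<le> - 2 * \<eta> * s\<^sup>2"
      if "b \<in> B" "b \<notin> cball (\<beta>0 g) \<epsilon>" for b
    proof -
      \<comment> \<open>A gap of \<open>4 * \<eta>\<close> in \<open>M\<close> survives as
        \<open>2 * \<eta>\<close> for the sample criterion, which is off by at most \<eta> at each
        of two points; \<open>\<beta>0\<close> can be replaced by \<open>m\<close> because it
        competes in the maximization.\<close>
      have "M b g \<le> M (\<beta>0 g) g - 4 * \<eta>"
        using that by (intro sep) (auto simp: dist_commute)
      moreover have "q2_bar S j t w (\<beta>0 g) g \<le> q2_bar S j t w m g" using umax \<delta>_pos by simp
      ultimately have "q2_bar S j t w b g - q2_bar S j t w m g \<le> - 2 * \<eta>"
        using q2_M[OF that(1)] q2_M[OF \<beta>0_in_B[OF gG]] by (simp add: abs_le_iff)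
      then have "s\<^sup>2 * (q2_bar S j t w b g - q2_bar S j t w m g) \<le> s\<^sup>2 * (- 2 * \<eta>)"
        by (intro mult_left_mono) auto
      then show ?thesis unfolding q_eq by (simp add: algebra_simps)
    qed
    show "exp (lam * q1_split S j b \<omega> - lam * q1_split S j m \<omega>) \<le> exp (2 * L * Q)" if "b \<in> B" for b
    proof -
      have "0 \<le> Q" "q1_split S j b \<omega> - q1_split S j m \<omega> \<le> 2 * Q"
        using Q[OF that] Q[OF mB] by linarith+
      then have "lam * (q1_split S j b \<omega> - q1_split S j m \<omega>) \<le> lam * (2 * Q)" "lam * (2 * Q) \<le> L * (2 * Q)"
        using lam by (auto intro!: mult_left_mono mult_right_mono)
      then show ?thesis by (simp add: algebra_simps)
    qed
    show "norm (b - m) \<le> 2 * R" if "b \<in> B" for b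
      using norm_triangle_ineq4[of b m] R[OF that] R[OF mB] by simp
  qed
qed

text \<open>\<open>K\<close> bounds the quadratic form of \<open>H g\<close> from above, so
  \<open>z\<close> bounds the Gaussian normalizer from below without reference to \<open>g\<close>.
  The last two conclusions allow the normalization to be undone when the mean is integrated over the
  retained variables.\<close>

lemma PS_close:
  assumes \<omega>: "\<omega> \<in> \<Omega>" and n: "1 \<le> n t"
    and q2_cont: "continuous_on (alpha_space S j) (q2_data S j t w)"
    and g: "g = gamma_of \<omega>" and m: "m = \<beta>hat t w g" and s: "s = sqrt (real (n t))"
    and pm: "0 < p m g"
    and c: "0 < c" "\<And>v. c * (norm v)\<^sup>2 \<le> v \<bullet> (H g *v v)" and K: "0 < K" "norm (H g) \<le> K"
    and z: "z = (\<integral>h. exp (- (K / 2) * (norm h)\<^sup>2) \<partial>(lborel :: (real ^ 'b) measure))"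
    and bound: "(\<integral>\<^sup>+h. ennreal ((1 + norm h) * \<bar>kernel t w lam \<omega> (m + (1 / s) *\<^sub>R h) /
        (exp (q2_split S j t w m g + lam * q1_split S j m \<omega>) * p m g) - exp (- (1/2) * (h \<bullet> (H g *v h)))\<bar>) \<partial>lborel) \<le> ennreal D"
    and D: "0 \<le> D" "D \<le> z / 2"
  shows "d_BL (PS S j p \<beta>hat t w lam \<omega>) (mvnormal 0 (matrix_inv (H g))) \<le> ennreal (2 * D / z)"
    and "norm (\<integral>h. h \<partial>PS S j p \<beta>hat t w lam \<omega>) \<le> 2 * D / z"
    and "integrable lborel (kernel t w lam \<omega>)"
    and "0 < integral\<^sup>L lborel (kernel t w lam \<omega>)"
proof -
  have s0: "0 < s" using n s by simp
  define e where "e = exp (q2_split S j t w m g + lam * q1_split S j m \<omega>) * p m g"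
  have e0: "0 < e" using pm by (simp add: e_def)
  define f where "f = (\<lambda>h. kernel t w lam \<omega> (m + (1 / s) *\<^sub>R h) / e)"
  define \<phi> where "\<phi> = (\<lambda>h. exp (- (1/2) * (h \<bullet> (H g *v h))))"
  have [measurable]: "kernel t w lam \<omega> \<in> borel_measurable borel"
    by (rule kernel_measurable[OF q2_cont \<omega>])
  have k0: "0 \<le> kernel t w lam \<omega> b" for b by (rule kernel_nonneg[OF \<omega>])
  have f_meas: "f \<in> borel_measurable borel" unfolding f_def by measurable
  have f0: "0 \<le> f h" for h using k0 e0 by (simp add: f_def)
  have "continuous_on UNIV (\<lambda>h. H g *v h)"
    by (rule matrix_vector_mult_linear_continuous_on)
  then have "continuous_on UNIV \<phi>"
    unfolding \<phi>_def by (intro continuous_intros)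
  then have \<phi>_meas [measurable]: "\<phi> \<in> borel_measurable borel"
    by (rule borel_measurable_continuous_onI)
  have \<phi>_le: "\<phi> h \<le> exp (- (c / 2) * (norm h)\<^sup>2)" for h using c(2)[of h] by (simp add: \<phi>_def)
  have \<phi>_abs: "\<bar>\<phi> h\<bar> = \<phi> h" for h by (simp add: \<phi>_def)
  have \<phi>_int: "integrable lborel \<phi>"
    using c(1) \<phi>_le by (intro Bochner_Integration.integrable_bound[OF integrable_exp_minus_norm_square[of "c / 2"]])
      (auto simp: \<phi>_abs)
  have \<phi>1_int: "integrable lborel (\<lambda>h. norm h * \<phi> h)"
  proof (rule Bochner_Integration.integrable_bound[OF integrable_gaussian_majorant[of "c / 2"]])
    have "norm h * \<phi> h \<le> (1 + norm h) * ((1 + (norm h)\<^sup>2) * exp (- (c / 2) * (norm h)\<^sup>2))" for h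
    proof -
      have "1 * exp (- (c / 2) * (norm h)\<^sup>2) \<le> (1 + (norm h)\<^sup>2) * exp (- (c / 2) * (norm h)\<^sup>2)"
        by (intro mult_right_mono) auto
      with \<phi>_le[of h] have "\<phi> h \<le> (1 + (norm h)\<^sup>2) * exp (- (c / 2) * (norm h)\<^sup>2)" by linarith
      then show ?thesis by (intro mult_mono) (auto simp: \<phi>_def)
    qed
    then show "AE h in lborel. norm (norm h * \<phi> h) \<le> norm ((1 + norm h) * ((1 + (norm h)\<^sup>2) * exp (- (c / 2) * (norm h)\<^sup>2)))"
      by (auto simp: abs_mult \<phi>_abs)
  qed (use c in auto)
  have z0: "0 < z" unfolding z using K(1) by (intro gaussian_mass_pos) auto
  have "z \<le> integral\<^sup>L lborel \<phi>"
    unfolding z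
  proof (rule integral_mono[OF integrable_exp_minus_norm_square \<phi>_int])
    fix h :: "real ^ 'b"
    have "h \<bullet> (H g *v h) \<le> K * (norm h)\<^sup>2"
      using order_trans[OF abs_quadratic_form_le mult_right_mono[OF K(2)], of h] by (simp add: abs_le_iff)
    then show "exp (- (K / 2) * (norm h)\<^sup>2) \<le> \<phi> h" by (simp add: \<phi>_def)
  qed (use K in auto)
  note close = normalized_close[OF f_meas f0 \<phi>_int _ _ \<phi>1_int _ z0 this D]
  have \<phi>_even: "\<phi> (- h) = \<phi> h" and \<phi>0: "0 \<le> \<phi> h" for h
    using matrix_vector_mult_diff_distrib[of "H g" 0 h] by (simp_all add: \<phi>_def)
  have b: "(\<integral>\<^sup>+h. ennreal ((1 + norm h) * \<bar>f h - \<phi> h\<bar>) \<partial>lborel) \<le> ennreal D"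
    using bound by (simp add: f_def \<phi>_def e_def)
  have "PS S j p \<beta>hat t w lam \<omega> = normalized lborel (\<lambda>h. kernel t w lam \<omega> (m + (1 / s) *\<^sub>R h))"
    unfolding PS_def cond_law_eq g[symmetric] m[symmetric] s[symmetric]
    by (rule distr_normalized_lborel_affine[OF s0 _ k0]) simp
  also have "\<dots> = normalized lborel f"
    unfolding f_def divide_real_def
    by (subst mult.commute, rule normalized_cmult[symmetric]) (use e0 k0 in auto)
  finally have PS: "PS S j p \<beta>hat t w lam \<omega> = normalized lborel f" .
  have "matrix_inv (matrix_inv (H g)) = H g"
    by (rule matrix_inv_matrix_inv[OF invertible_of_quadratic_form[OF c]])
  then have mv: "mvnormal 0 (matrix_inv (H g)) = normalized lborel \<phi>"
    by (simp add: mvnormal_def \<phi>_def)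
  show "d_BL (PS S j p \<beta>hat t w lam \<omega>) (mvnormal 0 (matrix_inv (H g))) \<le> ennreal (2 * D / z)"
    unfolding PS mv by (rule close(3)[OF \<phi>0 \<phi>_even b])
  show "norm (\<integral>h. h \<partial>PS S j p \<beta>hat t w lam \<omega>) \<le> 2 * D / z"
    unfolding PS by (rule close(4)[OF \<phi>0 \<phi>_even b])
  have int: "integrable lborel f" "0 < integral\<^sup>L lborel f"
    using close(1,2)[OF \<phi>0 \<phi>_even b] by auto
  \<comment> \<open>The change of variables is run backwards: were the mass of the kernel 0 or
    infinite, so would be that of \<open>f\<close>.\<close>
  have "(\<integral>\<^sup>+b. ennreal (kernel t w lam \<omega> b) \<partial>lborel) < \<infinity>"
    "(\<integral>\<^sup>+b. ennreal (kernel t w lam \<omega> b) \<partial>lborel) \<noteq> 0"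
  proof -
    have "(\<integral>\<^sup>+h. ennreal (f h) \<partial>lborel) = (\<integral>\<^sup>+h. (\<lambda>b. ennreal (kernel t w lam \<omega> b / e)) (m + (1 / s) *\<^sub>R h) \<partial>lborel)"
      by (simp add: f_def)
    also have "\<dots> = ennreal (s ^ CARD('b)) * (\<integral>\<^sup>+b. ennreal (kernel t w lam \<omega> b / e) \<partial>lborel)"
      using s0 by (subst nn_integral_lborel_rescale) auto
    also have "(\<integral>\<^sup>+b. ennreal (kernel t w lam \<omega> b / e) \<partial>lborel) = ennreal (1 / e) * (\<integral>\<^sup>+b. ennreal (kernel t w lam \<omega> b) \<partial>lborel)"
      using e0 k0 by (subst nn_integral_cmult[symmetric]) (auto intro!: nn_integral_cong simp: ennreal_mult[symmetric])
    finally have eq: "ennreal (integral\<^sup>L lborel f) =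
        ennreal (s ^ CARD('b)) * (ennreal (1 / e) * (\<integral>\<^sup>+b. ennreal (kernel t w lam \<omega> b) \<partial>lborel))"
      using nn_integral_eq_integral[OF int(1)] f0 by simp
    show "(\<integral>\<^sup>+b. ennreal (kernel t w lam \<omega> b) \<partial>lborel) \<noteq> 0"
      using eq int(2) by auto
    show "(\<integral>\<^sup>+b. ennreal (kernel t w lam \<omega> b) \<partial>lborel) < \<infinity>"
    proof (rule ccontr)
      assume "\<not> ?thesis"
      then have "(\<integral>\<^sup>+b. ennreal (kernel t w lam \<omega> b) \<partial>lborel) = \<top>" by (simp add: not_less top_unique)
      with eq s0 e0 show False by (simp add: ennreal_mult_top)
    qed
  qed
  then show k_int: "integrable lborel (kernel t w lam \<omega>)"
    using k0 by (intro integrableI_bounded) auto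
  have "ennreal (integral\<^sup>L lborel (kernel t w lam \<omega>)) = (\<integral>\<^sup>+b. ennreal (kernel t w lam \<omega> b) \<partial>lborel)"
    using k_int k0 by (simp add: nn_integral_eq_integral)
  with \<open>(\<integral>\<^sup>+b. ennreal (kernel t w lam \<omega> b) \<partial>lborel) \<noteq> 0\<close>
  have "integral\<^sup>L lborel (kernel t w lam \<omega>) \<noteq> 0" by auto
  moreover have "0 \<le> integral\<^sup>L lborel (kernel t w lam \<omega>)" using k0 by simp
  ultimately show "0 < integral\<^sup>L lborel (kernel t w lam \<omega>)" by linarith
qed

section \<open>Events of probability approaching one\<close>

lemma wpa1_q2_continuous:
  "wpa1 (pspace S) (\<lambda>t w. \<forall>l\<in>{..<ngroups S}. continuous_on (alpha_space S l) (q2_data S l t w))"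
proof (rule wpa1_ball[OF prob_space_pspace])
  have "\<forall>l<ngroups S. wpa1 (pspace S) (\<lambda>t w. continuous_on (alpha_space S l) (q2_data S l t w))"
    using setup_S unfolding setup_cond_def by (elim conjE)
  then show "wpa1 (pspace S) (\<lambda>t w. continuous_on (alpha_space S l) (q2_data S l t w))" if "l \<in> {..<ngroups S}" for l
    using that by simp
qed simp

lemma wpa1_q2_near_M:
  assumes "0 < \<eta>"
  shows "wpa1 (pspace S) (\<lambda>t w. \<forall>(b, g)\<in>B \<times> G. \<bar>q2_bar S j t w b g - M b g\<bar> \<le> \<eta>)"
proof -
  have "small_op1 (pspace S) (\<lambda>t w. SUP (b, g)\<in>B \<times> G. ennreal \<bar>q2_bar S j t w b g - M b g\<bar>)"
    using strong unfolding mixed_strong_def by (elim conjE)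
  from small_op1_SUP[OF this assms] show ?thesis
    using assms by (simp add: case_prod_beta)
qed

lemma wpa1_twice_differentiable:
  "wpa1 (pspace S) (\<lambda>t w. \<forall>(b, g)\<in>tube S j \<beta>0 \<delta>. twice_differentiable_at (\<lambda>b. q2_bar S j t w b g) b)"
  using strong unfolding mixed_strong_def by (elim conjE)

lemma wpa1_hessian_near_M:
  assumes "0 < \<rho>"
  shows "wpa1 (pspace S) (\<lambda>t w. \<forall>(b, g)\<in>tube S j \<beta>0 \<delta>.
    norm (hessian (\<lambda>b. q2_bar S j t w b g) b - hessian (\<lambda>b. M b g) b) \<le> \<rho>)"
proof -
  have "small_op1 (pspace S) (\<lambda>t w. SUP (b, g)\<in>tube S j \<beta>0 \<delta>.
      ennreal (norm (hessian (\<lambda>b. q2_bar S j t w b g) b - hessian (\<lambda>b. M b g) b)))"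
    using strong unfolding mixed_strong_def by (elim conjE)
  from small_op1_SUP[OF this assms] show ?thesis
    using assms by (simp add: case_prod_beta)
qed

lemma wpa1_maximizer:
  "wpa1 (pspace S) (\<lambda>t w. \<forall>g\<in>G. norm (\<beta>hat t w g - \<beta>0 g) \<le> \<delta> \<and>
    (\<forall>b. norm (b - \<beta>0 g) \<le> \<delta> \<longrightarrow> q2_split S j t w b g \<le> q2_split S j t w (\<beta>hat t w g) g))"
  using maximizer unfolding conditional_maximizer_def by (elim conjE)

lemma wpa1_consistent:
  assumes "0 < r"
  shows "wpa1 (pspace S) (\<lambda>t w. \<forall>\<omega>\<in>\<Omega>. norm (\<beta>hat t w (gamma_of \<omega>) - \<beta>0 (gamma_of \<omega>)) \<le> r)"
proof (rule wpa1_le_of_big_Op1[OF _ filterlim_sqrt_real_at_top[OF sample_size_at_top] assms])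
  show "big_Op1 (pspace S) (\<lambda>t w. SUP \<omega>\<in>\<Omega>.
      ennreal (sqrt (real (n t)) * norm (\<beta>hat t w (gamma_of \<omega>) - \<beta>0 (gamma_of \<omega>))))"
    using maximizer unfolding conditional_maximizer_def by (elim conjE)
qed

text \<open>Gathers all that the probabilistic conditions contribute to the conclusions.
  \<open>lam\<close> ranges over an interval starting at 0, so that the unpooled law is an instance
  even if the tuning set omits 0. Continuity for all groups serves the full posterior weight, the
  bound by \<delta> the integrability of the maximizer under it.\<close>

definition good_event :: "real \<Rightarrow> real \<Rightarrow> nat \<Rightarrow> 'w \<Rightarrow> bool" where
  "good_event L r t w \<longleftrightarrow> 1 \<le> n t \<and>
     (\<forall>l\<in>{..<ngroups S}. continuous_on (alpha_space S l) (q2_data S l t w)) \<and>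
     (\<forall>g\<in>G. norm (\<beta>hat t w g - \<beta>0 g) \<le> \<delta>) \<and>
     (\<forall>lam\<in>{0..L}. \<forall>\<omega>\<in>\<Omega>.
       d_BL (PS S j p \<beta>hat t w lam \<omega>) (mvnormal 0 (matrix_inv (H (gamma_of \<omega>)))) \<le> ennreal r \<and>
       norm (\<integral>h. h \<partial>PS S j p \<beta>hat t w lam \<omega>) \<le> r \<and>
       integrable lborel (kernel t w lam \<omega>) \<and> 0 < integral\<^sup>L lborel (kernel t w lam \<omega>))"

text \<open>All constants are fixed before the outcome \<open>w\<close>, and \<open>lam\<close> and
  \<omega> are introduced only after it; hence a single event serves them all.\<close>

lemma wpa1_good_event:
  assumes r: "0 < r"
  shows "wpa1 (pspace S) (good_event L r)"
proof -
  obtain c where c: "0 < c" "\<And>g v. g \<in> G \<Longrightarrow> c * (norm v)\<^sup>2 \<le> v \<bullet> (H g *v v)" by (rule H_pos) blast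
  obtain K where K: "0 < K" "\<And>g. g \<in> G \<Longrightarrow> norm (H g) \<le> K" by (rule H_bounded) blast
  obtain Q where Q: "0 < Q" "\<And>b \<omega>. b \<in> B \<Longrightarrow> \<omega> \<in> \<Omega> \<Longrightarrow> \<bar>q1_split S j b \<omega>\<bar> \<le> Q" by (rule q1_bounded) blast
  obtain R where R: "0 < R" "\<And>b. b \<in> B \<Longrightarrow> norm b \<le> R" by (rule B_bounded) blast
  obtain pmin where pmin: "0 < pmin" "\<And>g b. g \<in> G \<Longrightarrow> b \<in> cball (\<beta>0 g) \<delta> \<Longrightarrow> pmin \<le> p b g" by (rule p_lower) blast
  define z where "z = (\<integral>h. exp (- (K / 2) * (norm h)\<^sup>2) \<partial>(lborel :: (real ^ 'b) measure))"
  have z: "0 < z" unfolding z_def using K(1) by (intro gaussian_mass_pos) auto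
  \<comment> \<open>The first entry keeps the normalizers away from 0, the second makes
    \<open>2 * D / z\<close> at most \<open>r\<close>.\<close>
  define D where "D = min (z / 2) (r * z / 2)"
  have D: "0 < D" "D \<le> z / 2" "2 * D / z \<le> r"
    using z r by (auto simp: D_def min_def field_simps)
  define I where "I = (\<integral>h. (1 + norm h) * ((1 + (norm h)\<^sup>2) * exp (- (c / 4) * (norm h)\<^sup>2)) \<partial>(lborel :: (real ^ 'b) measure))"
  have I: "0 \<le> I" unfolding I_def by (intro integral_nonneg_AE) auto
  \<comment> \<open>\<open>D\<close> is shared equally between \<open>\<rho> * I\<close> and the
    remainder; the 1 added to \<open>I\<close> avoids division by zero. The entry
    \<open>c / 2\<close> is the share of the curvature that the expansion error may consume.\<close>
  define \<rho> where "\<rho> = min (c / 2) (D / (2 * (I + 1)))"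
  have "0 < \<rho>" using c(1) D(1) I by (simp add: \<rho>_def)
  moreover have "\<rho> \<le> c / 2" "\<rho> \<le> D / (2 * (I + 1))"
    unfolding \<rho>_def by (rule min.cobounded1 min.cobounded2)+
  ultimately have \<rho>: "0 < \<rho>" "\<rho> \<le> c / 2" "\<rho> \<le> D / (2 * (I + 1))" by auto
  have "\<rho> * I \<le> D / (2 * (I + 1)) * (I + 1)"
    using I D(1) \<rho>(3) by (intro mult_mono) auto
  also have "D / (2 * (I + 1)) * (I + 1) = D / 2" using I by (simp add: field_simps)
  finally have \<rho>I: "\<rho> * I \<le> D / 2" .
  obtain e1 where e1: "0 < e1" "\<And>g b. g \<in> G \<Longrightarrow> norm (b - \<beta>0 g) \<le> min e1 \<delta> \<Longrightarrow>
      norm (hessian (\<lambda>b. M b g) b - hessian (\<lambda>b. M b g) (\<beta>0 g)) \<le> \<rho> / 2"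
    using hessian_M_near[of "\<rho> / 2"] \<rho>(1) by auto
  obtain e2 where e2: "0 < e2" "\<And>\<omega> lam b b'. \<omega> \<in> \<Omega> \<Longrightarrow> lam \<in> {0..L} \<Longrightarrow>
      norm (b - \<beta>0 (gamma_of \<omega>)) \<le> min e2 \<delta> \<Longrightarrow> norm (b' - \<beta>0 (gamma_of \<omega>)) \<le> min e2 \<delta> \<Longrightarrow>
      \<bar>exp (lam * q1_split S j b \<omega> - lam * q1_split S j b' \<omega>) * p b (gamma_of \<omega>) / p b' (gamma_of \<omega>) - 1\<bar> \<le> \<rho>"
    using pooling_and_prior_near[OF \<rho>(1)] by blast
  define \<epsilon> where "\<epsilon> = min \<delta> (min e1 e2)"
  have \<epsilon>: "0 < \<epsilon>" "\<epsilon> \<le> \<delta>" "\<epsilon> \<le> min e1 \<delta>" "\<epsilon> \<le> min e2 \<delta>" using \<delta>_pos e1(1) e2(1) by (auto simp: \<epsilon>_def)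
  obtain \<eta>' where \<eta>': "0 < \<eta>'" "\<And>g b. g \<in> G \<Longrightarrow> b \<in> B \<Longrightarrow> \<epsilon> \<le> dist b (\<beta>0 g) \<Longrightarrow> M b g \<le> M (\<beta>0 g) g - \<eta>'"
    using separated_maximum[OF compact_B compact_G M_cont \<beta>0_in_B \<beta>0_max \<epsilon>(1)] by metis
  \<comment> \<open>A quarter, because the criterion is known only up to \<eta> and
    \<open>kernel_close\<close> asks for a gap of \<open>4 * \<eta>\<close>.\<close>
  define \<eta> where "\<eta> = \<eta>' / 4"
  have \<eta>: "0 < \<eta>" using \<eta>'(1) by (simp add: \<eta>_def)
  \<comment> \<open>The part of the Laplace bound that vanishes as \<open>s\<close> grows; only
    \<open>\<rho> * I\<close> stays.\<close>
  define rem where "rem = (\<lambda>s. exp (- (c / 16 * \<epsilon>\<^sup>2) * s\<^sup>2) * I +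
      (exp (2 * L * Q) * (1 / pmin)) * exp (- 2 * \<eta> * s\<^sup>2) * (1 + s * (2 * R)) * s ^ CARD('b))"
  have "\<forall>\<^sub>F s in at_top. rem s \<le> D / 2"
    unfolding rem_def by (rule laplace_remainder_small) (use c(1) \<epsilon>(1) \<eta> D(1) in auto)
  then have ev_rem: "\<forall>\<^sub>F t in sequentially. rem (sqrt (real (n t))) \<le> D / 2"
    by (rule eventually_compose_filterlim[OF _ filterlim_sqrt_real_at_top[OF sample_size_at_top]])
  have ev_n: "\<forall>\<^sub>F t in sequentially. 1 \<le> n t"
    using sample_size_at_top unfolding filterlim_at_top by blast
  have wp: "wpa1 (pspace S) (\<lambda>t w.
      (\<forall>l\<in>{..<ngroups S}. continuous_on (alpha_space S l) (q2_data S l t w)) \<and>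
      (\<forall>(b, g)\<in>B \<times> G. \<bar>q2_bar S j t w b g - M b g\<bar> \<le> \<eta>) \<and>
      (\<forall>(b, g)\<in>tube S j \<beta>0 \<delta>. twice_differentiable_at (\<lambda>b. q2_bar S j t w b g) b) \<and>
      (\<forall>(b, g)\<in>tube S j \<beta>0 \<delta>.
        norm (hessian (\<lambda>b. q2_bar S j t w b g) b - hessian (\<lambda>b. M b g) b) \<le> \<rho> / 2) \<and>
      (\<forall>g\<in>G. norm (\<beta>hat t w g - \<beta>0 g) \<le> \<delta> \<and>
        (\<forall>b. norm (b - \<beta>0 g) \<le> \<delta> \<longrightarrow> q2_split S j t w b g \<le> q2_split S j t w (\<beta>hat t w g) g)) \<and>
      (\<forall>\<omega>\<in>\<Omega>. norm (\<beta>hat t w (gamma_of \<omega>) - \<beta>0 (gamma_of \<omega>)) \<le> \<epsilon> / 2))"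
    by (intro wpa1_conj[OF prob_space_pspace] wpa1_q2_continuous wpa1_q2_near_M[OF \<eta>] wpa1_twice_differentiable
        wpa1_hessian_near_M wpa1_maximizer wpa1_consistent) (use \<rho>(1) \<epsilon>(1) in auto)
  show ?thesis
  proof (rule wpa1_mono[OF wp])
    show "\<forall>\<^sub>F t in sequentially. \<forall>w\<in>space (pspace S t).
      (\<forall>l\<in>{..<ngroups S}. continuous_on (alpha_space S l) (q2_data S l t w)) \<and>
      (\<forall>(b, g)\<in>B \<times> G. \<bar>q2_bar S j t w b g - M b g\<bar> \<le> \<eta>) \<and>
      (\<forall>(b, g)\<in>tube S j \<beta>0 \<delta>. twice_differentiable_at (\<lambda>b. q2_bar S j t w b g) b) \<and>
      (\<forall>(b, g)\<in>tube S j \<beta>0 \<delta>.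
        norm (hessian (\<lambda>b. q2_bar S j t w b g) b - hessian (\<lambda>b. M b g) b) \<le> \<rho> / 2) \<and>
      (\<forall>g\<in>G. norm (\<beta>hat t w g - \<beta>0 g) \<le> \<delta> \<and>
        (\<forall>b. norm (b - \<beta>0 g) \<le> \<delta> \<longrightarrow> q2_split S j t w b g \<le> q2_split S j t w (\<beta>hat t w g) g)) \<and>
      (\<forall>\<omega>\<in>\<Omega>. norm (\<beta>hat t w (gamma_of \<omega>) - \<beta>0 (gamma_of \<omega>)) \<le> \<epsilon> / 2) \<longrightarrow> good_event L r t w"
      using ev_rem ev_n
    proof (eventually_elim, intro ballI impI, elim conjE)
      fix t w
      assume rem: "rem (sqrt (real (n t))) \<le> D / 2" and n: "1 \<le> n t"
        and cont: "\<forall>l\<in>{..<ngroups S}. continuous_on (alpha_space S l) (q2_data S l t w)"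
        and q2_M: "\<forall>(b, g)\<in>B \<times> G. \<bar>q2_bar S j t w b g - M b g\<bar> \<le> \<eta>"
        and diff: "\<forall>(b, g)\<in>tube S j \<beta>0 \<delta>. twice_differentiable_at (\<lambda>b. q2_bar S j t w b g) b"
        and hess: "\<forall>(b, g)\<in>tube S j \<beta>0 \<delta>.
          norm (hessian (\<lambda>b. q2_bar S j t w b g) b - hessian (\<lambda>b. M b g) b) \<le> \<rho> / 2"
        and max: "\<forall>g\<in>G. norm (\<beta>hat t w g - \<beta>0 g) \<le> \<delta> \<and>
          (\<forall>b. norm (b - \<beta>0 g) \<le> \<delta> \<longrightarrow> q2_split S j t w b g \<le> q2_split S j t w (\<beta>hat t w g) g)"
        and cons: "\<forall>\<omega>\<in>\<Omega>. norm (\<beta>hat t w (gamma_of \<omega>) - \<beta>0 (gamma_of \<omega>)) \<le> \<epsilon> / 2"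
      have contj: "continuous_on (alpha_space S j) (q2_data S j t w)" using cont j by simp
      have main: "d_BL (PS S j p \<beta>hat t w lam \<omega>) (mvnormal 0 (matrix_inv (H (gamma_of \<omega>)))) \<le> ennreal r \<and>
          norm (\<integral>h. h \<partial>PS S j p \<beta>hat t w lam \<omega>) \<le> r \<and>
          integrable lborel (kernel t w lam \<omega>) \<and> 0 < integral\<^sup>L lborel (kernel t w lam \<omega>)"
        if lam: "lam \<in> {0..L}" and \<omega>: "\<omega> \<in> \<Omega>" for lam \<omega>
      proof -
        define g where "g = gamma_of \<omega>"
        define s where "s = sqrt (real (n t))"
        define m where "m = \<beta>hat t w g"
        have gG: "g \<in> G" using gamma_of_\<Omega>[OF \<omega>] by (simp add: g_def)
        have ball: "(b, g) \<in> tube S j \<beta>0 \<delta>" if "b \<in> cball (\<beta>0 g) \<delta>" for b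
          using that gG tube_iff by blast
        have cons': "norm (m - \<beta>0 g) \<le> \<epsilon> / 2" using cons \<omega> by (simp add: g_def m_def)
        have "(\<integral>\<^sup>+h. ennreal ((1 + norm h) * \<bar>kernel t w lam \<omega> (m + (1 / s) *\<^sub>R h) /
              (exp (q2_split S j t w m g + lam * q1_split S j m \<omega>) * p m g) - exp (- (1/2) * (h \<bullet> (H g *v h)))\<bar>) \<partial>lborel) \<le>
          ennreal ((\<rho> + exp (- (c / 16) * (s * \<epsilon>)\<^sup>2)) *
              (\<integral>h. (1 + norm h) * ((1 + (norm h)\<^sup>2) * exp (- (c / 4) * (norm h)\<^sup>2)) \<partial>(lborel :: (real ^ 'b) measure)) +
            exp (2 * L * Q) * (1 / pmin) * exp (- 2 * \<eta> * s\<^sup>2) * (1 + s * (2 * R)) * s ^ CARD('b))"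
        proof (rule kernel_close[OF \<omega> lam n g_def m_def s_def \<epsilon>(1,2) \<rho>(1,2) c(1)])
          show "c * (norm v)\<^sup>2 \<le> v \<bullet> (H g *v v)" for v by (rule c(2)[OF gG])
          show "norm (hessian (\<lambda>b. M b g) b - hessian (\<lambda>b. M b g) (\<beta>0 g)) \<le> \<rho> / 2" if "norm (b - \<beta>0 g) \<le> \<epsilon>" for b
            using e1(2)[OF gG] that \<epsilon>(3) by simp
          show "\<bar>exp (lam * q1_split S j b \<omega> - lam * q1_split S j b' \<omega>) * p b g / p b' g - 1\<bar> \<le> \<rho>"
            if "norm (b - \<beta>0 g) \<le> \<epsilon>" "norm (b' - \<beta>0 g) \<le> \<epsilon>" for b b'
            using e2(2)[OF \<omega> lam, of b b'] that \<epsilon>(4) by (simp add: g_def)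
          show "M b g \<le> M (\<beta>0 g) g - 4 * \<eta>" if "b \<in> B" "\<epsilon> \<le> dist b (\<beta>0 g)" for b
            using \<eta>'(2)[OF gG that] by (simp add: \<eta>_def)
          show "\<bar>q1_split S j b \<omega>\<bar> \<le> Q" if "b \<in> B" for b by (rule Q(2)[OF that \<omega>])
          show "norm b \<le> R" if "b \<in> B" for b by (rule R(2)[OF that])
          show "0 < pmin" by (rule pmin(1))
          show "pmin \<le> p b g" if "b \<in> cball (\<beta>0 g) \<delta>" for b by (rule pmin(2)[OF gG that])
          show "continuous_on (alpha_space S j) (q2_data S j t w)" by (rule contj)
          show "\<bar>q2_bar S j t w b g - M b g\<bar> \<le> \<eta>" if "b \<in> B" for b
            using bspec[OF q2_M, of "(b, g)"] that gG by simp
          show "twice_differentiable_at (\<lambda>b. q2_bar S j t w b g) b" if "b \<in> cball (\<beta>0 g) \<delta>" for b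
            using bspec[OF diff ball[OF that]] by simp
          show "norm (hessian (\<lambda>b. q2_bar S j t w b g) b - hessian (\<lambda>b. M b g) b) \<le> \<rho> / 2"
            if "b \<in> cball (\<beta>0 g) \<delta>" for b
            using bspec[OF hess ball[OF that]] by simp
          show "q2_split S j t w b g \<le> q2_split S j t w m g" if "norm (b - \<beta>0 g) \<le> \<delta>" for b
            using max gG that by (simp add: m_def)
          show "norm (m - \<beta>0 g) \<le> \<epsilon> / 2" by (rule cons')
        qed
        also have "(\<rho> + exp (- (c / 16) * (s * \<epsilon>)\<^sup>2)) *
              (\<integral>h. (1 + norm h) * ((1 + (norm h)\<^sup>2) * exp (- (c / 4) * (norm h)\<^sup>2)) \<partial>(lborel :: (real ^ 'b) measure)) +
            exp (2 * L * Q) * (1 / pmin) * exp (- 2 * \<eta> * s\<^sup>2) * (1 + s * (2 * R)) * s ^ CARD('b) = \<rho> * I + rem s"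
          unfolding I_def[symmetric] rem_def by (simp add: algebra_simps power_mult_distrib)
        also have "ennreal (\<rho> * I + rem s) \<le> ennreal D"
          using \<rho>I rem by (intro ennreal_leI) (simp add: s_def)
        finally have bound: "(\<integral>\<^sup>+h. ennreal ((1 + norm h) * \<bar>kernel t w lam \<omega> (m + (1 / s) *\<^sub>R h) /
              (exp (q2_split S j t w m g + lam * q1_split S j m \<omega>) * p m g) - exp (- (1/2) * (h \<bullet> (H g *v h)))\<bar>) \<partial>lborel) \<le>
            ennreal D" .
        have "m \<in> cball (\<beta>0 g) \<delta>" using cons' \<epsilon> by (simp add: dist_norm norm_minus_commute)
        then have pm: "0 < p m g" by (rule p_tube(2)[OF gG])
        note close = PS_close[OF \<omega> n contj g_def m_def s_def pm c(1) c(2)[OF gG] K(1) K(2)[OF gG] z_def bound less_imp_le[OF D(1)] D(2)]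
        have "ennreal (2 * D / z) \<le> ennreal r" using D(3) by (rule ennreal_leI)
        with close(1) have "d_BL (PS S j p \<beta>hat t w lam \<omega>) (mvnormal 0 (matrix_inv (H g))) \<le> ennreal r"
          by (rule order_trans)
        then show ?thesis using close(2-4) D(3) by (auto simp: g_def)
      qed
      show "good_event L r t w"
        unfolding good_event_def using n cont max main by blast
    qed
  qed
qed

end

section \<open>The full quasi-posterior\<close>

text \<open>A bound of a vector integral by a multiple of the mass \<open>u\<close> survives
  integration in the outer variable. It is applied three times, integrating out in turn the weak
  block, the other groups and \<theta>.\<close>

lemma (in pair_sigma_finite) norm_integral_le_of_sections:
  fixes f :: "'a \<times> 'b \<Rightarrow> 'c::{banach, second_countable_topology}" and u :: "'a \<times> 'b \<Rightarrow> real"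
  assumes f: "integrable (M1 \<Otimes>\<^sub>M M2) f" and u: "integrable (M1 \<Otimes>\<^sub>M M2) u"
    and le: "\<And>y. y \<in> space M2 \<Longrightarrow> norm (\<integral>x. f (x, y) \<partial>M1) \<le> k * (\<integral>x. u (x, y) \<partial>M1)"
  shows "norm (integral\<^sup>L (M1 \<Otimes>\<^sub>M M2) f) \<le> k * integral\<^sup>L (M1 \<Otimes>\<^sub>M M2) u"
proof -
  have f': "integrable (M1 \<Otimes>\<^sub>M M2) (case_prod (\<lambda>x y. f (x, y)))" using f by simp
  have u': "integrable (M1 \<Otimes>\<^sub>M M2) (case_prod (\<lambda>x y. u (x, y)))" using u by simp
  have "norm (integral\<^sup>L (M1 \<Otimes>\<^sub>M M2) f) = norm (\<integral>y. (\<integral>x. f (x, y) \<partial>M1) \<partial>M2)"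
    using integral_snd[OF f'] by simp
  also have "\<dots> \<le> (\<integral>y. norm (\<integral>x. f (x, y) \<partial>M1) \<partial>M2)" by (rule integral_norm_bound)
  also have "\<dots> \<le> (\<integral>y. k * (\<integral>x. u (x, y) \<partial>M1) \<partial>M2)"
    using integrable_snd[OF f'] integrable_snd[OF u'] le by (intro integral_mono) auto
  also have "\<dots> = k * integral\<^sup>L (M1 \<Otimes>\<^sub>M M2) u"
    using integral_snd[OF u'] by simp
  finally show ?thesis .
qed

text \<open>Continuity of the criteria refers to the Borel sets of the function space, the priors to
  the product sigma-algebra. The two are linked coordinatewise; outside \<open>I\<close> every
  coordinate is the constant \<open>undefined\<close>.\<close>

lemma measurable_PiM_imp_borel:
  fixes I :: "'i::countable set" and M :: "'i \<Rightarrow> 'a::second_countable_topology measure"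
  assumes "\<And>i. i \<in> I \<Longrightarrow> sets (M i) = sets borel"
  shows "(\<lambda>x. x) \<in> (\<Pi>\<^sub>M i\<in>I. M i) \<rightarrow>\<^sub>M borel"
proof (rule measurable_coordinatewise_then_product)
  fix i
  show "(\<lambda>x. x i) \<in> borel_measurable (Pi\<^sub>M I M)"
  proof (cases "i \<in> I")
    case True
    then have "(\<lambda>x. x i) \<in> Pi\<^sub>M I M \<rightarrow>\<^sub>M M i" by (rule measurable_component_singleton)
    then show ?thesis using measurable_cong_sets[OF refl assms[OF True]] by blast
  next
    case False
    have u: "x i = undefined" if "x \<in> space (Pi\<^sub>M I M)" for x
      using that by (intro PiE_arb[OF _ False]) (simp add: space_PiM)
    have "(\<lambda>x. x i) \<in> borel_measurable (Pi\<^sub>M I M) \<longleftrightarrow> (\<lambda>x. undefined :: 'a) \<in> borel_measurable (Pi\<^sub>M I M)"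
      by (rule measurable_cong, rule u)
    then show ?thesis by (simp only:) (rule measurable_const, simp)
  qed
qed

lemma regular_priorD:
  assumes "regular_prior A \<pi>" and A: "A \<in> sets borel"
  shows "prob_space \<pi>" "sets \<pi> = sets borel" "AE a in \<pi>. a \<in> A"
proof -
  obtain D f where D: "sets D = sets borel" "continuous_on A f" "\<pi> = density D (\<lambda>a. ennreal (f a) * indicator A a)"
    and \<pi>: "prob_space \<pi>" "sets \<pi> = sets borel"
    using assms(1) unfolding regular_prior_def by auto
  show "prob_space \<pi>" "sets \<pi> = sets borel" by fact+
  have "emeasure \<pi> (space \<pi> - A) = 0"
  proof -
    \<comment> \<open>\<open>f\<close> is continuous only on \<open>A\<close>, so measurability is
      available for its product with the indicator.\<close>
    have "(\<lambda>a. indicator A a *\<^sub>R f a) \<in> borel_measurable borel"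
      by (rule borel_measurable_continuous_on_indicator[OF A D(2)])
    then have m: "(\<lambda>a. ennreal (indicator A a *\<^sub>R f a)) \<in> borel_measurable D"
      using measurable_compose[OF _ measurable_ennreal] measurable_cong_sets[OF D(1) refl] by blast
    have e: "ennreal (indicator A a *\<^sub>R f a) = ennreal (f a) * indicator A a" for a
      by (simp add: indicator_def)
    have "space D - A \<in> sets D" using A D(1) by (metis sets.Diff sets.top)
    then have "emeasure \<pi> (space D - A) = (\<integral>\<^sup>+a. ennreal (f a) * indicator A a * indicator (space D - A) a \<partial>D)"
      unfolding D(3) using m unfolding e by (subst emeasure_density) simp_all
    also have "\<dots> = (\<integral>\<^sup>+a. 0 \<partial>D)"
      by (intro nn_integral_cong) (simp add: indicator_def)
    finally show ?thesis by (simp add: D(3))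
  qed
  moreover have "space \<pi> - A \<in> sets \<pi>" using A \<pi>(2) by (metis sets.Diff sets.top)
  ultimately show "AE a in \<pi>. a \<in> A"
    by (intro AE_I[of _ _ "space \<pi> - A"]) auto
qed

section \<open>Priors, parameter set and posterior weight\<close>

context split_group begin

lemma closed_imp_borel_alpha: "l < ngroups S \<Longrightarrow> alpha_space S l \<in> sets borel"
  by (rule borel_closed[OF compact_imp_closed[OF compact_alpha_space]])

lemma borel_theta: "theta_space S \<in> sets borel"
  by (rule borel_closed[OF compact_imp_closed[OF compact_theta_space]])

lemmas prior_prob = regular_priorD(1)[OF regular_priors(1) closed_imp_borel_alpha]
lemmas prior_sets = regular_priorD(2)[OF regular_priors(1) closed_imp_borel_alpha]
lemmas prior_AE = regular_priorD(3)[OF regular_priors(1) closed_imp_borel_alpha]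
lemmas theta_prob = regular_priorD(1)[OF regular_priors(2) borel_theta]
lemmas theta_sets = regular_priorD(2)[OF regular_priors(2) borel_theta]
lemmas theta_AE = regular_priorD(3)[OF regular_priors(2) borel_theta]

abbreviation "\<Pi>\<alpha> \<equiv> \<Pi>\<^sub>M l\<in>{..<ngroups S}. prior S l"
abbreviation "\<Pi>rest \<equiv> \<Pi>\<^sub>M l\<in>{..<ngroups S} - {j}. prior S l"
abbreviation "\<Pi>0 \<equiv> \<Pi>\<alpha> \<Otimes>\<^sub>M prior_theta S"
abbreviation "K \<equiv> alphas S \<times> theta_space S"

lemma prob_space_\<Pi>\<alpha>: "prob_space \<Pi>\<alpha>"
  by (rule prob_space_PiM) (simp add: prior_prob)

lemma prob_space_\<Pi>rest: "prob_space \<Pi>rest"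
  by (rule prob_space_PiM) (simp add: prior_prob)

lemma prob_space_\<Pi>0: "prob_space \<Pi>0"
proof -
  interpret a: prob_space \<Pi>\<alpha> by (rule prob_space_\<Pi>\<alpha>)
  interpret t: prob_space "prior_theta S" by (rule theta_prob)
  interpret at: pair_prob_space \<Pi>\<alpha> "prior_theta S" ..
  show ?thesis by (rule at.prob_space_axioms)
qed

lemma compact_K: "compact K"
  unfolding alphas_def by (intro compact_Times compact_PiE compact_alpha_space compact_theta_space) simp

lemma borel_K: "K \<in> sets borel"
  by (rule borel_closed[OF compact_imp_closed[OF compact_K]])

lemma measurable_\<Pi>0_borel: "(\<lambda>x. x) \<in> \<Pi>0 \<rightarrow>\<^sub>M borel"
proof -
  have 1: "(\<lambda>x. x) \<in> \<Pi>\<alpha> \<rightarrow>\<^sub>M borel"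
    by (rule measurable_PiM_imp_borel) (simp add: prior_sets)
  have 2: "(\<lambda>x. x) \<in> prior_theta S \<rightarrow>\<^sub>M borel"
    using theta_sets by (simp add: measurable_ident_sets)
  have "(\<lambda>x. (fst x, snd x)) \<in> \<Pi>0 \<rightarrow>\<^sub>M borel \<Otimes>\<^sub>M borel"
    by (intro measurable_Pair measurable_compose[OF measurable_fst 1] measurable_compose[OF measurable_snd 2])
  then show ?thesis by (simp add: borel_prod)
qed

lemma AE_\<Pi>0_K: "AE x in \<Pi>0. x \<in> K"
proof -
  interpret a: prob_space \<Pi>\<alpha> by (rule prob_space_\<Pi>\<alpha>)
  interpret t: prob_space "prior_theta S" by (rule theta_prob)
  interpret pair_prob_space \<Pi>\<alpha> "prior_theta S" ..
  have "AE \<alpha> in \<Pi>\<alpha>. \<alpha> l \<in> alpha_space S l" if "l \<in> {..<ngroups S}" for l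
    using that by (intro AE_PiM_component[OF prior_prob] prior_AE) auto
  then have "AE \<alpha> in \<Pi>\<alpha>. \<forall>l\<in>{..<ngroups S}. \<alpha> l \<in> alpha_space S l"
    by (intro AE_finite_allI) auto
  then have \<alpha>: "AE \<alpha> in \<Pi>\<alpha>. \<alpha> \<in> alphas S"
    using AE_space by eventually_elim (auto simp: alphas_def space_PiM PiE_iff)
  show ?thesis
  proof (rule AE_pair_measure)
    have "{x \<in> space \<Pi>0. x \<in> K} = (\<lambda>x. x) -` K \<inter> space \<Pi>0" by blast
    then show "{x \<in> space \<Pi>0. x \<in> K} \<in> sets \<Pi>0"
      using measurable_sets[OF measurable_\<Pi>0_borel borel_K] by simp
    show "AE \<alpha> in \<Pi>\<alpha>. AE \<theta> in prior_theta S. (\<alpha>, \<theta>) \<in> K"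
      using \<alpha> by eventually_elim (use theta_AE in auto)
  qed
qed

definition post_weight :: "nat \<Rightarrow> 'w \<Rightarrow> real \<Rightarrow> (nat \<Rightarrow> rvec \<times> rvec) \<times> rvec \<Rightarrow> real" where
  "post_weight t w lam = (\<lambda>(\<alpha>, \<theta>). if \<alpha> \<in> alphas S \<and> \<theta> \<in> theta_space S
     then exp ((\<Sum>l<ngroups S. q2_data S l t w (\<alpha> l)) + lam * q1 S \<alpha> \<theta>) else 0)"

lemma full_posterior_eq: "full_posterior S t w lam = normalized \<Pi>0 (post_weight t w lam)"
  unfolding full_posterior_def post_weight_def ..

lemma post_weight_nonneg: "0 \<le> post_weight t w lam x"
  by (simp add: post_weight_def case_prod_beta)

lemma post_weight_outside: "x \<notin> K \<Longrightarrow> post_weight t w lam x = 0"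
  by (auto simp: post_weight_def case_prod_beta mem_Times_iff)

lemma post_exponent_cont:
  assumes "\<forall>l\<in>{..<ngroups S}. continuous_on (alpha_space S l) (q2_data S l t w)"
  shows "continuous_on K (\<lambda>x. exp ((\<Sum>l<ngroups S. q2_data S l t w (fst x l)) + lam * q1 S (fst x) (snd x)))"
proof -
  have "continuous_on K (\<lambda>x. q2_data S l t w (fst x l))" if l: "l \<in> {..<ngroups S}" for l
  proof (rule continuous_on_compose2[OF bspec[OF assms l]])
    show "continuous_on K (\<lambda>x. fst x l)"
      by (rule continuous_on_product_then_coordinatewise[OF continuous_on_fst[OF continuous_on_id]])
    show "(\<lambda>x. fst x l) ` K \<subseteq> alpha_space S l"
    proof (rule image_subsetI)
      fix x assume "x \<in> K"
      then have "fst x \<in> (\<Pi>\<^sub>E l\<in>{..<ngroups S}. alpha_space S l)" by (simp add: alphas_def mem_Times_iff)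
      then show "fst x l \<in> alpha_space S l" using l by (rule PiE_mem)
    qed
  qed
  then show ?thesis
    using q1_cont[unfolded case_prod_beta]
    by (intro continuous_on_exp continuous_on_add continuous_on_sum continuous_on_mult continuous_on_const)
qed

lemma post_weight_measurable:
  assumes "\<forall>l\<in>{..<ngroups S}. continuous_on (alpha_space S l) (q2_data S l t w)"
  shows "post_weight t w lam \<in> borel_measurable borel"
proof -
  have "(\<lambda>x. indicator K x *\<^sub>R exp ((\<Sum>l<ngroups S. q2_data S l t w (fst x l)) + lam * q1 S (fst x) (snd x)))
      \<in> borel_measurable borel"
    by (rule borel_measurable_continuous_on_indicator[OF borel_K post_exponent_cont[OF assms]])
  moreover have "post_weight t w lam =
      (\<lambda>x. indicator K x *\<^sub>R exp ((\<Sum>l<ngroups S. q2_data S l t w (fst x l)) + lam * q1 S (fst x) (snd x)))"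
    by (rule ext) (simp add: post_weight_def case_prod_beta indicator_def mem_Times_iff)
  ultimately show ?thesis by simp
qed

lemma post_weight_bounded:
  assumes "\<forall>l\<in>{..<ngroups S}. continuous_on (alpha_space S l) (q2_data S l t w)"
  obtains C where "0 < C" "\<And>x. post_weight t w lam x \<le> C"
proof -
  have "bounded ((\<lambda>x. exp ((\<Sum>l<ngroups S. q2_data S l t w (fst x l)) + lam * q1 S (fst x) (snd x))) ` K)"
    by (rule compact_imp_bounded[OF compact_continuous_image[OF post_exponent_cont[OF assms] compact_K]])
  then obtain C where C: "0 < C"
    "\<forall>y\<in>(\<lambda>x. exp ((\<Sum>l<ngroups S. q2_data S l t w (fst x l)) + lam * q1 S (fst x) (snd x))) ` K. norm y \<le> C"
    unfolding bounded_pos by blast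
  have "post_weight t w lam x \<le> C" for x
  proof (cases "x \<in> K")
    case True
    with C(2) have "norm (exp ((\<Sum>l<ngroups S. q2_data S l t w (fst x l)) + lam * q1 S (fst x) (snd x))) \<le> C"
      by (rule bspec[OF _ imageI])
    with True show ?thesis by (simp add: post_weight_def case_prod_beta mem_Times_iff)
  qed (use C(1) post_weight_outside in simp)
  with C(1) show ?thesis by (rule that)
qed

text \<open>The normalizer is positive because the weight is an exponential on \<open>K\<close>, and
  \<open>K\<close> has prior probability one.\<close>

lemma post_weight_integrable:
  assumes "\<forall>l\<in>{..<ngroups S}. continuous_on (alpha_space S l) (q2_data S l t w)"
  shows "integrable \<Pi>0 (post_weight t w lam)" and "0 < integral\<^sup>L \<Pi>0 (post_weight t w lam)"
proof -
  interpret P: prob_space \<Pi>0 by (rule prob_space_\<Pi>0)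
  obtain C where C: "0 < C" "\<And>x. post_weight t w lam x \<le> C"
    by (rule post_weight_bounded[OF assms, of lam]) blast
  have m: "post_weight t w lam \<in> borel_measurable \<Pi>0"
    using measurable_compose[OF measurable_\<Pi>0_borel post_weight_measurable[OF assms]] .
  show int: "integrable \<Pi>0 (post_weight t w lam)"
    using C(2) post_weight_nonneg by (intro P.integrable_const_bound[of _ C] m) simp
  have "\<not> (AE x in \<Pi>0. post_weight t w lam x = 0)"
  proof
    assume "AE x in \<Pi>0. post_weight t w lam x = 0"
    with AE_\<Pi>0_K have "AE x in \<Pi>0. False"
      by eventually_elim (auto simp: post_weight_def case_prod_beta)
    then show False by simp
  qed
  moreover have "0 \<le> integral\<^sup>L \<Pi>0 (post_weight t w lam)" using post_weight_nonneg by simp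
  ultimately show "0 < integral\<^sup>L \<Pi>0 (post_weight t w lam)"
    using integral_nonneg_eq_0_iff_AE[OF int] post_weight_nonneg by (simp add: less_le)
qed

text \<open>The link between the posterior and the formula for the conditional law. The sample
  criteria separate over the groups, so those of the other groups form a factor constant in
  \<open>b\<close>; the pooling term is not split and stays in the kernel.\<close>

lemma post_weight_split:
  assumes \<omega>: "(a, g, \<theta>) \<in> \<Omega>"
  shows "p b g * indicator (B \<times> G) (b, g) * post_weight t w lam (a(j := (to_rvec b, g)), \<theta>) =
    exp (\<Sum>l\<in>{..<ngroups S} - {j}. q2_data S l t w (a l)) * kernel t w lam (a, g, \<theta>) b"
proof (cases "b \<in> B")
  case True
  have g: "g \<in> G" using gamma_of_\<Omega>[OF \<omega>] by (simp add: gamma_of_def)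
  have "(\<Sum>l<ngroups S. q2_data S l t w ((a(j := (to_rvec b, g))) l)) =
      q2_split S j t w b g + (\<Sum>l\<in>{..<ngroups S} - {j}. q2_data S l t w (a l))"
    using j by (subst sum.remove[of _ j]) (auto simp: q2_split_def intro!: sum.cong)
  then show ?thesis
    using True g retain_in_alphas[OF True \<omega>]
    by (simp add: post_weight_def kernel_def gamma_of_def q1_split_def exp_add mult_ac)
qed (simp add: kernel_def)

text \<open>Off the retained space both sides of the section bound below are 0, so that bound can be
  asserted for every \<open>g\<close> and \<theta>, without exceptional sets.\<close>

lemma post_weight_not_retained:
  assumes "a \<in> space \<Pi>rest" and "(a, g, \<theta>) \<notin> \<Omega>"
  shows "p b g * indicator (B \<times> G) (b, g) * post_weight t w lam (a(j := (to_rvec b, g)), \<theta>) = 0"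
proof (rule ccontr)
  assume "\<not> ?thesis"
  then have "indicator (B \<times> G) (b, g) \<noteq> (0::real)" and "post_weight t w lam (a(j := (to_rvec b, g)), \<theta>) \<noteq> 0"
    by auto
  then have g: "g \<in> G" and "(a(j := (to_rvec b, g)), \<theta>) \<in> K"
    using post_weight_outside[of "(a(j := (to_rvec b, g)), \<theta>)"] by (fastforce simp: indicator_def)+
  then have up: "a(j := (to_rvec b, g)) \<in> alphas S" and \<theta>: "\<theta> \<in> theta_space S" by auto
  have "a l \<in> alpha_space S l" if "l \<in> {..<ngroups S} - {j}" for l
    using PiE_mem[OF up[unfolded alphas_def], of l] that by simp
  moreover have "a \<in> extensional ({..<ngroups S} - {j})"
    using assms(1) by (simp add: space_PiM PiE_def)
  ultimately have "a \<in> (\<Pi>\<^sub>E l\<in>{..<ngroups S} - {j}. alpha_space S l)"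
    by (simp add: PiE_iff)
  with g \<theta> assms(2) show False by (simp add: retained_space_def)
qed

text \<open>The measurability of \<open>\<beta>hat t w\<close> is only assumed on \<open>G\<close>.\<close>

definition \<beta>cut :: "nat \<Rightarrow> 'w \<Rightarrow> rvec \<Rightarrow> real ^ 'b" where
  "\<beta>cut t w g = indicator G g *\<^sub>R \<beta>hat t w g"

lemma \<beta>cut_measurable:
  assumes "w \<in> space (pspace S t)"
  shows "\<beta>cut t w \<in> borel_measurable borel"
proof -
  have "(\<lambda>(w, g). \<beta>hat t w g) \<in> borel_measurable (pspace S t \<Otimes>\<^sub>M restrict_space borel G)"
    using maximizer unfolding conditional_maximizer_def by (elim conjE) blast
  from measurable_compose[OF measurable_Pair1'[OF assms] this]
  have "\<beta>hat t w \<in> borel_measurable (restrict_space borel G)" by simp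
  then show ?thesis
    unfolding \<beta>cut_def[abs_def] using borel_measurable_restrict_space_iff[of G borel "\<beta>hat t w"] borel_G by simp
qed

section \<open>From conditional means to the posterior mean\<close>

text \<open>The mean of \<open>h\<close> is scaled back, which produces the square root of the
  sample size in the denominator, and the normalizer is moved to the right. In this form the bound
  can be integrated.\<close>

lemma kernel_mean_bound:
  assumes good: "good_event L r t w" and lam: "lam \<in> {0..L}" and \<omega>: "\<omega> \<in> \<Omega>"
  shows "norm (\<integral>b. kernel t w lam \<omega> b *\<^sub>R (b - \<beta>hat t w (gamma_of \<omega>)) \<partial>lborel) \<le>
    r / sqrt (real (n t)) * integral\<^sup>L lborel (kernel t w lam \<omega>)"
proof -
  define s where "s = sqrt (real (n t))"
  define m where "m = \<beta>hat t w (gamma_of \<omega>)"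
  have s: "0 < s" using good by (simp add: s_def good_event_def)
  have int: "integrable lborel (kernel t w lam \<omega>)" and Z: "0 < integral\<^sup>L lborel (kernel t w lam \<omega>)"
    and mean: "norm (\<integral>h. h \<partial>PS S j p \<beta>hat t w lam \<omega>) \<le> r"
    using good lam \<omega> unfolding good_event_def by blast+
  have "(\<integral>h. h \<partial>PS S j p \<beta>hat t w lam \<omega>) = (\<integral>b. s *\<^sub>R (b - m) \<partial>normalized lborel (kernel t w lam \<omega>))"
    unfolding PS_def cond_law_eq s_def[symmetric] m_def[symmetric]
    by (rule integral_distr) (simp_all add: normalized_def)
  also have "\<dots> = (1 / integral\<^sup>L lborel (kernel t w lam \<omega>)) *\<^sub>R (\<integral>b. kernel t w lam \<omega> b *\<^sub>R (s *\<^sub>R (b - m)) \<partial>lborel)"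
    by (rule integral_normalized[OF int kernel_nonneg[OF \<omega>] Z]) simp
  also have "(\<integral>b. kernel t w lam \<omega> b *\<^sub>R (s *\<^sub>R (b - m)) \<partial>lborel) = s *\<^sub>R (\<integral>b. kernel t w lam \<omega> b *\<^sub>R (b - m) \<partial>lborel)"
    unfolding integral_scaleR_right[symmetric]
    by (intro Bochner_Integration.integral_cong refl) (simp add: mult.commute)
  finally have "norm (\<integral>h. h \<partial>PS S j p \<beta>hat t w lam \<omega>) =
      s * norm (\<integral>b. kernel t w lam \<omega> b *\<^sub>R (b - m) \<partial>lborel) / integral\<^sup>L lborel (kernel t w lam \<omega>)"
    using s Z by simp
  with mean have "s * norm (\<integral>b. kernel t w lam \<omega> b *\<^sub>R (b - m) \<partial>lborel) \<le> r * integral\<^sup>L lborel (kernel t w lam \<omega>)"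
    using Z by (simp add: field_simps)
  then show ?thesis using s by (simp add: s_def[symmetric] m_def[symmetric] field_simps)
qed

text \<open>On the retained space the factor free of \<open>b\<close> is positive and comes out of
  both integrals; elsewhere both sides vanish.\<close>

lemma section_mean_bound:
  assumes good: "good_event L r t w" and lam: "lam \<in> {0..L}" and a: "a \<in> space \<Pi>rest"
  shows "norm (\<integral>b. (p b g * indicator (B \<times> G) (b, g)) *\<^sub>R
      (post_weight t w lam (a(j := (to_rvec b, g)), \<theta>) *\<^sub>R (b - \<beta>cut t w g)) \<partial>lborel) \<le>
    r / sqrt (real (n t)) *
      (\<integral>b. (p b g * indicator (B \<times> G) (b, g)) * post_weight t w lam (a(j := (to_rvec b, g)), \<theta>) \<partial>lborel)"
proof (cases "(a, g, \<theta>) \<in> \<Omega>")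
  case True
  define e where "e = exp (\<Sum>l\<in>{..<ngroups S} - {j}. q2_data S l t w (a l))"
  have g: "gamma_of (a, g, \<theta>) = g" "\<beta>cut t w g = \<beta>hat t w g"
    using gamma_of_\<Omega>[OF True] by (simp_all add: gamma_of_def \<beta>cut_def)
  have "e * norm (\<integral>b. kernel t w lam (a, g, \<theta>) b *\<^sub>R (b - \<beta>hat t w g) \<partial>lborel) \<le>
      e * (r / sqrt (real (n t)) * integral\<^sup>L lborel (kernel t w lam (a, g, \<theta>)))"
    using kernel_mean_bound[OF good lam True] unfolding g by (rule mult_left_mono) (simp add: e_def)
  moreover have "(\<integral>b. (e * kernel t w lam (a, g, \<theta>) b) *\<^sub>R (b - \<beta>hat t w g) \<partial>lborel) =
      e *\<^sub>R (\<integral>b. kernel t w lam (a, g, \<theta>) b *\<^sub>R (b - \<beta>hat t w g) \<partial>lborel)"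
    unfolding integral_scaleR_right[symmetric] by simp
  moreover have "0 < e" by (simp add: e_def)
  ultimately show ?thesis
    unfolding scaleR_scaleR post_weight_split[OF True] e_def[symmetric] g(2)
    by (simp add: mult_ac)
next
  case False
  then show ?thesis
    unfolding scaleR_scaleR post_weight_not_retained[OF a False] by simp
qed

lemma prior_eq:
  "prior S j = distr (density (lborel \<Otimes>\<^sub>M \<mu>) (\<lambda>x. ennreal ((\<lambda>(b, g). p b g * indicator (B \<times> G) (b, g)) x)))
    borel (\<lambda>(b, g). (to_rvec b, g))"
proof -
  have "prior S j = distr (density (lborel \<Otimes>\<^sub>M \<mu>)
      (\<lambda>(b, g). ennreal (p b g) * indicator (B \<times> G) (b, g))) borel (\<lambda>(b, g). (to_rvec b, g))"
    using prior unfolding split_prior_def by (elim conjE)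
  also have "(\<lambda>(b, g). ennreal (p b g) * indicator (B \<times> G) (b, g)) =
      (\<lambda>x. ennreal ((\<lambda>(b, g). p b g * indicator (B \<times> G) (b, g)) x))"
    by (auto simp: indicator_def)
  finally show ?thesis .
qed

lemma \<mu>_prob: "prob_space \<mu>"
  using prior unfolding split_prior_def by (elim conjE)

lemma \<mu>_sets: "sets \<mu> = sets borel"
  using prior unfolding split_prior_def by (elim conjE)

text \<open>The prior of group \<open>j\<close> is the image of a density on
  \<open>lborel \<Otimes>\<^sub>M \<mu>\<close>, whose sections in \<open>b\<close> are those
  already bounded; the weak block is integrated out here.\<close>

lemma prior_mean_bound:
  assumes good: "good_event L r t w" and w: "w \<in> space (pspace S t)"
    and lam: "lam \<in> {0..L}" and a: "a \<in> space \<Pi>rest"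
    and int: "integrable (prior S j) (\<lambda>x. post_weight t w lam (a(j := x), \<theta>) *\<^sub>R (of_rvec (fst x) - \<beta>cut t w (snd x)))"
      "integrable (prior S j) (\<lambda>x. post_weight t w lam (a(j := x), \<theta>))"
  shows "norm (\<integral>x. post_weight t w lam (a(j := x), \<theta>) *\<^sub>R (of_rvec (fst x) - \<beta>cut t w (snd x)) \<partial>prior S j) \<le>
    r / sqrt (real (n t)) * (\<integral>x. post_weight t w lam (a(j := x), \<theta>) \<partial>prior S j)"
proof -
  interpret \<mu>: prob_space \<mu> by (rule \<mu>_prob)
  interpret lborel_\<mu>: pair_sigma_finite "lborel :: (real ^ 'b) measure" \<mu> ..
  define P where "P = (\<lambda>(b, g). p b g * indicator (B \<times> G) (b, g))"
  define T where "T = (\<lambda>(b :: real ^ 'b, g :: rvec). (to_rvec b, g))"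
  define f where "f = (\<lambda>x. post_weight t w lam (a(j := x), \<theta>) *\<^sub>R ((of_rvec (fst x) :: real ^ 'b) - \<beta>cut t w (snd x)))"
  define u where "u = (\<lambda>x. post_weight t w lam (a(j := x), \<theta>))"
  have sets_eq: "sets (lborel \<Otimes>\<^sub>M \<mu>) = sets (borel :: ((real ^ 'b) \<times> rvec) measure)"
    unfolding borel_prod[symmetric] by (rule sets_pair_measure_cong[OF sets_lborel \<mu>_sets])
  have P0: "0 \<le> P x" for x
    using p_nonneg by (auto simp: P_def indicator_def split: prod.split)
  have P: "P \<in> borel_measurable (lborel \<Otimes>\<^sub>M \<mu>)"
    unfolding measurable_cong_sets[OF sets_eq refl] using p_measurable by (simp add: P_def borel_prod)
  have "continuous_on UNIV T"
    unfolding T_def case_prod_beta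
    by (intro continuous_on_Pair continuous_on_compose2[OF continuous_on_to_rvec[of UNIV]]
        continuous_on_fst continuous_on_snd continuous_on_id subset_UNIV)
  then have "T \<in> borel \<rightarrow>\<^sub>M borel" by (rule borel_measurable_continuous_onI)
  then have T: "T \<in> lborel \<Otimes>\<^sub>M \<mu> \<rightarrow>\<^sub>M borel"
    unfolding measurable_cong_sets[OF sets_eq refl] .
  then have T': "T \<in> density (lborel \<Otimes>\<^sub>M \<mu>) (\<lambda>x. ennreal (P x)) \<rightarrow>\<^sub>M borel" by simp
  have prior_eq': "prior S j = distr (density (lborel \<Otimes>\<^sub>M \<mu>) (\<lambda>x. ennreal (P x))) borel T"
    unfolding P_def T_def by (rule prior_eq)
  \<comment> \<open>Stated for a general target space, as it serves both the vector integrand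
    \<open>f\<close> and the scalar mass \<open>u\<close>.\<close>
  have transfer: "integrable (lborel \<Otimes>\<^sub>M \<mu>) (\<lambda>x. P x *\<^sub>R h (T x))"
    "integral\<^sup>L (prior S j) h = (\<integral>x. P x *\<^sub>R h (T x) \<partial>(lborel \<Otimes>\<^sub>M \<mu>))"
    if h: "integrable (prior S j) h" for h :: "rvec \<times> rvec \<Rightarrow> 'd::{banach, second_countable_topology}"
  proof -
    have hm: "h \<in> borel_measurable borel" using h unfolding prior_eq' by auto
    have hT: "(\<lambda>x. h (T x)) \<in> borel_measurable (lborel \<Otimes>\<^sub>M \<mu>)" by (rule measurable_compose[OF T hm])
    have "integrable (density (lborel \<Otimes>\<^sub>M \<mu>) (\<lambda>x. ennreal (P x))) (\<lambda>x. h (T x))"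
      using h unfolding prior_eq' integrable_distr_eq[OF T' hm] .
    then show "integrable (lborel \<Otimes>\<^sub>M \<mu>) (\<lambda>x. P x *\<^sub>R h (T x))"
      by (subst (asm) integrable_density[OF hT P]) (use P0 in auto)
    show "integral\<^sup>L (prior S j) h = (\<integral>x. P x *\<^sub>R h (T x) \<partial>(lborel \<Otimes>\<^sub>M \<mu>))"
      unfolding prior_eq' integral_distr[OF T' hm] using P0 by (intro integral_density[OF hT P]) auto
  qed
  have "norm (\<integral>x. P x *\<^sub>R f (T x) \<partial>(lborel \<Otimes>\<^sub>M \<mu>)) \<le> r / sqrt (real (n t)) * (\<integral>x. P x *\<^sub>R u (T x) \<partial>(lborel \<Otimes>\<^sub>M \<mu>))"
  proof (rule lborel_\<mu>.norm_integral_le_of_sections)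
    show "integrable (lborel \<Otimes>\<^sub>M \<mu>) (\<lambda>x. P x *\<^sub>R f (T x))" "integrable (lborel \<Otimes>\<^sub>M \<mu>) (\<lambda>x. P x *\<^sub>R u (T x))"
      by (rule transfer(1)[OF int(1)[folded f_def]], rule transfer(1)[OF int(2)[folded u_def]])
    show "norm (\<integral>b. P (b, g) *\<^sub>R f (T (b, g)) \<partial>lborel) \<le> r / sqrt (real (n t)) * (\<integral>b. P (b, g) *\<^sub>R u (T (b, g)) \<partial>lborel)" for g
      using section_mean_bound[OF good lam a, of g \<theta>] by (simp add: P_def T_def f_def u_def)
  qed
  then show ?thesis
    using transfer(2)[OF int(1)[folded f_def]] transfer(2)[OF int(2)[folded u_def]] by (simp add: f_def u_def)
qed

lemma coordinate_measurable: "(\<lambda>x :: (nat \<Rightarrow> rvec \<times> rvec) \<times> rvec. fst x j) \<in> borel \<rightarrow>\<^sub>M borel"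
  by (rule borel_measurable_continuous_onI)
    (rule continuous_on_product_then_coordinatewise[OF continuous_on_fst[OF continuous_on_id]])

lemma beta_coordinate_measurable:
  "(\<lambda>x :: (nat \<Rightarrow> rvec \<times> rvec) \<times> rvec. of_rvec (fst (fst x j))) \<in> borel_measurable borel"
  by (rule measurable_compose[OF coordinate_measurable
        borel_measurable_continuous_onI[OF continuous_on_compose2[OF continuous_on_of_rvec[of UNIV]
          continuous_on_fst[OF continuous_on_id] subset_UNIV]]])

lemma \<beta>cut_coordinate_measurable:
  assumes "w \<in> space (pspace S t)"
  shows "(\<lambda>x :: (nat \<Rightarrow> rvec \<times> rvec) \<times> rvec. \<beta>cut t w (snd (fst x j))) \<in> borel_measurable borel"
  by (rule measurable_compose[OF measurable_compose[OF coordinate_measurable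
        borel_measurable_continuous_onI[OF continuous_on_snd[OF continuous_on_id]]] \<beta>cut_measurable[OF assms]])

lemma \<beta>cut_bounded:
  assumes good: "good_event L r t w" and R: "0 < R" "\<And>b. b \<in> B \<Longrightarrow> norm b \<le> R"
  shows "norm (\<beta>cut t w g) \<le> R + \<delta>"
proof (cases "g \<in> G")
  case True
  then have "norm (\<beta>hat t w g - \<beta>0 g) \<le> \<delta>"
    using good unfolding good_event_def by blast
  then show ?thesis
    using True R(2)[OF \<beta>0_in_B[OF True]] norm_triangle_sub[of "\<beta>hat t w g" "\<beta>0 g"]
    by (simp add: \<beta>cut_def)
qed (use R(1) \<delta>_pos in \<open>simp add: \<beta>cut_def\<close>)

text \<open>\<open>f\<close> is bounded, since the parameters lie in compact sets and
  \<open>\<beta>cut\<close> is bounded on the good event; that yields integrability at every Fubini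
  step.\<close>

lemma posterior_mean_bound:
  assumes good: "good_event L r t w" and w: "w \<in> space (pspace S t)" and lam: "lam \<in> {0..L}"
  defines "f \<equiv> \<lambda>x. post_weight t w lam x *\<^sub>R (of_rvec (fst (fst x j)) - \<beta>cut t w (snd (fst x j)))"
  shows "norm (integral\<^sup>L \<Pi>0 f) \<le> r / sqrt (real (n t)) * integral\<^sup>L \<Pi>0 (post_weight t w lam)"
    and "f \<in> borel_measurable borel" and "\<exists>C. \<forall>x. norm (f x) \<le> C"
proof -
  define u where "u = post_weight t w lam"
  have cont: "\<forall>l\<in>{..<ngroups S}. continuous_on (alpha_space S l) (q2_data S l t w)"
    using good unfolding good_event_def by blast
  have u: "u \<in> borel_measurable borel" unfolding u_def by (rule post_weight_measurable[OF cont])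
  show f: "f \<in> borel_measurable borel"
    unfolding f_def using u unfolding u_def
    by (intro borel_measurable_scaleR borel_measurable_diff beta_coordinate_measurable \<beta>cut_coordinate_measurable[OF w])
  obtain C where C: "0 < C" "\<And>x. u x \<le> C"
    unfolding u_def by (rule post_weight_bounded[OF cont, of lam]) blast
  have u0: "0 \<le> u x" for x unfolding u_def by (rule post_weight_nonneg)
  obtain R where R: "0 < R" "\<And>b. b \<in> B \<Longrightarrow> norm b \<le> R" by (rule B_bounded) blast
  have fC: "norm (f x) \<le> C * (2 * R + \<delta>)" for x
  proof (cases "x \<in> K")
    case True
    then have "fst x \<in> (\<Pi>\<^sub>E l\<in>{..<ngroups S}. alpha_space S l)" by (simp add: alphas_def mem_Times_iff)
    then have xj: "fst x j \<in> alpha_space S j" by (rule PiE_mem) (simp add: j)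
    then have "fst (fst x j) \<in> to_rvec ` B"
      by (auto simp: alpha_space_def beta_space_eq mem_Times_iff)
    then have b: "of_rvec (fst (fst x j)) \<in> B" by auto
    have "norm (\<beta>cut t w (snd (fst x j))) \<le> R + \<delta>"
      by (rule \<beta>cut_bounded[OF good R])
    then have "norm (of_rvec (fst (fst x j)) - \<beta>cut t w (snd (fst x j))) \<le> 2 * R + \<delta>"
      using R(2)[OF b] norm_triangle_ineq4[of "of_rvec (fst (fst x j)) :: real ^ 'b" "\<beta>cut t w (snd (fst x j))"] by simp
    then show ?thesis
      using C(2)[of x] u0[of x] by (auto simp: f_def u_def[symmetric] intro!: mult_mono)
  next
    case False
    then show ?thesis
      using post_weight_outside[OF False] C(1) R(1) \<delta>_pos by (simp add: f_def)
  qed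
  then show "\<exists>C. \<forall>x. norm (f x) \<le> C" by blast
  interpret \<Pi>\<alpha>: prob_space \<Pi>\<alpha> by (rule prob_space_\<Pi>\<alpha>)
  interpret rest: prob_space \<Pi>rest by (rule prob_space_\<Pi>rest)
  interpret priorj: prob_space "prior S j" by (rule prior_prob[OF j j])
  interpret theta: prob_space "prior_theta S" by (rule theta_prob)
  interpret at: pair_prob_space \<Pi>\<alpha> "prior_theta S" ..
  interpret jr: pair_prob_space "prior S j" \<Pi>rest ..
  have "prob_space \<Pi>0" by (rule prob_space_\<Pi>0)
  \<comment> \<open>The levels carry different measures and sigma-algebras; the map \<open>X\<close>
    into the Borel space lets one statement cover them all.\<close>
  have bounded_integrable: "integrable N (\<lambda>x. h (X x))"
    if "prob_space N" "X \<in> N \<rightarrow>\<^sub>M borel" "h \<in> borel_measurable borel" "\<And>x. norm (h x) \<le> c"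
    for N :: "'n measure" and X :: "'n \<Rightarrow> (nat \<Rightarrow> rvec \<times> rvec) \<times> rvec"
      and h :: "(nat \<Rightarrow> rvec \<times> rvec) \<times> rvec \<Rightarrow> 'd::{banach, second_countable_topology}" and c
  proof -
    interpret N: prob_space N by fact
    show ?thesis
      using that(4) by (intro N.integrable_const_bound[of _ c] measurable_compose[OF that(2,3)]) auto
  qed
  have uC: "norm (u x) \<le> C" for x using C(2) u0 by simp
  have \<alpha>_meas: "(\<lambda>\<alpha>. (\<alpha>, \<theta>)) \<in> \<Pi>\<alpha> \<rightarrow>\<^sub>M borel" for \<theta> :: rvec
  proof -
    have "(\<lambda>\<alpha>. (\<alpha>, \<theta>)) \<in> \<Pi>\<alpha> \<rightarrow>\<^sub>M borel \<Otimes>\<^sub>M borel"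
      using measurable_PiM_imp_borel[of "{..<ngroups S}" "prior S"] prior_sets by (intro measurable_Pair) auto
    then show ?thesis by (simp add: borel_prod)
  qed
  have upd: "(\<lambda>(x, X). X(j := x)) \<in> prior S j \<Otimes>\<^sub>M \<Pi>rest \<rightarrow>\<^sub>M \<Pi>\<alpha>"
    unfolding case_prod_beta using j
    by (intro measurable_fun_upd[of _ "{..<ngroups S} - {j}"]) auto
  have ins: "insert j ({..<ngroups S} - {j}) = {..<ngroups S}" using j by auto
  \<comment> \<open>Writes the joint prior as an image of group \<open>j\<close> times the rest,
    which makes group \<open>j\<close> the inner variable.\<close>
  have \<Pi>\<alpha>_eq: "\<Pi>\<alpha> = distr (prior S j \<Otimes>\<^sub>M \<Pi>rest) \<Pi>\<alpha> (\<lambda>(x, X). X(j := x))"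
    using distr_pair_PiM_eq_PiM[of "{..<ngroups S} - {j}" "prior S" j] prior_prob j unfolding ins by simp
  have level: "norm (\<integral>\<alpha>. f (\<alpha>, \<theta>) \<partial>\<Pi>\<alpha>) \<le> r / sqrt (real (n t)) * (\<integral>\<alpha>. u (\<alpha>, \<theta>) \<partial>\<Pi>\<alpha>)" for \<theta>
  proof -
    have upd': "(\<lambda>x. ((case x of (x, X) \<Rightarrow> X(j := x)), \<theta>)) \<in> prior S j \<Otimes>\<^sub>M \<Pi>rest \<rightarrow>\<^sub>M borel"
      by (rule measurable_compose[OF upd \<alpha>_meas])
    have "norm (\<integral>x. f ((case x of (x, X) \<Rightarrow> X(j := x)), \<theta>) \<partial>(prior S j \<Otimes>\<^sub>M \<Pi>rest)) \<le>
        r / sqrt (real (n t)) * (\<integral>x. u ((case x of (x, X) \<Rightarrow> X(j := x)), \<theta>) \<partial>(prior S j \<Otimes>\<^sub>M \<Pi>rest))"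
    proof (rule jr.norm_integral_le_of_sections)
      show "integrable (prior S j \<Otimes>\<^sub>M \<Pi>rest) (\<lambda>x. f ((case x of (x, X) \<Rightarrow> X(j := x)), \<theta>))"
        by (rule bounded_integrable[OF jr.prob_space_axioms upd' f fC])
      show "integrable (prior S j \<Otimes>\<^sub>M \<Pi>rest) (\<lambda>x. u ((case x of (x, X) \<Rightarrow> X(j := x)), \<theta>))"
        by (rule bounded_integrable[OF jr.prob_space_axioms upd' u uC])
    next
      fix a assume a: "a \<in> space \<Pi>rest"
      have "continuous_on UNIV (\<lambda>x. (a(j := x), \<theta>))"
        by (rule continuous_on_Pair[OF continuous_on_fun_upd[OF continuous_on_const continuous_on_id] continuous_on_const])
      then have "(\<lambda>x. (a(j := x), \<theta>)) \<in> borel \<rightarrow>\<^sub>M borel" by (rule borel_measurable_continuous_onI)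
      then have am: "(\<lambda>x. (a(j := x), \<theta>)) \<in> prior S j \<rightarrow>\<^sub>M borel"
        unfolding measurable_cong_sets[OF prior_sets[OF j j] refl] .
      have "integrable (prior S j) (\<lambda>x. f (a(j := x), \<theta>))" "integrable (prior S j) (\<lambda>x. u (a(j := x), \<theta>))"
        by (rule bounded_integrable[OF priorj.prob_space_axioms am f fC],
            rule bounded_integrable[OF priorj.prob_space_axioms am u uC])
      then show "norm (\<integral>x. f ((case (x, a) of (x, X) \<Rightarrow> X(j := x)), \<theta>) \<partial>prior S j) \<le>
          r / sqrt (real (n t)) * (\<integral>x. u ((case (x, a) of (x, X) \<Rightarrow> X(j := x)), \<theta>) \<partial>prior S j)"
        using prior_mean_bound[OF good w lam a, of \<theta>] by (simp add: f_def u_def)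
    qed
    moreover have "(\<integral>\<alpha>. f (\<alpha>, \<theta>) \<partial>\<Pi>\<alpha>) = (\<integral>x. f ((case x of (x, X) \<Rightarrow> X(j := x)), \<theta>) \<partial>(prior S j \<Otimes>\<^sub>M \<Pi>rest))"
      by (subst \<Pi>\<alpha>_eq, rule integral_distr[OF upd measurable_compose[OF \<alpha>_meas f]])
    moreover have "(\<integral>\<alpha>. u (\<alpha>, \<theta>) \<partial>\<Pi>\<alpha>) = (\<integral>x. u ((case x of (x, X) \<Rightarrow> X(j := x)), \<theta>) \<partial>(prior S j \<Otimes>\<^sub>M \<Pi>rest))"
      by (subst \<Pi>\<alpha>_eq, rule integral_distr[OF upd measurable_compose[OF \<alpha>_meas u]])
    ultimately show ?thesis by simp
  qed
  have "norm (integral\<^sup>L \<Pi>0 f) \<le> r / sqrt (real (n t)) * integral\<^sup>L \<Pi>0 u"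
    by (rule at.norm_integral_le_of_sections[OF bounded_integrable[OF prob_space_\<Pi>0 measurable_\<Pi>0_borel f fC]
          bounded_integrable[OF prob_space_\<Pi>0 measurable_\<Pi>0_borel u uC] level])
  then show "norm (integral\<^sup>L \<Pi>0 f) \<le> r / sqrt (real (n t)) * integral\<^sup>L \<Pi>0 (post_weight t w lam)"
    by (simp add: u_def)
qed

text \<open>The regular block minus \<open>v\<close> is split at the conditional maximizer. The
  first part has posterior mean of norm at most \<open>r\<close> over the square root of the sample
  size; the second depends on the weak block alone, so its norm is integrated against
  \<open>weak_marginal\<close>.\<close>

lemma beta_tilde_bound:
  fixes v :: "real ^ 'b"
  assumes good: "good_event L r t w" and w: "w \<in> space (pspace S t)" and lam: "lam \<in> {0..L}"
  shows "ennreal (sqrt (real (n t)) * norm (beta_tilde S j t w lam - v)) \<le>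
    ennreal r + (\<integral>\<^sup>+\<gamma>. ennreal (sqrt (real (n t)) * norm (\<beta>hat t w (\<gamma> j) - v)) \<partial>weak_marginal S t w lam)"
proof -
  define s where "s = sqrt (real (n t))"
  define W where "W = post_weight t w lam"
  define U where "U = (\<lambda>x :: (nat \<Rightarrow> rvec \<times> rvec) \<times> rvec. of_rvec (fst (fst x j)) :: real ^ 'b)"
  define V where "V = (\<lambda>x :: (nat \<Rightarrow> rvec \<times> rvec) \<times> rvec. \<beta>cut t w (snd (fst x j)))"
  define Z where "Z = integral\<^sup>L \<Pi>0 W"
  define full where "full = full_posterior S t w lam"
  interpret P: prob_space \<Pi>0 by (rule prob_space_\<Pi>0)
  have s: "0 < s" using good by (simp add: s_def good_event_def)
  have cont: "\<forall>l\<in>{..<ngroups S}. continuous_on (alpha_space S l) (q2_data S l t w)"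
    using good unfolding good_event_def by blast
  have W: "integrable \<Pi>0 W" "0 < Z"
    using post_weight_integrable[OF cont] by (simp_all add: W_def Z_def)
  have W0: "0 \<le> W x" for x unfolding W_def by (rule post_weight_nonneg)
  have full: "full = normalized \<Pi>0 W" unfolding full_def W_def by (rule full_posterior_eq)
  have sets_full: "sets full = sets \<Pi>0" unfolding full normalized_def by simp
  have Um: "U \<in> borel_measurable \<Pi>0" and Vm: "V \<in> borel_measurable \<Pi>0"
    unfolding U_def V_def
    by (rule measurable_compose[OF measurable_\<Pi>0_borel beta_coordinate_measurable],
        rule measurable_compose[OF measurable_\<Pi>0_borel \<beta>cut_coordinate_measurable[OF w]])
  have Wm: "W \<in> borel_measurable \<Pi>0" using W(1) by auto
  note post = posterior_mean_bound[OF good w lam, folded W_def]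
  obtain C where C: "\<And>x. norm (W x *\<^sub>R (U x - V x)) \<le> C"
    using post(3) unfolding U_def V_def by blast
  have f_int: "integrable \<Pi>0 (\<lambda>x. W x *\<^sub>R (U x - V x))"
    using C Um Vm Wm by (intro P.integrable_const_bound[of _ C] borel_measurable_scaleR borel_measurable_diff) auto
  have f_le: "norm (\<integral>x. W x *\<^sub>R (U x - V x) \<partial>\<Pi>0) \<le> r / s * Z"
    using post(1) by (simp add: U_def V_def s_def Z_def)
  obtain R where R: "0 < R" "\<And>b. b \<in> B \<Longrightarrow> norm b \<le> R" by (rule B_bounded) blast
  have V_le: "norm (V x) \<le> R + \<delta>" for x unfolding V_def by (rule \<beta>cut_bounded[OF good R])
  have "norm (W x *\<^sub>R V x) \<le> norm ((R + \<delta>) * W x)" for x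
    using mult_right_mono[OF V_le W0] W0[of x] R(1) \<delta>_pos by (simp add: abs_mult mult.commute)
  then have V_int: "integrable \<Pi>0 (\<lambda>x. W x *\<^sub>R V x)"
    using W(1) Wm Vm by (intro Bochner_Integration.integrable_bound[OF integrable_mult_right[OF W(1), of "R + \<delta>"]]) auto
  have v_int: "integrable \<Pi>0 (\<lambda>x. W x *\<^sub>R (V x - v))"
    unfolding scaleR_right_diff_distrib using V_int W(1)
    by (intro Bochner_Integration.integrable_diff integrable_scaleR_left) auto
  have "beta_tilde S j t w lam = (1 / Z) *\<^sub>R (\<integral>x. W x *\<^sub>R U x \<partial>\<Pi>0)"
    using integral_normalized[OF W(1) W0 _ Um] W(2)
    unfolding beta_tilde_def full_def[symmetric] full Z_def by (simp add: U_def case_prod_beta')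
  moreover have "(\<integral>x. W x *\<^sub>R U x \<partial>\<Pi>0) = (\<integral>x. W x *\<^sub>R (U x - V x) + (W x *\<^sub>R (V x - v) + W x *\<^sub>R v) \<partial>\<Pi>0)"
    by (intro Bochner_Integration.integral_cong) (simp_all add: algebra_simps)
  moreover have "\<dots> = (\<integral>x. W x *\<^sub>R (U x - V x) \<partial>\<Pi>0) + ((\<integral>x. W x *\<^sub>R (V x - v) \<partial>\<Pi>0) + Z *\<^sub>R v)"
    using f_int v_int W(1) unfolding Z_def by simp
  moreover have "(\<integral>x. V x - v \<partial>full) = (1 / Z) *\<^sub>R (\<integral>x. W x *\<^sub>R (V x - v) \<partial>\<Pi>0)"
    unfolding full Z_def using W(2) Vm by (intro integral_normalized[OF W(1) W0]) (auto simp: Z_def)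
  ultimately have "beta_tilde S j t w lam - v = (1 / Z) *\<^sub>R (\<integral>x. W x *\<^sub>R (U x - V x) \<partial>\<Pi>0) + (\<integral>x. V x - v \<partial>full)"
    using W(2) by (simp add: scaleR_add_right)
  then have "norm (beta_tilde S j t w lam - v) \<le> norm (\<integral>x. W x *\<^sub>R (U x - V x) \<partial>\<Pi>0) / Z + norm (\<integral>x. V x - v \<partial>full)"
    using norm_triangle_ineq[of "(1 / Z) *\<^sub>R (\<integral>x. W x *\<^sub>R (U x - V x) \<partial>\<Pi>0)"] W(2) by simp
  also have "norm (\<integral>x. W x *\<^sub>R (U x - V x) \<partial>\<Pi>0) / Z \<le> r / s"
    using f_le W(2) by (simp add: pos_divide_le_eq)
  finally have "s * norm (beta_tilde S j t w lam - v) \<le> s * (r / s + norm (\<integral>x. V x - v \<partial>full))"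
    using s by (intro mult_left_mono) auto
  also have "\<dots> = r + s * norm (\<integral>x. V x - v \<partial>full)"
    using s by (simp add: distrib_left)
  finally have "ennreal (s * norm (beta_tilde S j t w lam - v)) \<le> ennreal (r + s * norm (\<integral>x. V x - v \<partial>full))"
    by (rule ennreal_leI)
  also have "\<dots> \<le> ennreal r + ennreal (s * norm (\<integral>x. V x - v \<partial>full))"
    \<comment> \<open>The sign of \<open>r\<close> is not fixed; for negative \<open>r\<close>,
      \<open>ennreal r\<close> is 0.\<close>
    using s by (cases "0 \<le> r") (auto simp: ennreal_neg intro!: ennreal_leI)
  also have "ennreal (s * norm (\<integral>x. V x - v \<partial>full)) \<le>
      (\<integral>\<^sup>+\<gamma>. ennreal (s * norm (\<beta>hat t w (\<gamma> j) - v)) \<partial>weak_marginal S t w lam)"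
  proof -
    define X where "X = (\<lambda>x :: (nat \<Rightarrow> rvec \<times> rvec) \<times> rvec. \<lambda>l\<in>{..<ngroups S}. snd (fst x l))"
    define h where "h = (\<lambda>\<gamma> :: nat \<Rightarrow> rvec. ennreal (s * norm (\<beta>cut t w (\<gamma> j) - v)))"
    have "(\<lambda>x. snd (fst x l)) \<in> \<Pi>0 \<rightarrow>\<^sub>M borel" for l
    proof (rule measurable_compose[OF measurable_\<Pi>0_borel])
      show "(\<lambda>x :: (nat \<Rightarrow> rvec \<times> rvec) \<times> rvec. snd (fst x l)) \<in> borel \<rightarrow>\<^sub>M borel"
        by (rule borel_measurable_continuous_onI[OF continuous_on_snd[OF
              continuous_on_product_then_coordinatewise[OF continuous_on_fst[OF continuous_on_id]]]])
    qed
    then have "X \<in> \<Pi>0 \<rightarrow>\<^sub>M (\<Pi>\<^sub>M l\<in>{..<ngroups S}. borel)"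
      unfolding X_def by (rule measurable_restrict)
    then have X: "X \<in> full \<rightarrow>\<^sub>M (\<Pi>\<^sub>M l\<in>{..<ngroups S}. borel)"
      unfolding measurable_cong_sets[OF sets_full refl] .
    have weak: "weak_marginal S t w lam = distr full (\<Pi>\<^sub>M l\<in>{..<ngroups S}. borel) X"
      unfolding weak_marginal_def full_def X_def case_prod_beta' ..
    have comp: "(\<lambda>\<gamma>. \<gamma> j) \<in> (\<Pi>\<^sub>M l\<in>{..<ngroups S}. borel) \<rightarrow>\<^sub>M (borel :: rvec measure)"
      by (rule measurable_component_singleton) (simp add: j)
    have "(\<lambda>\<gamma> :: nat \<Rightarrow> rvec. \<beta>cut t w (\<gamma> j)) \<in> borel_measurable (\<Pi>\<^sub>M l\<in>{..<ngroups S}. borel)"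
      by (rule measurable_compose[OF comp \<beta>cut_measurable[OF w]])
    then have "(\<lambda>\<gamma>. s * norm (\<beta>cut t w (\<gamma> j) - v)) \<in> borel_measurable (\<Pi>\<^sub>M l\<in>{..<ngroups S}. borel)"
      by (intro borel_measurable_times borel_measurable_const measurable_compose[OF _ borel_measurable_norm]
          borel_measurable_diff)
    then have h: "h \<in> borel_measurable (\<Pi>\<^sub>M l\<in>{..<ngroups S}. borel)"
      unfolding h_def by (rule measurable_compose[OF _ measurable_ennreal])
    have "ennreal (norm (\<integral>x. V x - v \<partial>full)) \<le> (\<integral>\<^sup>+x. ennreal (norm (V x - v)) \<partial>full)"
    \<comment> \<open>A non-integrable integrand has integral 0 by convention, so the inequality
      holds in either case.\<close>
    proof (cases "integrable full (\<lambda>x. V x - v)")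
      case True
      then show ?thesis by (rule integral_norm_bound_ennreal)
    qed (simp add: not_integrable_integral_eq)
    then have "ennreal s * ennreal (norm (\<integral>x. V x - v \<partial>full)) \<le> ennreal s * (\<integral>\<^sup>+x. ennreal (norm (V x - v)) \<partial>full)"
      by (rule mult_left_mono) simp
    also have "\<dots> = (\<integral>\<^sup>+x. ennreal s * ennreal (norm (V x - v)) \<partial>full)"
    proof (rule nn_integral_cmult[symmetric])
      have "V \<in> borel_measurable full" unfolding measurable_cong_sets[OF sets_full refl] by (rule Vm)
      then have "(\<lambda>x. norm (V x - v)) \<in> borel_measurable full"
        by (intro measurable_compose[OF _ borel_measurable_norm] borel_measurable_diff borel_measurable_const)
      then show "(\<lambda>x. ennreal (norm (V x - v))) \<in> borel_measurable full"
        by (rule measurable_compose[OF _ measurable_ennreal])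
    qed
    also have "\<dots> = (\<integral>\<^sup>+x. h (X x) \<partial>full)"
      using s j by (intro nn_integral_cong) (simp add: h_def X_def V_def ennreal_mult)
    also have "\<dots> = (\<integral>\<^sup>+\<gamma>. h \<gamma> \<partial>weak_marginal S t w lam)"
      unfolding weak using h by (intro nn_integral_distr[OF X, symmetric]) simp
    also have "\<dots> \<le> (\<integral>\<^sup>+\<gamma>. ennreal (s * norm (\<beta>hat t w (\<gamma> j) - v)) \<partial>weak_marginal S t w lam)"
    \<comment> \<open>\<open>\<beta>cut\<close> and \<open>\<beta>hat\<close> agree on
      \<open>G\<close>, and the posterior puts the weak block there almost surely. The comparison
      asks no measurability of the integrand in \<open>\<beta>hat\<close>.\<close>
    proof (rule nn_integral_mono_AE)
      have "AE x in full. x \<in> K"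
        unfolding full normalized_def
        by (subst AE_density) (use Wm AE_\<Pi>0_K in \<open>auto elim: eventually_mono\<close>)
      then have "AE x in full. X x j \<in> G"
      proof eventually_elim
        fix x assume "x \<in> K"
        then have "fst x \<in> (\<Pi>\<^sub>E l\<in>{..<ngroups S}. alpha_space S l)" by (simp add: alphas_def mem_Times_iff)
        then have "fst x j \<in> alpha_space S j" by (rule PiE_mem) (simp add: j)
        then show "X x j \<in> G" using j by (simp add: X_def alpha_space_def mem_Times_iff)
      qed
      moreover have "{\<gamma> \<in> space (\<Pi>\<^sub>M l\<in>{..<ngroups S}. borel). \<gamma> j \<in> G} \<in> sets (\<Pi>\<^sub>M l\<in>{..<ngroups S}. borel)"
        using measurable_sets[OF comp borel_G] by (simp add: vimage_def Int_def conj_commute)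
      ultimately have "AE \<gamma> in weak_marginal S t w lam. \<gamma> j \<in> G"
        unfolding weak by (subst AE_distr_iff[OF X])
      then show "AE \<gamma> in weak_marginal S t w lam. h \<gamma> \<le> ennreal (s * norm (\<beta>hat t w (\<gamma> j) - v))"
        by eventually_elim (simp add: h_def \<beta>cut_def)
    qed
    finally show ?thesis using s by (simp add: ennreal_mult)
  qed
  finally show ?thesis by (simp add: s_def add_left_mono)
qed

end

section \<open>Collecting the uniform limits\<close>

theorem propositionA2:
  fixes S :: "('w, 'x, 'z) grouped_problem" and j :: nat
    and M :: "real ^ 'b \<Rightarrow> rvec \<Rightarrow> real" and \<beta>0 :: "rvec \<Rightarrow> real ^ 'b" and \<delta> :: real
    and p :: "real ^ 'b \<Rightarrow> rvec \<Rightarrow> real" and \<mu> :: "rvec measure"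
    and \<beta>hat :: "nat \<Rightarrow> 'w \<Rightarrow> rvec \<Rightarrow> real ^ 'b"
  assumes "well_formed S" and "setup_cond S"
    and "j < ngroups S" and "dim_beta S j = CARD('b)"
    and "split_prior S j p \<mu>"
    and "mixed_strong S j M \<beta>0 \<delta> p"
    and "conditional_maximizer S j \<beta>0 \<delta> \<beta>hat"
  shows "small_op1 (pspace S) (\<lambda>t w. SUP lam\<in>tuning_set S. SUP \<omega>\<in>retained_space S j.
           d_BL (PS S j p \<beta>hat t w lam \<omega>) (mvnormal 0 (matrix_inv (H_mat M \<beta>0 (gamma_of \<omega>))))) \<and>
         small_op1 (pspace S) (\<lambda>t w. SUP \<omega>\<in>retained_space S j.
           d_BL (PS S j p \<beta>hat t w 0 \<omega>) (mvnormal 0 (matrix_inv (H_mat M \<beta>0 (gamma_of \<omega>))))) \<and>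
         small_op1 (pspace S) (\<lambda>t w.
           (SUP lam\<in>tuning_set S. SUP \<omega>\<in>retained_space S j.
              ennreal (norm (\<integral>h. h \<partial>PS S j p \<beta>hat t w lam \<omega>))) +
           (SUP \<omega>\<in>retained_space S j. ennreal (norm (\<integral>h. h \<partial>PS S j p \<beta>hat t w 0 \<omega>)))) \<and>
         (\<forall>\<beta>un :: nat \<Rightarrow> 'w \<Rightarrow> real ^ 'b.
           (\<forall>t. \<beta>un t \<in> borel_measurable (pspace S t)) \<longrightarrow>
           small_op1 (pspace S) (\<lambda>t w. SUP lam\<in>tuning_set S.
             (\<integral>\<^sup>+ \<gamma>. ennreal (sqrt (real (sample_size S t j)) * norm (\<beta>hat t w (\<gamma> j) - \<beta>un t w))
                \<partial>weak_marginal S t w lam)) \<longrightarrow>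
           small_op1 (pspace S) (\<lambda>t w. SUP lam\<in>tuning_set S.
             ennreal (sqrt (real (sample_size S t j)) * norm (beta_tilde S j t w lam - \<beta>un t w))))"
proof -
  interpret split_group S j M \<beta>0 \<delta> p \<mu> \<beta>hat
    by unfold_locales (fact assms)+
  have "\<exists>b. tuning_set S \<subseteq> {0..b}"
    using assms(2) unfolding setup_cond_def by (elim conjE)
  then obtain b where b: "tuning_set S \<subseteq> {0..b}" by blast
  \<comment> \<open>The maximum keeps 0 in the interval even if \<open>b\<close> is negative, which
    is possible for an empty tuning set.\<close>
  define L where "L = max 0 b"
  have tuning: "lam \<in> {0..L}" if "lam \<in> tuning_set S" for lam
    using subsetD[OF b that] by (simp add: L_def)
  have zero: "0 \<in> {0..L}" by (simp add: L_def)
  have dBL: "d_BL (PS S j p \<beta>hat t w lam \<omega>) (mvnormal 0 (matrix_inv (H_mat M \<beta>0 (gamma_of \<omega>)))) \<le> ennreal r"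
    and mean: "ennreal (norm (\<integral>h. h \<partial>PS S j p \<beta>hat t w lam \<omega>)) \<le> ennreal r"
    if "good_event L r t w" "lam \<in> {0..L}" "\<omega> \<in> retained_space S j" for r t w lam \<omega>
    using that unfolding good_event_def by (blast, blast intro: ennreal_leI)
  \<comment> \<open>The event is taken at \<open>r / 2\<close> since the third claim adds two
    suprema; for the first two this is merely generous.\<close>
  have op1: "small_op1 (pspace S) Y"
    if "\<And>r t w. 0 < r \<Longrightarrow> good_event L (r / 2) t w \<Longrightarrow> Y t w \<le> ennreal r" for Y
    unfolding small_op1_def
  proof (intro allI impI)
    fix r :: real assume r: "0 < r"
    then have "wpa1 (pspace S) (good_event L (r / 2))" by (intro wpa1_good_event) simp
    then show "wpa1 (pspace S) (\<lambda>t w. Y t w \<le> ennreal r)"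
      by (rule wpa1_mono, intro always_eventually allI ballI impI) (rule that[OF r])
  qed
  have half: "x \<le> ennreal r" if "x \<le> ennreal (r / 2)" "0 < r" for x and r :: real
    by (rule order_trans[OF that(1) ennreal_leI]) (use that(2) in simp)
  have "small_op1 (pspace S) (\<lambda>t w. SUP lam\<in>tuning_set S. SUP \<omega>\<in>retained_space S j.
      d_BL (PS S j p \<beta>hat t w lam \<omega>) (mvnormal 0 (matrix_inv (H_mat M \<beta>0 (gamma_of \<omega>)))))"
    by (rule op1, intro SUP_least, rule half[OF dBL[OF _ tuning]])
  moreover have "small_op1 (pspace S) (\<lambda>t w. SUP \<omega>\<in>retained_space S j.
      d_BL (PS S j p \<beta>hat t w 0 \<omega>) (mvnormal 0 (matrix_inv (H_mat M \<beta>0 (gamma_of \<omega>)))))"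
    by (rule op1, intro SUP_least, rule half[OF dBL[OF _ zero]])
  moreover have "small_op1 (pspace S) (\<lambda>t w.
      (SUP lam\<in>tuning_set S. SUP \<omega>\<in>retained_space S j. ennreal (norm (\<integral>h. h \<partial>PS S j p \<beta>hat t w lam \<omega>))) +
      (SUP \<omega>\<in>retained_space S j. ennreal (norm (\<integral>h. h \<partial>PS S j p \<beta>hat t w 0 \<omega>))))"
  proof (rule op1)
    fix r :: real and t w assume r: "0 < r" and good: "good_event L (r / 2) t w"
    have "(SUP lam\<in>tuning_set S. SUP \<omega>\<in>retained_space S j. ennreal (norm (\<integral>h. h \<partial>PS S j p \<beta>hat t w lam \<omega>))) +
        (SUP \<omega>\<in>retained_space S j. ennreal (norm (\<integral>h. h \<partial>PS S j p \<beta>hat t w 0 \<omega>))) \<le> ennreal (r / 2) + ennreal (r / 2)"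
      by (intro add_mono SUP_least mean[OF good tuning] mean[OF good zero])
    also have "\<dots> = ennreal r" using r by (simp flip: ennreal_plus)
    finally show "(SUP lam\<in>tuning_set S. SUP \<omega>\<in>retained_space S j. ennreal (norm (\<integral>h. h \<partial>PS S j p \<beta>hat t w lam \<omega>))) +
        (SUP \<omega>\<in>retained_space S j. ennreal (norm (\<integral>h. h \<partial>PS S j p \<beta>hat t w 0 \<omega>))) \<le> ennreal r" .
  qed
  moreover have "small_op1 (pspace S) (\<lambda>t w. SUP lam\<in>tuning_set S.
      ennreal (sqrt (real (sample_size S t j)) * norm (beta_tilde S j t w lam - \<beta>un t w)))"
    if profiled: "small_op1 (pspace S) (\<lambda>t w. SUP lam\<in>tuning_set S.
      (\<integral>\<^sup>+ \<gamma>. ennreal (sqrt (real (sample_size S t j)) * norm (\<beta>hat t w (\<gamma> j) - \<beta>un t w)) \<partial>weak_marginal S t w lam))"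
    for \<beta>un :: "nat \<Rightarrow> 'w \<Rightarrow> real ^ 'b"
    unfolding small_op1_def
  proof (intro allI impI)
    fix r :: real assume r: "0 < r"
    then have r2: "0 < r / 2" by simp
    \<comment> \<open>One \<open>r / 2\<close> comes from the conditional means, the other from the
      assumption on the profiled estimator.\<close>
    have "wpa1 (pspace S) (\<lambda>t w. good_event L (r / 2) t w \<and> (\<forall>lam\<in>tuning_set S.
        (\<integral>\<^sup>+ \<gamma>. ennreal (sqrt (real (sample_size S t j)) * norm (\<beta>hat t w (\<gamma> j) - \<beta>un t w)) \<partial>weak_marginal S t w lam)
          \<le> ennreal (r / 2)))"
      by (rule wpa1_conj[OF prob_space_pspace wpa1_good_event[OF r2] small_op1_SUP[OF profiled r2]])
    then show "wpa1 (pspace S) (\<lambda>t w. (SUP lam\<in>tuning_set S.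
        ennreal (sqrt (real (sample_size S t j)) * norm (beta_tilde S j t w lam - \<beta>un t w))) \<le> ennreal r)"
    proof (rule wpa1_mono, intro always_eventually allI ballI impI SUP_least, elim conjE)
      fix t w lam assume w: "w \<in> space (pspace S t)" and lam: "lam \<in> tuning_set S"
        and good: "good_event L (r / 2) t w"
        and le: "\<forall>lam\<in>tuning_set S.
          (\<integral>\<^sup>+ \<gamma>. ennreal (sqrt (real (sample_size S t j)) * norm (\<beta>hat t w (\<gamma> j) - \<beta>un t w)) \<partial>weak_marginal S t w lam)
            \<le> ennreal (r / 2)"
      have "ennreal (sqrt (real (sample_size S t j)) * norm (beta_tilde S j t w lam - \<beta>un t w)) \<le>
          ennreal (r / 2) + ennreal (r / 2)"
        by (rule order_trans[OF beta_tilde_bound[OF good w tuning[OF lam]] add_left_mono[OF bspec[OF le lam]]])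
      also have "\<dots> = ennreal r" using r by (simp flip: ennreal_plus)
      finally show "ennreal (sqrt (real (sample_size S t j)) * norm (beta_tilde S j t w lam - \<beta>un t w)) \<le> ennreal r" .
    qed
  qed
  ultimately show ?thesis by blast
qed

end
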